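(* Let $\mathcal M=1$, $\mathcal N=2$ and $\hat K=\begin{pmatrix}0&0\\0&K_2\end{pmatrix}$ with $K_2$ an invertible diagonalizable $2\times2$ matrix with eigenvalues $\mathsf k_2\ne\mathsf k_3$, $\mathsf k_2\mathsf k_3\ne0$. For almost every choice of inhomogeneities with $\xi_a-\xi_b\notin\eta\mathbb Z$ ($a\ne b$), the set of eigenvalues of $T^{(\hat K)}_1(\lambda)$ equals $$\Sigma=\Big\{t_1(\lambda)=-(\mathsf k_2+\mathsf k_3)d(\lambda)+\sum_{a=1}^{\mathsf N}f^{(1)}_a(\lambda)x_a\ :\ (x_1,\dots,x_{\mathsf N})\in S\Big\},$$ where $S$ is the set of solutions $(x_1,\dots,x_{\mathsf N})\in\mathbb C^{\mathsf N}$ of the system of $\mathsf N$ cubic equations $$x_a\Big[\mathsf k_2\mathsf k_3\,d(\xi_a+\eta)+\sum_{r=1}^{\mathsf N}f^{(2)}_r(\xi_a+\eta)\,t_1(\xi_r+\eta)\,x_r\Big]=0,\qquad a=1,\dots,\mathsf N,$$ with $t_1(\lambda)=-(\mathsf k_2+\mathsf k_3)d(\lambda)+\sum_{a}f^{(1)}_a(\lambda)x_a$. Moreover $T^{(\hat K)}_1(\lambda)$ is diagonalizable with simple spectrum, and for each $t_1\in\Sigma$ the unique (up to normalization) eigenvector $|t\rangle$ satisfies $\langle h_1,\dots,h_{\mathsf N}|t\rangle=\prod_{n=1}^{\mathsf N}t_1(\xi_n)^{h_n}$ for all $(h_1,\dots,h_{\mathsf N})\in\{0,1,2\}^{\mathsf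 N}$, where $\langle h_1,\dots,h_{\mathsf N}|=\langle S|\prod_{n}(T^{(\hat K)}_1(\xi_n))^{h_n}$ is the SoV covector basis (for a generic covector $\langle S|$).
   Context: Fix a nonzero complex number $\eta$, an integer $\mathsf N\ge1$ and complex inhomogeneities $\xi_1,\dots,\xi_{\mathsf N}$. Let $V=\mathbb C^{1|2}$ be the super vector space with homogeneous basis $v_1,v_2,v_3$, $v_1$ even and $v_2,v_3$ odd ($\bar1=0$, $\bar2=\bar3=1$); let $e^j_i\in\operatorname{End}V$ be defined by $e^j_iv_k=\delta_{jk}v_i$. Tensor products are graded: $(a_1\otimes b_1)(a_2\otimes b_2)=(-1)^{\bar b_1\bar a_2}a_1a_2\otimes b_1b_2$ and $(a\otimes b)(v\otimes w)=(-1)^{\bar b\bar v}av\otimes bw$. The graded permutation is $\mathbb P=\sum_{\alpha,\beta}(-1)^{\bar\beta}e^\beta_\alpha\otimes e^\alpha_\beta$; the supertrace is $\operatorname{str}(e^j_i)=(-1)^{\bar j}\delta_{ij}$; $R(\lambda)=\lambda\,\mathbb I\otimes\mathbb I+\eta\mathbb P$. For a twist $K=\operatorname{diag}(\mathsf k_1,K_2)$ (with $K_2$ a $2\times2$ block), $\mathcal H=V_1\otimes\cdots\otimes V_{\mathsf N}$, the monodromy is $M^{(K)}_0(\lambda)=K_0R_{0\mathsf N}(\lambda-\xi_{\mathsf N})\cdots R_{01}(\lambda-\xi_1)$ and $T^{(K)}_1(\lambda)=\operatorname{str}_0M^{(K)}_0(\lambda)$. Write $d(\lambda)=\prod_{n=1}^{\mathsf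 N}(\lambda-\xi_n)$. Let $f^{(m)}_a(\lambda)=\prod_{b\ne a}\frac{\lambda-\xi_b}{\xi_a-\xi_b}\prod_{b=1}^{\mathsf N}\prod_{r=1}^{m-1}\frac{1}{\xi_a-\xi_b+r\eta}$. "Almost every" means outside a proper algebraic subset of parameter space. *)

theory Defs
  imports "HOL-Analysis.Analysis"
begin

(* Basis index convention: v_1, v_2, v_3 of V = C^(1|2) are encoded by 0, 1, 2.
   Index 0 is even, indices 1, 2 are odd. *)
definition par :: "nat \<Rightarrow> nat" where
  "par i = (if i = 0 then 0 else 1)"

(* Basis configurations of V_0 \<otimes> V_1 \<otimes> ... \<otimes> V_N : position 0 = auxiliary space,
   positions 1..N = quantum sites. *)
type_synonym cfg = "nat \<Rightarrow> nat"
type_synonym mat = "cfg \<Rightarrow> cfg \<Rightarrow> complex"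

definition cfgs0 :: "nat \<Rightarrow> cfg set" where
  "cfgs0 N = {c. (\<forall>n. c n < 3) \<and> (\<forall>n. N < n \<longrightarrow> c n = 0)}"

(* basis of the quantum space H = V_1 \<otimes> ... \<otimes> V_N (auxiliary slot fixed to 0) *)
definition cfgsH :: "nat \<Rightarrow> cfg set" where
  "cfgsH N = {c. (\<forall>n. c n < 3) \<and> (\<forall>n. (n = 0 \<or> N < n) \<longrightarrow> c n = 0)}"

definition mmul :: "cfg set \<Rightarrow> mat \<Rightarrow> mat \<Rightarrow> mat" where
  "mmul C A B = (\<lambda>c a. \<Sum>b\<in>C. A c b * B b a)"

definition idm :: mat where
  "idm = (\<lambda>c a. if c = a then 1 else 0)"

(* e^j_i (maps v_j to v_i, parity par i + par j) acting in position k of the graded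
   tensor product, with the Koszul sign coming from passing the factors at positions < k *)
definition site_op :: "nat \<Rightarrow> nat \<Rightarrow> nat \<Rightarrow> mat" where
  "site_op k i j = (\<lambda>c' c. if c k = j \<and> c' = c(k := i)
      then (-1) ^ ((par i + par j) * (\<Sum>m<k. par (c m))) else 0)"

definition gperm :: "nat \<Rightarrow> nat \<Rightarrow> mat" where
  "gperm N n = (\<lambda>c' c. \<Sum>\<alpha><3. \<Sum>\<beta><3.
      (-1) ^ par \<beta> * mmul (cfgs0 N) (site_op 0 \<alpha> \<beta>) (site_op n \<beta> \<alpha>) c' c)"

definition Rmat :: "nat \<Rightarrow> complex \<Rightarrow> nat \<Rightarrow> complex \<Rightarrow> mat" where
  "Rmat N \<eta> n \<mu> = (\<lambda>c' c. \<mu> * idm c' c + \<eta> * gperm N n c' c)"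

definition Kaux :: "(nat \<Rightarrow> nat \<Rightarrow> complex) \<Rightarrow> mat" where
  "Kaux K = (\<lambda>c' c. \<Sum>i<3. \<Sum>j<3. K i j * site_op 0 i j c' c)"

fun monoR :: "nat \<Rightarrow> complex \<Rightarrow> (nat \<Rightarrow> complex) \<Rightarrow> nat \<Rightarrow> complex \<Rightarrow> mat" where
  "monoR N \<eta> \<xi> 0 lam = idm"
| "monoR N \<eta> \<xi> (Suc k) lam =
     mmul (cfgs0 N) (Rmat N \<eta> (Suc k) (lam - \<xi> (Suc k))) (monoR N \<eta> \<xi> k lam)"

definition monodromy :: "nat \<Rightarrow> complex \<Rightarrow> (nat \<Rightarrow> complex) \<Rightarrow> (nat \<Rightarrow> nat \<Rightarrow> complex) \<Rightarrow> complex \<Rightarrow> mat" where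
  "monodromy N \<eta> \<xi> K lam = mmul (cfgs0 N) (Kaux K) (monoR N \<eta> \<xi> N lam)"

definition pH :: "nat \<Rightarrow> cfg \<Rightarrow> nat" where
  "pH N a = (\<Sum>n\<in>{1..N}. par (a n))"

(* T^{(K)}_1(\<lambda>) = str_0 M^{(K)}_0(\<lambda>), as a matrix on the basis cfgsH N of H.
   Graded partial supertrace: writing X = \<Sum> e^j_i \<otimes> B_ij one has
   <i,b|X|i,a> = (-1)^{par i (p(a)+p(b))} <b|B_ii|a>, and str_0 X = \<Sum>_i (-1)^{par i} B_ii. *)
definition transfer :: "nat \<Rightarrow> complex \<Rightarrow> (nat \<Rightarrow> complex) \<Rightarrow> (nat \<Rightarrow> nat \<Rightarrow> complex) \<Rightarrow> complex \<Rightarrow> mat" where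
  "transfer N \<eta> \<xi> K lam = (\<lambda>b a. \<Sum>i<3. (-1) ^ par i * (-1) ^ (par i * (pH N a + pH N b))
      * monodromy N \<eta> \<xi> K lam (b(0 := i)) (a(0 := i)))"

definition Khat :: "(nat \<Rightarrow> nat \<Rightarrow> complex) \<Rightarrow> nat \<Rightarrow> nat \<Rightarrow> complex" where
  "Khat K2 i j = (if i \<in> {1,2} \<and> j \<in> {1,2} then K2 i j else 0)"

definition joint_eigvec :: "nat \<Rightarrow> (complex \<Rightarrow> mat) \<Rightarrow> (complex \<Rightarrow> complex) \<Rightarrow> (cfg \<Rightarrow> complex) \<Rightarrow> bool" where
  "joint_eigvec N T t v \<longleftrightarrow> (\<exists>a\<in>cfgsH N. v a \<noteq> 0) \<and>
     (\<forall>lam. \<forall>b\<in>cfgsH N. (\<Sum>a\<in>cfgsH N. T lam b a * v a) = t lam * v b)"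

definition eigvals :: "nat \<Rightarrow> (complex \<Rightarrow> mat) \<Rightarrow> (complex \<Rightarrow> complex) set" where
  "eigvals N T = {t. \<exists>v. joint_eigvec N T t v}"

definition diag_simple :: "nat \<Rightarrow> (complex \<Rightarrow> mat) \<Rightarrow> bool" where
  "diag_simple N T \<longleftrightarrow>
     (\<forall>w :: cfg \<Rightarrow> complex. \<exists>F c. finite F \<and> (\<forall>v\<in>F. \<exists>t. joint_eigvec N T t v) \<and>
          (\<forall>b\<in>cfgsH N. w b = (\<Sum>v\<in>F. c v * v b))) \<and>
     (\<forall>t v w. joint_eigvec N T t v \<and> joint_eigvec N T t w \<longrightarrow>
          (\<exists>c. \<forall>b\<in>cfgsH N. w b = c * v b))"

definition dpoly :: "nat \<Rightarrow> (nat \<Rightarrow> complex) \<Rightarrow> complex \<Rightarrow> complex" where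
  "dpoly N \<xi> lam = (\<Prod>n\<in>{1..N}. lam - \<xi> n)"

definition fcoef :: "nat \<Rightarrow> complex \<Rightarrow> (nat \<Rightarrow> complex) \<Rightarrow> nat \<Rightarrow> nat \<Rightarrow> complex \<Rightarrow> complex" where
  "fcoef N \<eta> \<xi> m a lam = (\<Prod>b\<in>{1..N} - {a}. (lam - \<xi> b) / (\<xi> a - \<xi> b))
      * (\<Prod>b\<in>{1..N}. \<Prod>r\<in>{1..<m}. 1 / (\<xi> a - \<xi> b + of_nat r * \<eta>))"

definition tfun :: "nat \<Rightarrow> complex \<Rightarrow> (nat \<Rightarrow> complex) \<Rightarrow> complex \<Rightarrow> complex \<Rightarrow> (nat \<Rightarrow> complex) \<Rightarrow> complex \<Rightarrow> complex" where
  "tfun N \<eta> \<xi> k2 k3 x lam = - (k2 + k3) * dpoly N \<xi> lam + (\<Sum>a\<in>{1..N}. fcoef N \<eta> \<xi> 1 a lam * x a)"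

definition solset :: "nat \<Rightarrow> complex \<Rightarrow> (nat \<Rightarrow> complex) \<Rightarrow> complex \<Rightarrow> complex \<Rightarrow> (nat \<Rightarrow> complex) set" where
  "solset N \<eta> \<xi> k2 k3 = {x. (\<forall>a. a \<notin> {1..N} \<longrightarrow> x a = 0) \<and>
     (\<forall>a\<in>{1..N}. x a * (k2 * k3 * dpoly N \<xi> (\<xi> a + \<eta>)
        + (\<Sum>r\<in>{1..N}. fcoef N \<eta> \<xi> 2 r (\<xi> a + \<eta>) * tfun N \<eta> \<xi> k2 k3 x (\<xi> r + \<eta>) * x r)) = 0)}"

definition Sigma_set :: "nat \<Rightarrow> complex \<Rightarrow> (nat \<Rightarrow> complex) \<Rightarrow> complex \<Rightarrow> complex \<Rightarrow> (complex \<Rightarrow> complex) set" where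
  "Sigma_set N \<eta> \<xi> k2 k3 = tfun N \<eta> \<xi> k2 k3 ` solset N \<eta> \<xi> k2 k3"

fun rpow :: "nat \<Rightarrow> (cfg \<Rightarrow> complex) \<Rightarrow> mat \<Rightarrow> nat \<Rightarrow> cfg \<Rightarrow> complex" where
  "rpow N v A 0 = v"
| "rpow N v A (Suc m) = (\<lambda>a. \<Sum>b\<in>cfgsH N. rpow N v A m b * A b a)"

fun covp :: "nat \<Rightarrow> (complex \<Rightarrow> mat) \<Rightarrow> (nat \<Rightarrow> complex) \<Rightarrow> (cfg \<Rightarrow> complex) \<Rightarrow> cfg \<Rightarrow> nat \<Rightarrow> cfg \<Rightarrow> complex" where
  "covp N T \<xi> S h 0 = S"
| "covp N T \<xi> S h (Suc k) = rpow N (covp N T \<xi> S h k) (T (\<xi> (Suc k))) (h (Suc k))"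

definition sov_covec :: "nat \<Rightarrow> (complex \<Rightarrow> mat) \<Rightarrow> (nat \<Rightarrow> complex) \<Rightarrow> (cfg \<Rightarrow> complex) \<Rightarrow> cfg \<Rightarrow> cfg \<Rightarrow> complex" where
  "sov_covec N T \<xi> S h = covp N T \<xi> S h N"

definition pairing :: "nat \<Rightarrow> (cfg \<Rightarrow> complex) \<Rightarrow> (cfg \<Rightarrow> complex) \<Rightarrow> complex" where
  "pairing N u v = (\<Sum>a\<in>cfgsH N. u a * v a)"

inductive polyfun :: "'i set \<Rightarrow> (('i \<Rightarrow> complex) \<Rightarrow> complex) \<Rightarrow> bool" for I where
  pconst: "polyfun I (\<lambda>_. c)"
| pvar: "i \<in> I \<Longrightarrow> polyfun I (\<lambda>x. x i)"
| padd: "polyfun I p \<Longrightarrow> polyfun I q \<Longrightarrow> polyfun I (\<lambda>x. p x + q x)"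
| pmul: "polyfun I p \<Longrightarrow> polyfun I q \<Longrightarrow> polyfun I (\<lambda>x. p x * q x)"

definition nonres :: "nat \<Rightarrow> complex \<Rightarrow> (nat \<Rightarrow> complex) \<Rightarrow> bool" where
  "nonres N \<eta> \<xi> \<longleftrightarrow> (\<forall>a\<in>{1..N}. \<forall>b\<in>{1..N}. a \<noteq> b \<longrightarrow> (\<forall>k::int. \<xi> a - \<xi> b \<noteq> of_int k * \<eta>))"

end

theory Submission
  imports Defs "HOL-Combinatorics.Permutations" "Jordan_Normal_Form.Schur_Decomposition"
begin

text \<open>
  Write \<open>R\<^sub>a\<^sub>n(u) = u + \<eta> P\<^sub>a\<^sub>n\<close> with graded transpositions. The Yang-Baxter equation makes the
  operators \<open>T(\<lambda>)\<close> commute. Since the antisymmetrizer of two auxiliary spaces kills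
  \<open>M\<^sub>a(\<xi>\<^sub>n) M\<^sub>b(\<xi>\<^sub>n + \<eta>)\<close>, one has \<open>T(\<xi>\<^sub>n) T(\<xi>\<^sub>n + \<eta>) = d(\<xi>\<^sub>n + \<eta>) T\<^sub>2(\<xi>\<^sub>n)\<close> with \<open>T\<^sub>2\<close> a polynomial of
  degree \<open>N\<close> and leading coefficient \<open>k\<^sub>2 k\<^sub>3\<close>; and \<open>T(\<xi>\<^sub>n) T\<^sub>2(\<xi>\<^sub>n + \<eta>) = 0\<close> because the twist has
  purely odd image of dimension two, so that \<open>K \<otimes> K \<otimes> K\<close> kills graded-symmetric tensors.
  Interpolation turns this into the cubic system for the commuting operators \<open>T(\<xi>\<^sub>n)\<close>.

  Conversely, for commuting solutions \<open>x\<^sub>n\<close> of the cubic system put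
  \<open>y\<^sub>n = x\<^sub>n t(\<xi>\<^sub>n + \<eta>) / d(\<xi>\<^sub>n + \<eta>)\<close>. The \<open>3\<^sup>N\<close> products of factors from \<open>{1, x\<^sub>n, y\<^sub>n}\<close> span all
  polynomials in \<open>x\<close>, with coefficients that are the same for operators and for scalars. Hence
  the vector prescribed by a scalar solution on the covectors \<open>S U(T)\<close> is an eigenvector.

  When the inhomogeneities are far apart, \<open>T(\<xi>\<^sub>n)\<close> is proportional to \<open>K\<close> at site \<open>n\<close>, up to lower
  order. So the determinant of the separate covectors and that of the trace form of the algebra
  generated by the \<open>T(\<xi>\<^sub>n)\<close> are nonzero polynomials in \<open>\<xi>\<close>. Nondegeneracy of the trace form rules
  out nilpotents, whence diagonalizability.
\<close>

subsection \<open>Determinants over finite index sets\<close>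

text \<open>Both determinants of the last paragraph are treated alike. Along inhomogeneities s, 2s,
  3s, ... each splits over the sites to leading order, leaving a 3 by 3 determinant at one site: the
  Krylov matrix of a covector under the twist, and the Hankel matrix of the power sums of 0, k2, k3.
  The first can be made nonzero and the second is nonzero because these three numbers are distinct.

  Powers of \<open>x n\<close> are awkward to reduce, since each equation of the system couples all
  unknowns through values of t at shifted points. The factors 1, \<open>x n\<close>,
  \<open>y n\<close> avoid this: \<open>y n\<close> is, up to a scalar, the second fused transfer
  matrix at \<open>\<xi> n\<close>, and t times a product of such factors is known at
  \<open>\<xi> n\<close> or at \<open>\<xi> n + \<eta>\<close>, whichever suits the factor at site
  n. With N nodes and a known leading coefficient, interpolation at this mixed set of nodes gives
  the product at every point. Powers are then combinations of these products, so the determinant of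
  the covectors built from powers has the determinant for the products as a factor, and its
  nonvanishing carries over.\<close>

definition enumI :: "'i set \<Rightarrow> nat \<Rightarrow> 'i" where
  "enumI I = (SOME e. bij_betw e {0..<card I} I)"

lemma enumI_bij: "finite I \<Longrightarrow> bij_betw (enumI I) {0..<card I} I"
  using someI_ex[OF ex_bij_betw_nat_finite[of I]] by (simp add: enumI_def)

text \<open>Rows and columns are numbered by the same arbitrary enumeration, so that products and
  the identity are preserved; the sign of a renumbering cancels between rows and columns.\<close>

definition toM :: "'i set \<Rightarrow> ('i \<Rightarrow> 'i \<Rightarrow> complex) \<Rightarrow> complex Matrix.mat" where
  "toM I M = Matrix.mat (card I) (card I) (\<lambda>(i, j). M (enumI I i) (enumI I j))"

definition detI :: "'i set \<Rightarrow> ('i \<Rightarrow> 'i \<Rightarrow> complex) \<Rightarrow> complex" where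
  "detI I M = Determinant.det (toM I M)"

lemma toM_carrier [simp]: "toM I M \<in> carrier_mat (card I) (card I)"
  by (simp add: toM_def)

lemma toM_index: "i < card I \<Longrightarrow> j < card I \<Longrightarrow> toM I M $$ (i, j) = M (enumI I i) (enumI I j)"
  by (simp add: toM_def)

lemma perm_less: "p permutes {0..<n} \<Longrightarrow> i < n \<Longrightarrow> p i < n" for n :: nat
  using permutes_in_image[of p "{0..<n}" i] by simp

lemma detI_leibniz: "detI I M = (\<Sum>p | p permutes {0..<card I}. signof p * (\<Prod>i = 0..<card I. M (enumI I i) (enumI I (p i))))"
  unfolding detI_def
  by (subst Determinant.det_def'[OF toM_carrier])
    (intro sum.cong refl arg_cong2[where f = times] prod.cong, auto simp: toM_index perm_less)

lemma enumI_surj: "finite I \<Longrightarrow> i \<in> I \<Longrightarrow> \<exists>a<card I. i = enumI I a"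
proof -
  assume "finite I" "i \<in> I"
  then have "i \<in> enumI I ` {0..<card I}" using bij_betw_imp_surj_on[OF enumI_bij[of I]] by blast
  then show ?thesis by auto
qed

lemma enumI_in: "finite I \<Longrightarrow> i < card I \<Longrightarrow> enumI I i \<in> I"
  using enumI_bij[of I] by (auto simp: bij_betw_def)

lemma sum_enum: "finite I \<Longrightarrow> (\<Sum>i\<in>I. f i) = (\<Sum>k = 0..<card I. f (enumI I k))"
  by (rule sum.reindex_bij_betw[OF enumI_bij, symmetric])
lemma prod_enum: "finite I \<Longrightarrow> (\<Prod>i\<in>I. f i) = (\<Prod>k = 0..<card I. f (enumI I k))"
  by (rule prod.reindex_bij_betw[OF enumI_bij, symmetric])

lemma polyfun_sum: "finite A \<Longrightarrow> (\<And>i. i \<in> A \<Longrightarrow> polyfun V (f i)) \<Longrightarrow> polyfun V (\<lambda>x. \<Sum>i\<in>A. f i x)"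
  by (induction A rule: finite_induct) (auto intro: polyfun.intros)
lemma polyfun_prod: "finite A \<Longrightarrow> (\<And>i. i \<in> A \<Longrightarrow> polyfun V (f i)) \<Longrightarrow> polyfun V (\<lambda>x. \<Prod>i\<in>A. f i x)"
  by (induction A rule: finite_induct) (auto intro: polyfun.intros)

lemma detI_polyfun:
  assumes "finite I" "\<And>i j. i \<in> I \<Longrightarrow> j \<in> I \<Longrightarrow> polyfun V (\<lambda>x. M x i j)"
  shows "polyfun V (\<lambda>x. detI I (M x))"
  unfolding detI_leibniz
  by (intro polyfun_sum polyfun.pmul polyfun.pconst polyfun_prod assms enumI_in finite_permutations)
    (auto simp: perm_less)

lemma detI_tendsto:
  assumes "finite I" "\<And>i j. i \<in> I \<Longrightarrow> j \<in> I \<Longrightarrow> ((\<lambda>s. M s i j) \<longlongrightarrow> L i j) F"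
  shows "((\<lambda>s. detI I (M s)) \<longlongrightarrow> detI I L) F"
  unfolding detI_leibniz
  by (intro tendsto_sum tendsto_mult tendsto_const tendsto_prod assms enumI_in) (auto simp: perm_less)

text \<open>Row factors leave each Leibniz term at once; the column factors appear in permuted
  order, which does not change their product.\<close>

lemma detI_scale:
  assumes "finite I"
  shows "detI I (\<lambda>i j. r i * M i j * q j) = (\<Prod>i\<in>I. r i) * (\<Prod>i\<in>I. q i) * detI I M"
proof -
  have "(\<Prod>i = 0..<card I. q (enumI I (p i))) = (\<Prod>i = 0..<card I. q (enumI I i))" if "p permutes {0..<card I}" for p
    using prod.permute[OF that, of "\<lambda>i. q (enumI I i)"] by (simp add: comp_def)
  then show ?thesis
    unfolding detI_leibniz prod_enum[OF assms] sum_distrib_left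
    by (intro sum.cong refl) (simp add: prod.distrib)
qed

lemma toM_mult: assumes "finite I"
  shows "toM I A * toM I B = toM I (\<lambda>i k. \<Sum>j\<in>I. A i j * B j k)"
  by (rule Matrix.eq_matI) (auto simp: toM_def sum_enum[OF assms] scalar_prod_def)

lemma toM_one: assumes "finite I" shows "toM I (\<lambda>i j. if i = j then 1 else 0) = 1\<^sub>m (card I)"
  using enumI_bij[OF assms]
  by (intro Matrix.eq_matI) (auto simp: toM_def bij_betw_def inj_on_def)

lemma toM_cong: "finite I \<Longrightarrow> (\<And>i j. i \<in> I \<Longrightarrow> j \<in> I \<Longrightarrow> A i j = B i j) \<Longrightarrow> toM I A = toM I B"
  by (intro Matrix.eq_matI) (auto simp: toM_def enumI_in)

lemma detI_mult: "finite I \<Longrightarrow> detI I (\<lambda>i k. \<Sum>j\<in>I. A i j * B j k) = detI I A * detI I B"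
  unfolding detI_def toM_mult[symmetric] by (rule Determinant.det_mult[OF toM_carrier toM_carrier])

lemma detI_cong: "finite I \<Longrightarrow> (\<And>i j. i \<in> I \<Longrightarrow> j \<in> I \<Longrightarrow> A i j = B i j) \<Longrightarrow> detI I A = detI I B"
  unfolding detI_def by (simp cong: toM_cong)

lemma detI_right_inverse:
  assumes I: "finite I" and inv: "\<And>i k. i \<in> I \<Longrightarrow> k \<in> I \<Longrightarrow> (\<Sum>j\<in>I. A i j * B j k) = (if i = k then 1 else 0)"
  shows "detI I A \<noteq> 0"
proof -
  have "detI I A * detI I B = detI I (\<lambda>i j. if i = j then 1 else 0)"
    unfolding detI_mult[OF I, symmetric] by (rule detI_cong[OF I inv])
  also have "\<dots> = 1" unfolding detI_def toM_one[OF I] by simp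
  finally show ?thesis by auto
qed

lemma detI_inverse:
  assumes I: "finite I" and nz: "detI I A \<noteq> 0"
  obtains B where "\<And>i k. i \<in> I \<Longrightarrow> k \<in> I \<Longrightarrow> (\<Sum>j\<in>I. A i j * B j k) = (if i = k then 1 else 0)"
    "\<And>i k. i \<in> I \<Longrightarrow> k \<in> I \<Longrightarrow> (\<Sum>j\<in>I. B i j * A j k) = (if i = k then 1 else 0)"
proof -
  let ?n = "card I" and ?A = "toM I A"
  have "?A \<in> Units (ring_mat TYPE(complex) ?n ())"
    by (rule det_non_zero_imp_unit[OF toM_carrier]) (use nz in \<open>simp add: detI_def\<close>)
  then obtain B' where B': "B' \<in> carrier_mat ?n ?n" "B' * ?A = 1\<^sub>m ?n" "?A * B' = 1\<^sub>m ?n"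
    by (auto simp: Units_def ring_mat_def)
  define f where "f = the_inv_into {0..<?n} (enumI I)"
  have f: "f (enumI I k) = k" if "k < ?n" for k
    using enumI_bij[OF I] that by (simp add: f_def the_inv_into_f_f bij_betw_def)
  define B where "B i j = B' $$ (f i, f j)" for i j
  have "toM I B = B'" using B'(1) by (intro Matrix.eq_matI) (auto simp: toM_def B_def f)
  then have m: "toM I (\<lambda>i k. \<Sum>j\<in>I. B i j * A j k) = toM I (\<lambda>i j. if i = j then 1 else 0)"
     "toM I (\<lambda>i k. \<Sum>j\<in>I. A i j * B j k) = toM I (\<lambda>i j. if i = j then 1 else 0)"
    using B' by (simp_all add: toM_mult[OF I, symmetric] toM_one[OF I])
  have entry: "X i k = Y i k" if e: "toM I X = toM I Y" and ik: "i \<in> I" "k \<in> I" for X Y i k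
  proof -
    obtain a b where "a < ?n" "b < ?n" "i = enumI I a" "k = enumI I b"
      using enumI_surj[OF I] ik by metis
    then show ?thesis using e toM_index[of a I b] by metis
  qed
  show ?thesis by (rule that[of B]) (use entry[OF m(1)] entry[OF m(2)] in auto)
qed

lemma detI_solve:
  assumes I: "finite I" and nz: "detI I A \<noteq> 0"
  shows "\<exists>v. \<forall>i\<in>I. (\<Sum>j\<in>I. A i j * v j) = b i"
proof -
  obtain B where B: "\<And>i k. i \<in> I \<Longrightarrow> k \<in> I \<Longrightarrow> (\<Sum>j\<in>I. A i j * B j k) = (if i = k then 1 else 0)"
    by (rule detI_inverse[OF assms]) blast
  have "(\<Sum>j\<in>I. A i j * (\<Sum>k\<in>I. B j k * b k)) = b i" if i: "i \<in> I" for i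
  proof -
    have "(\<Sum>j\<in>I. A i j * (\<Sum>k\<in>I. B j k * b k)) = (\<Sum>k\<in>I. (\<Sum>j\<in>I. A i j * B j k) * b k)"
      by (simp add: sum_distrib_left sum_distrib_right mult.assoc) (rule sum.swap)
    also have "\<dots> = (\<Sum>k\<in>I. if i = k then b k else 0)"
      by (intro sum.cong refl) (simp add: B[OF i])
    finally show ?thesis using I i by simp
  qed
  then show ?thesis by (intro exI[of _ "\<lambda>j. \<Sum>k\<in>I. B j k * b k"]) simp
qed

lemma detI_kernel:
  assumes I: "finite I" and nz: "detI I A \<noteq> 0" and z: "\<And>i. i \<in> I \<Longrightarrow> (\<Sum>j\<in>I. A i j * v j) = 0" and k: "k \<in> I"
  shows "v k = 0"
proof -
  obtain B where B: "\<And>i k. i \<in> I \<Longrightarrow> k \<in> I \<Longrightarrow> (\<Sum>j\<in>I. B i j * A j k) = (if i = k then 1 else 0)"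
    by (rule detI_inverse[OF I nz]) blast
  have "0 = (\<Sum>i\<in>I. B k i * (\<Sum>j\<in>I. A i j * v j))" by (simp add: z)
  also have "\<dots> = (\<Sum>j\<in>I. (\<Sum>i\<in>I. B k i * A i j) * v j)"
    by (simp add: sum_distrib_left sum_distrib_right mult.assoc) (rule sum.swap)
  also have "\<dots> = (\<Sum>j\<in>I. if k = j then v j else 0)"
    by (intro sum.cong refl) (simp add: B[OF k])
  finally show ?thesis using I k by simp
qed

lemma detI_left_kernel:
  assumes I: "finite I" and nz: "detI I A \<noteq> 0" and z: "\<And>j. j \<in> I \<Longrightarrow> (\<Sum>i\<in>I. c i * A i j) = 0" and k: "k \<in> I"
  shows "c k = 0"
proof -
  obtain B where B: "\<And>i k. i \<in> I \<Longrightarrow> k \<in> I \<Longrightarrow> (\<Sum>j\<in>I. A i j * B j k) = (if i = k then 1 else 0)"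
    by (rule detI_inverse[OF I nz]) blast
  have "0 = (\<Sum>j\<in>I. (\<Sum>i\<in>I. c i * A i j) * B j k)" by (simp add: z)
  also have "\<dots> = (\<Sum>i\<in>I. c i * (\<Sum>j\<in>I. A i j * B j k))"
    by (simp add: sum_distrib_left sum_distrib_right mult.assoc) (rule sum.swap)
  also have "\<dots> = (\<Sum>i\<in>I. if i = k then c i else 0)"
    by (intro sum.cong refl) (simp add: B k)
  finally show ?thesis using I k by simp
qed

text \<open>There is one more unknown than there are equations. A zero row makes the system square
  and singular.\<close>

lemma linear_dependence:
  assumes I: "finite I"
  shows "\<exists>c. (\<exists>k\<le>card I. c k \<noteq> 0) \<and> (\<forall>i\<in>I. (\<Sum>k\<le>card I. A i k * c k) = (0::complex))"
proof -
  let ?n = "Suc (card I)"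
  define Z where "Z = Matrix.mat ?n ?n (\<lambda>(i, k). if i < card I then A (enumI I i) k else 0)"
  have Z: "Z \<in> carrier_mat ?n ?n" by (simp add: Z_def)
  have "Determinant.det Z = 0"
    unfolding det_def'[OF Z]
  proof (rule sum.neutral, rule ballI)
    fix p assume "p \<in> {p. p permutes {0..<?n}}"
    then have "p (card I) < ?n" using perm_less[of p ?n "card I"] by simp
    then have "Z $$ (card I, p (card I)) = 0" by (simp add: Z_def)
    then have "(\<Prod>i = 0..<?n. Z $$ (i, p i)) = 0"
      by (intro prod_zero) (auto intro!: bexI[of _ "card I"])
    then show "signof p * (\<Prod>i = 0..<?n. Z $$ (i, p i)) = 0" by simp
  qed
  then obtain v where v: "v \<in> carrier_vec ?n" "v \<noteq> 0\<^sub>v ?n" "Z *\<^sub>v v = 0\<^sub>v ?n"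
    using det_0_iff_vec_prod_zero_field[OF Z] by blast
  define c where "c k = vec_index v k" for k
  have "\<exists>k\<le>card I. c k \<noteq> 0"
  proof (rule ccontr)
    assume "\<not> ?thesis"
    then have "v = 0\<^sub>v ?n" using v(1) by (intro Matrix.eq_vecI) (auto simp: c_def less_Suc_eq_le)
    then show False using v(2) by simp
  qed
  moreover have "(\<Sum>k\<le>card I. A i k * c k) = 0" if i: "i \<in> I" for i
  proof -
    obtain a where a: "a < card I" "i = enumI I a"
      using enumI_surj[OF I i] by blast
    have "vec_index (Z *\<^sub>v v) a = 0" using a v(3) by simp
    then show ?thesis using a v(1)
      by (simp add: Z_def scalar_prod_def c_def atLeast0LessThan lessThan_Suc_atMost del: sum.atMost_Suc)
  qed
  ultimately show ?thesis by blast
qed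

text \<open>In Schur form the diagonal of the square consists of the squares of the diagonal
  entries, so all of these vanish; the trace does not change under the similarity.\<close>

lemma trace_square_zero_mat:
  assumes A: "(A :: complex Matrix.mat) \<in> carrier_mat n n" and sq: "A * A = 0\<^sub>m n n"
  shows "(\<Sum>i<n. A $$ (i, i)) = 0"
proof -
  obtain es where "char_poly A = (\<Prod>a\<leftarrow>es. [:- a, 1:])" using char_poly_factorized[OF A] by auto
  from schur_decomposition_exists[OF A this] obtain B where B: "B \<in> carrier_mat n n" "upper_triangular B" "similar_mat A B" by auto
  then obtain P Q where "similar_mat_wit A B P Q" by (auto simp: similar_mat_def)
  note w = similar_mat_witD2[OF A this]
  note PQ = w(1-3)
  note car = w(4-7)
  note assoc = assoc_mult_mat[of _ n n _ n _ n]
  have qp: "Q * (P * Z) = Z" if "Z \<in> carrier_mat n n" for Z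
    using that car by (simp add: PQ(2) flip: assoc)
  have "A * A = P * (B * (B * Q))"
  proof -
    have "A * A = P * B * Q * (P * B * Q)" by (simp only: PQ(3))
    also have "\<dots> = P * (B * (Q * (P * (B * Q))))"
      using car by (simp add: assoc)
    also have "Q * (P * (B * Q)) = B * Q" using car by (intro qp) simp
    finally show ?thesis .
  qed
  then have "P * (B * (B * Q)) = 0\<^sub>m n n" using sq by simp
  then have "Q * (P * (B * (B * Q))) * P = 0\<^sub>m n n" using car by simp
  moreover have "Q * (P * (B * (B * Q))) = B * (B * Q)" using car by (intro qp) simp
  ultimately have "B * (B * (Q * P)) = 0\<^sub>m n n" using car by (simp add: assoc)
  then have BB: "B * B = 0\<^sub>m n n" using car by (simp add: PQ(2))
  have diag: "B $$ (i, i) = 0" if i: "i < n" for i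
  proof -
    have "(B * B) $$ (i, i) = (\<Sum>k = 0..<n. B $$ (i, k) * B $$ (k, i))"
      using B(1) i by (simp add: scalar_prod_def)
    also have "\<dots> = (\<Sum>k = 0..<n. if k = i then B $$ (i, i) * B $$ (i, i) else 0)"
    proof (intro sum.cong refl)
      fix k assume "k \<in> {0..<n}"
      then show "B $$ (i, k) * B $$ (k, i) = (if k = i then B $$ (i, i) * B $$ (i, i) else 0)"
        using upper_triangularD[OF B(2), of i k] upper_triangularD[OF B(2), of k i] B(1) i
        by (cases k i rule: linorder_cases) auto
    qed
    finally show ?thesis using i BB by simp
  qed
  have tr: "(\<Sum>i<n. (X * Y) $$ (i, i)) = (\<Sum>i<n. (Y * X) $$ (i, i))"
    if "X \<in> carrier_mat n n" "Y \<in> carrier_mat n n" for X Y :: "complex Matrix.mat"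
  proof -
    have "(\<Sum>i<n. (X * Y) $$ (i, i)) = (\<Sum>i<n. \<Sum>k<n. X $$ (i, k) * Y $$ (k, i))"
      using that by (intro sum.cong refl) (auto simp: scalar_prod_def atLeast0LessThan)
    also have "\<dots> = (\<Sum>k<n. \<Sum>i<n. Y $$ (k, i) * X $$ (i, k))"
      by (subst sum.swap) (simp add: mult.commute)
    also have "\<dots> = (\<Sum>i<n. (Y * X) $$ (i, i))"
      using that by (intro sum.cong refl) (auto simp: scalar_prod_def atLeast0LessThan)
    finally show ?thesis .
  qed
  have "A = P * (B * Q)" using car by (simp add: PQ(3) assoc)
  then have "(\<Sum>i<n. A $$ (i, i)) = (\<Sum>i<n. (P * (B * Q)) $$ (i, i))" by simp
  also have "\<dots> = (\<Sum>i<n. ((B * Q) * P) $$ (i, i))"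
    using car by (intro tr) auto
  also have "(B * Q) * P = B" using car by (simp add: PQ(2) assoc)
  finally show ?thesis by (simp add: diag)
qed

lemma trace_square_zero:
  assumes I: "finite I" and sq: "\<And>i k. i \<in> I \<Longrightarrow> k \<in> I \<Longrightarrow> (\<Sum>j\<in>I. A i j * A j k) = (0::complex)"
  shows "(\<Sum>i\<in>I. A i i) = 0"
proof -
  have "toM I A * toM I A = 0\<^sub>m (card I) (card I)"
    unfolding toM_mult[OF I] by (rule Matrix.eq_matI) (auto simp: toM_def sq enumI_in[OF I])
  from trace_square_zero_mat[OF toM_carrier this] show ?thesis
    by (simp add: sum_enum[OF I] toM_index atLeast0LessThan)
qed

subsection \<open>Operators on functions of configurations\<close>

text \<open>Operators act on functions of all configurations, so that they form a ring that does not
  depend on the number of sites.\<close>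
typedef lop = "{f :: (cfg \<Rightarrow> complex) \<Rightarrow> cfg \<Rightarrow> complex.
    (\<forall>u v. f (\<lambda>c. u c + v c) = (\<lambda>c. f u c + f v c)) \<and>
    (\<forall>z u. f (\<lambda>c. z * u c) = (\<lambda>c. z * f u c))}"
  morphisms app Lop
  by (rule exI[of _ "\<lambda>u. u"]) simp

setup_lifting type_definition_lop

lemma app_add: "app X (\<lambda>c. u c + v c) = (\<lambda>c. app X u c + app X v c)"
  using app[of X] by simp

lemma app_scale: "app X (\<lambda>c. z * u c) = (\<lambda>c. z * app X u c)"
  using app[of X] by simp

lemma app_uminus: "app X (\<lambda>c. - u c) = (\<lambda>c. - app X u c)"
  using app_scale[of X "-1" u] by simp

lemma app_diff: "app X (\<lambda>c. u c - v c) = (\<lambda>c. app X u c - app X v c)"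
  using app_add[of X u "\<lambda>c. - v c"] by (simp add: app_uminus)

lemma app_zero: "app X (\<lambda>c. 0) = (\<lambda>c. 0)"
  using app_scale[of X 0 "\<lambda>c. 0"] by simp

lemma app_sum: "app X (\<lambda>c. \<Sum>i\<in>A. u i c) = (\<lambda>c. \<Sum>i\<in>A. app X (u i) c)"
  by (induction A rule: infinite_finite_induct) (simp_all add: app_zero app_add)

instantiation lop :: ring_1
begin
lift_definition zero_lop :: lop is "\<lambda>u c. 0" by simp
lift_definition one_lop :: lop is "\<lambda>u. u" by simp
lift_definition plus_lop :: "lop \<Rightarrow> lop \<Rightarrow> lop" is "\<lambda>f g u c. f u c + g u c"
  by (auto simp: algebra_simps)
lift_definition minus_lop :: "lop \<Rightarrow> lop \<Rightarrow> lop" is "\<lambda>f g u c. f u c - g u c"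
  by (auto simp: algebra_simps)
lift_definition uminus_lop :: "lop \<Rightarrow> lop" is "\<lambda>f u c. - f u c"
  by (auto simp: algebra_simps)
lift_definition times_lop :: "lop \<Rightarrow> lop \<Rightarrow> lop" is "\<lambda>f g u. f (g u)"
  by auto
instance
proof
  have "app (0::lop) (\<lambda>_. 1) (\<lambda>_. 0) \<noteq> app 1 (\<lambda>_. 1) (\<lambda>_. 0)"
    by (simp add: zero_lop.rep_eq one_lop.rep_eq)
  then show "(0::lop) \<noteq> 1" by auto
qed (simp_all add: app_inject[symmetric] zero_lop.rep_eq one_lop.rep_eq plus_lop.rep_eq
       minus_lop.rep_eq uminus_lop.rep_eq times_lop.rep_eq app_add fun_eq_iff algebra_simps)
end

lift_definition sc :: "complex \<Rightarrow> lop" is "\<lambda>z u c. z * u c"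
  by (auto simp: algebra_simps)

lemmas app_ring = zero_lop.rep_eq one_lop.rep_eq plus_lop.rep_eq minus_lop.rep_eq
  uminus_lop.rep_eq times_lop.rep_eq sc.rep_eq

lemmas app_lin = app_ring app_add app_diff app_scale app_uminus app_zero

lemma lop_eqI: "(\<And>w c. app X w c = app Y w c) \<Longrightarrow> X = Y"
  by (simp add: app_inject[symmetric] fun_eq_iff)

lemma app_sum_lop: "app (\<Sum>i\<in>A. F i) w c = (\<Sum>i\<in>A. app (F i) w c)"
  by (induction A rule: infinite_finite_induct) (simp_all add: app_ring)

lemma sc_comm: "X * sc z = sc z * X"
  by (rule lop_eqI) (simp add: app_lin)
lemma sc_left_comm: "X * (sc z * Y) = sc z * (X * Y)"
  by (metis sc_comm mult.assoc)
lemma sc_mult: "sc (a * b) = sc a * sc b"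
  by (rule lop_eqI) (simp add: app_lin)
lemma sc_add: "sc (a + b) = sc a + sc b"
  by (rule lop_eqI) (simp add: app_lin algebra_simps)
lemma sc_minus: "sc (- a) = - sc a"
  by (rule lop_eqI) (simp add: app_lin algebra_simps)
lemma sc_diff: "sc (a - b) = sc a - sc b"
  by (rule lop_eqI) (simp add: app_lin algebra_simps)
lemma sc_0 [simp]: "sc 0 = 0"
  by (rule lop_eqI) (simp add: app_lin)
lemma sc_1 [simp]: "sc 1 = 1"
  by (rule lop_eqI) (simp add: app_lin)
lemma sc_sum: "sc (\<Sum>i\<in>A. f i) = (\<Sum>i\<in>A. sc (f i))"
  by (induction A rule: infinite_finite_induct) (simp_all add: sc_add)

lemma sc_cancel: "z \<noteq> 0 \<Longrightarrow> sc z * X = sc z * Y \<longleftrightarrow> X = Y"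
  by (metis mult.assoc mult_1 right_inverse sc_1 sc_mult mult.commute)

lemma sc_eq_0: "z \<noteq> 0 \<Longrightarrow> sc z * X = 0 \<longleftrightarrow> X = 0"
  using sc_cancel[of z X 0] by simp

subsection \<open>Signs of graded permutations\<close>

definition sg :: "nat \<Rightarrow> complex" where "sg x = (if x = 0 then 1 else - 1)"
definition jw :: "nat \<Rightarrow> cfg \<Rightarrow> complex" where "jw p c = (\<Prod>m<p. sg (c m))"
text \<open>Inversions are counted over unordered pairs of positions because a permutation maps this
  index set bijectively to itself by taking images.\<close>

definition two :: "nat \<Rightarrow> nat set set" where "two M = {X. X \<subseteq> {..<M} \<and> card X = 2}"
definition invd :: "(nat \<Rightarrow> nat) \<Rightarrow> nat set \<Rightarrow> bool" where
  "invd \<sigma> X \<longleftrightarrow> (\<exists>i\<in>X. \<exists>j\<in>X. i < j \<and> \<sigma> j < \<sigma> i)"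
text \<open>The Koszul sign of permuting the sites: one factor \<open>- 1\<close> per inverted pair of odd states.\<close>
definition gs :: "nat \<Rightarrow> (nat \<Rightarrow> nat) \<Rightarrow> cfg \<Rightarrow> complex" where
  "gs M \<sigma> c = (\<Prod>X\<in>two M. if invd \<sigma> X \<and> (\<forall>i\<in>X. c (\<sigma> i) \<noteq> 0) then - 1 else 1)"

lemma sg_sq [simp]: "sg x * sg x = 1" by (simp add: sg_def)

lemma jw_sq [simp]: "jw p c * jw p c = 1"
  by (simp add: jw_def flip: prod.distrib)

lemma jw_left [simp]: "jw p c * (jw p c * z) = z"
  by (simp flip: mult.assoc)

lemma jw_upd_same [simp]: "jw p (c(p := i)) = jw p c"
  unfolding jw_def by (intro prod.cong) auto

lemma jw_upd: "jw p (c(q := i)) = (if q < p then sg i * sg (c q) * jw p c else jw p c)"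
proof (cases "q < p")
  case True
  have *: "jw p d = sg (d q) * (\<Prod>m\<in>{..<p}-{q}. sg (d m))" for d
    unfolding jw_def using True by (subst prod.remove[of _ q]) auto
  have "(\<Prod>m\<in>{..<p}-{q}. sg ((c(q := i)) m)) = (\<Prod>m\<in>{..<p}-{q}. sg (c m))"
    by (intro prod.cong) auto
  then show ?thesis using True by (simp add: *[of "c(q:=i)"] *[of c])
qed (auto simp: jw_def intro!: prod.cong)

lemma finite_two [simp]: "finite (two M)"
  by (rule finite_subset[of _ "Pow {..<M}"]) (auto simp: two_def)

lemma two_iff: "X \<in> two M \<longleftrightarrow> (\<exists>i j. i < j \<and> j < M \<and> X = {i, j})"
proof
  assume "X \<in> two M"
  then obtain i j where "X = {i,j}" "i \<noteq> j" "X \<subseteq> {..<M}"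
    by (auto simp: two_def card_2_iff)
  moreover have "i < j \<or> j < i" using \<open>i \<noteq> j\<close> by auto
  ultimately show "\<exists>i j. i < j \<and> j < M \<and> X = {i, j}" by (metis insert_commute insert_subset lessThan_iff)
qed (auto simp: two_def card_2_iff)

lemma bij_two: assumes "\<tau> permutes {..<M}" shows "bij_betw ((`) \<tau>) (two M) (two M)"
proof -
  have inj: "inj \<tau>" using assms by (rule permutes_inj)
  have fwd: "\<pi> ` X \<in> two M" if "\<pi> permutes {..<M}" "X \<in> two M" for \<pi> X
    using that permutes_image[OF that(1)]
    by (auto simp: two_def card_image[OF inj_on_subset[OF permutes_inj[OF that(1)]]])
  show ?thesis
  proof (rule bij_betw_byWitness[where f' = "(`) (Hilbert_Choice.inv \<tau>)"])
    show "\<forall>X\<in>two M. Hilbert_Choice.inv \<tau> ` \<tau> ` X = X"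
      using inj by (simp add: image_comp)
    show "\<forall>X\<in>two M. \<tau> ` Hilbert_Choice.inv \<tau> ` X = X"
      using permutes_surj[OF assms] by (simp add: image_comp surj_iff)
  qed (use fwd assms permutes_inv[OF assms] in auto)
qed

text \<open>After reindexing the pairs of the first factor along \<tau>, the identity holds pair by
  pair: a pair is inverted by the composite iff exactly one of the two steps inverts it, and both
  steps see the same two states.\<close>

lemma gs_comp:
  assumes s: "\<sigma> permutes {..<M}" and t: "\<tau> permutes {..<M}"
  shows "gs M (\<sigma> \<circ> \<tau>) c = gs M \<sigma> c * gs M \<tau> (c \<circ> \<sigma>)"
proof -
  have "gs M \<sigma> c = (\<Prod>X\<in>two M. if invd \<sigma> (\<tau> ` X) \<and> (\<forall>i\<in>\<tau> ` X. c (\<sigma> i) \<noteq> 0) then - 1 else 1)"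
    unfolding gs_def by (rule prod.reindex_bij_betw[OF bij_two[OF t], symmetric])
  then have "gs M \<sigma> c * gs M \<tau> (c \<circ> \<sigma>) =
     (\<Prod>X\<in>two M. (if invd \<sigma> (\<tau> ` X) \<and> (\<forall>i\<in>\<tau> ` X. c (\<sigma> i) \<noteq> 0) then - 1 else 1) *
        (if invd \<tau> X \<and> (\<forall>i\<in>X. (c \<circ> \<sigma>) (\<tau> i) \<noteq> 0) then - 1 else 1))"
    by (simp add: gs_def prod.distrib)
  also have "\<dots> = gs M (\<sigma> \<circ> \<tau>) c"
    unfolding gs_def
  proof (rule prod.cong[OF refl])
    fix X assume "X \<in> two M"
    then obtain i j where X: "i < j" "X = {i,j}" by (auto simp: two_iff)
    have "\<tau> i \<noteq> \<tau> j" "\<sigma> (\<tau> i) \<noteq> \<sigma> (\<tau> j)"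
      using X(1) permutes_inj[OF s] permutes_inj[OF t] by (auto dest: injD)
    then show "(if invd \<sigma> (\<tau> ` X) \<and> (\<forall>i\<in>\<tau> ` X. c (\<sigma> i) \<noteq> 0) then - 1 else 1) *
        (if invd \<tau> X \<and> (\<forall>i\<in>X. (c \<circ> \<sigma>) (\<tau> i) \<noteq> 0) then - 1 else 1) =
       (if invd (\<sigma> \<circ> \<tau>) X \<and> (\<forall>i\<in>X. c ((\<sigma> \<circ> \<tau>) i) \<noteq> 0) then - 1 else (1::complex))"
      using X(1) by (auto simp: invd_def X(2))
  qed
  finally show ?thesis by simp
qed

lemma gs_cong: "(\<And>i. (c i = 0) = (d i = 0)) \<Longrightarrow> gs M \<sigma> c = gs M \<sigma> d"
  by (simp add: gs_def)

text \<open>Pairs without \<open>p\<close> do not notice that the site is emptied. A pair of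
  \<open>p\<close> and \<open>m\<close> is inverted iff \<open>m\<close> lies to the left of
  \<open>p\<close> before or after the permutation but not both, which is what the two Jordan-Wigner
  strings compare.\<close>

lemma gs_peel:
  assumes s: "\<sigma> permutes {..<M}" and p: "p < M" and nz: "c (\<sigma> p) \<noteq> 0"
  shows "gs M \<sigma> c * jw p (c \<circ> \<sigma>) = jw (\<sigma> p) c * gs M \<sigma> (c(\<sigma> p := 0))"
proof -
  let ?A = "{X\<in>two M. p \<in> X}" and ?B = "{X\<in>two M. p \<notin> X}" and ?R = "{..<M} - {p}"
  let ?f = "\<lambda>c X. if invd \<sigma> X \<and> (\<forall>i\<in>X. c (\<sigma> i) \<noteq> 0) then - 1 else (1::complex)"
  have inj: "inj \<sigma>" using s by (rule permutes_inj)
  have split: "gs M \<sigma> d = (\<Prod>X\<in>?A. ?f d X) * (\<Prod>X\<in>?B. ?f d X)" for d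
    unfolding gs_def by (subst prod.union_disjoint[symmetric]) (auto intro!: prod.cong)
  have B: "(\<Prod>X\<in>?B. ?f (c(\<sigma> p := 0)) X) = (\<Prod>X\<in>?B. ?f c X)"
  proof (rule prod.cong[OF refl])
    fix X assume "X \<in> ?B"
    then have "\<sigma> i \<noteq> \<sigma> p" if "i \<in> X" for i using that inj by (auto dest: injD)
    then show "?f (c(\<sigma> p := 0)) X = ?f c X" by auto
  qed
  have A0: "(\<Prod>X\<in>?A. ?f (c(\<sigma> p := 0)) X) = 1"
    by (rule prod.neutral) auto
  have bij: "bij_betw (\<lambda>m. {p, m}) ?R ?A"
    unfolding bij_betw_def
  proof
    show "inj_on (\<lambda>m. {p, m}) ?R" by (auto simp: inj_on_def doubleton_eq_iff)
    show "(\<lambda>m. {p, m}) ` ?R = ?A" using p by (auto simp: two_iff image_def) (metis doubleton_eq_iff nat_neq_iff)+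
  qed
  have A: "(\<Prod>X\<in>?A. ?f c X) = (\<Prod>m\<in>?R. ?f c {p, m})"
    by (rule prod.reindex_bij_betw[OF bij, symmetric])
  have j1: "jw p (c \<circ> \<sigma>) = (\<Prod>m\<in>?R. if m < p then sg (c (\<sigma> m)) else 1)"
  proof -
    have "(\<Prod>m\<in>?R. if m < p then sg (c (\<sigma> m)) else 1) = (\<Prod>m\<in>{m\<in>?R. m < p}. sg (c (\<sigma> m)))"
      by (rule prod.inter_filter[symmetric]) auto
    also have "{m\<in>?R. m < p} = {..<p}" using p by auto
    finally show ?thesis by (simp add: jw_def)
  qed
  have sp: "\<sigma> p < M" using permutes_in_image[OF s, of p] p by simp
  have j2: "jw (\<sigma> p) c = (\<Prod>m\<in>?R. if \<sigma> m < \<sigma> p then sg (c (\<sigma> m)) else 1)"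
  proof -
    have im: "\<sigma> ` {m\<in>?R. \<sigma> m < \<sigma> p} = {..<\<sigma> p}"
    proof
      show "{..<\<sigma> p} \<subseteq> \<sigma> ` {m\<in>?R. \<sigma> m < \<sigma> p}"
      proof
        fix x assume x: "x \<in> {..<\<sigma> p}"
        then have "x \<in> \<sigma> ` {..<M}" using sp permutes_image[OF s] by simp
        then obtain m where "m < M" "x = \<sigma> m" by auto
        then show "x \<in> \<sigma> ` {m\<in>?R. \<sigma> m < \<sigma> p}" using x by auto
      qed
    qed auto
    have "(\<Prod>m\<in>?R. if \<sigma> m < \<sigma> p then sg (c (\<sigma> m)) else 1) = (\<Prod>m\<in>{m\<in>?R. \<sigma> m < \<sigma> p}. sg (c (\<sigma> m)))"
      by (rule prod.inter_filter[symmetric]) auto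
    also have "\<dots> = (\<Prod>x\<in>{..<\<sigma> p}. sg (c x))"
      by (subst im[symmetric], subst prod.reindex) (auto intro: inj_on_subset[OF inj])
    finally show ?thesis by (simp add: jw_def)
  qed
  have "(\<Prod>X\<in>?A. ?f c X) * jw p (c \<circ> \<sigma>) = jw (\<sigma> p) c"
    unfolding A j1 j2 prod.distrib[symmetric]
  proof (rule prod.cong[OF refl])
    fix m assume "m \<in> ?R"
    then have "m \<noteq> p" "\<sigma> m \<noteq> \<sigma> p" using inj by (auto dest: injD)
    then show "?f c {p, m} * (if m < p then sg (c (\<sigma> m)) else 1) =
        (if \<sigma> m < \<sigma> p then sg (c (\<sigma> m)) else 1)"
      using nz by (auto simp: invd_def sg_def)
  qed
  then show ?thesis
    unfolding split[of c] split[of "c(\<sigma> p := 0)"] A0 B by (simp add: ac_simps)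
qed

abbreviation sw :: "nat \<Rightarrow> nat \<Rightarrow> nat \<Rightarrow> nat" where "sw \<equiv> Transposition.transpose"

text \<open>Every inversion of a transposition contains one of the exchanged positions, and these
  carry the even state.\<close>

lemma gs_sw_vac:
  assumes "c a = 0" "c b = 0"
  shows "gs M (sw a b) c = 1"
  unfolding gs_def
proof (rule prod.neutral, rule ballI)
  fix X assume "X \<in> two M"
  then obtain i j where X: "i < j" "X = {i,j}" by (auto simp: two_iff)
  show "(if invd (sw a b) X \<and> (\<forall>i\<in>X. c (sw a b i) \<noteq> 0) then - 1 else 1) = (1::complex)"
    using X assms by (auto simp: invd_def Transposition.transpose_def split: if_splits)
qed


subsection \<open>Graded operators\<close>

lift_definition Pop :: "nat \<Rightarrow> (nat \<Rightarrow> nat) \<Rightarrow> lop" is "\<lambda>M \<sigma> w c. gs M \<sigma> c * w (c \<circ> \<sigma>)"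
  by (auto simp: algebra_simps)

text \<open>\<open>ins p i\<close> puts the basis vector \<open>i\<close> at site \<open>p\<close>, which must be in the even state \<open>0\<close>;
  \<open>ext p i\<close> is its transpose. Both carry the Jordan-Wigner sign of the sites to the left of \<open>p\<close>,
  so that they supercommute at different sites and \<open>ext p i * X * ins p i\<close> is a graded partial
  matrix element.\<close>
lift_definition ins :: "nat \<Rightarrow> nat \<Rightarrow> lop" is
  "\<lambda>p i w c. if c p = i then (if i = 0 then 1 else jw p c) * w (c(p := 0)) else 0"
  by (auto simp: algebra_simps)
lift_definition ext :: "nat \<Rightarrow> nat \<Rightarrow> lop" is
  "\<lambda>p i w c. if c p = 0 then (if i = 0 then 1 else jw p c) * w (c(p := i)) else 0"
  by (auto simp: algebra_simps)
text \<open>No Jordan-Wigner sign is attached: nonzero entries of \<open>Khat\<close> connect odd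
  states with odd states, so the operator is even.\<close>

lift_definition Kop :: "(nat \<Rightarrow> nat \<Rightarrow> complex) \<Rightarrow> nat \<Rightarrow> lop" is
  "\<lambda>K2 p w c. \<Sum>j<3. Khat K2 (c p) j * w (c(p := j))"
  by (auto simp: algebra_simps sum.distrib sum_distrib_left)

abbreviation Pt :: "nat \<Rightarrow> nat \<Rightarrow> nat \<Rightarrow> lop" where "Pt M a b \<equiv> Pop M (sw a b)"
text \<open>The projection onto the even state at \<open>p\<close>. Partial supertraces over \<open>p\<close> carry it as a factor.\<close>
definition vac :: "nat \<Rightarrow> lop" where "vac p = ins p 0"

lemmas app_ops = Pop.rep_eq ins.rep_eq ext.rep_eq Kop.rep_eq

lemma app_vac: "app (vac p) w c = (if c p = 0 then w c else 0)"
  by (simp add: vac_def app_ops fun_upd_idem)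

lemma Khat_nz: "Khat K2 i j \<noteq> 0 \<Longrightarrow> i \<in> {1,2} \<and> j \<in> {1,2}"
  by (auto simp: Khat_def split: if_splits)

lemma Pop_comp:
  "\<sigma> permutes {..<M} \<Longrightarrow> \<tau> permutes {..<M} \<Longrightarrow> Pop M (\<sigma> \<circ> \<tau>) = Pop M \<sigma> * Pop M \<tau>"
  by (rule lop_eqI) (simp add: app_lin Pop.rep_eq gs_comp o_assoc)

lemma upd_comp: "inj \<sigma> \<Longrightarrow> c(\<sigma> p := x) \<circ> \<sigma> = (c \<circ> \<sigma>)(p := x)"
  by (auto simp: fun_eq_iff dest: injD)

lemma gs_peel2:
  assumes "\<sigma> permutes {..<M}" "p < M" "c (\<sigma> p) \<noteq> 0"
  shows "gs M \<sigma> (c(\<sigma> p := 0)) = jw (\<sigma> p) c * gs M \<sigma> c * jw p (c \<circ> \<sigma>)"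
proof -
  have "jw (\<sigma> p) c * (jw (\<sigma> p) c * gs M \<sigma> (c(\<sigma> p := 0))) = jw (\<sigma> p) c * (gs M \<sigma> c * jw p (c \<circ> \<sigma>))"
    using gs_peel[where c = c, OF assms] by simp
  then show ?thesis by (simp add: mult.assoc)
qed

text \<open>Conjugation by a graded permutation relabels the site of a local operator;
  \<open>gs_peel2\<close> is exactly the statement that the strings to the left of the old and the
  new site match.\<close>

lemma Pop_ins:
  assumes s: "\<sigma> permutes {..<M}" and p: "p < M"
  shows "Pop M \<sigma> * ins p i = ins (\<sigma> p) i * Pop M \<sigma>"
proof (rule lop_eqI)
  fix w :: "cfg \<Rightarrow> complex" and c :: cfg
  have u: "c(\<sigma> p := 0) \<circ> \<sigma> = (c \<circ> \<sigma>)(p := 0)"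
    by (rule upd_comp[OF permutes_inj[OF s]])
  have "c (\<sigma> p) = 0 \<Longrightarrow> c(\<sigma> p := 0) = c" by auto
  then show "app (Pop M \<sigma> * ins p i) w c = app (ins (\<sigma> p) i * Pop M \<sigma>) w c"
    using gs_peel2[where c = c, OF s p] by (auto simp: app_lin app_ops u ac_simps)
qed

lemma Pop_ext:
  assumes s: "\<sigma> permutes {..<M}" and p: "p < M"
  shows "Pop M \<sigma> * ext p i = ext (\<sigma> p) i * Pop M \<sigma>"
proof (rule lop_eqI)
  fix w :: "cfg \<Rightarrow> complex" and c :: cfg
  have u: "c(\<sigma> p := x) \<circ> \<sigma> = (c \<circ> \<sigma>)(p := x)" for x
    by (rule upd_comp[OF permutes_inj[OF s]])
  have "gs M \<sigma> c * (if i = 0 then 1 else jw p (c \<circ> \<sigma>)) =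
      (if i = 0 then 1 else jw (\<sigma> p) c) * gs M \<sigma> (c(\<sigma> p := i))" if "c (\<sigma> p) = 0"
  proof (cases "i = 0")
    case True
    then have "c(\<sigma> p := i) = c" using that by auto
    then show ?thesis using True by simp
  next
    case False
    have "c(\<sigma> p := i, \<sigma> p := 0) = c" using that by auto
    then show ?thesis
      using gs_peel2[where c = "c(\<sigma> p := i)", OF s p] False by (simp add: u mult.assoc)
  qed
  then show "app (Pop M \<sigma> * ext p i) w c = app (ext (\<sigma> p) i * Pop M \<sigma>) w c"
    by (auto simp: app_lin app_ops u)
qed

lemma Pop_K:
  assumes s: "\<sigma> permutes {..<M}"
  shows "Pop M \<sigma> * Kop K2 p = Kop K2 (\<sigma> p) * Pop M \<sigma>"
proof (rule lop_eqI)
  fix w :: "cfg \<Rightarrow> complex" and c :: cfg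
  have u: "c(\<sigma> p := x) \<circ> \<sigma> = (c \<circ> \<sigma>)(p := x)" for x
    by (rule upd_comp[OF permutes_inj[OF s]])
  have h: "gs M \<sigma> c * (Khat K2 (c (\<sigma> p)) j * w ((c \<circ> \<sigma>)(p := j))) =
    Khat K2 (c (\<sigma> p)) j * (gs M \<sigma> (c(\<sigma> p := j)) * w ((c \<circ> \<sigma>)(p := j)))" for j
  proof (cases "Khat K2 (c (\<sigma> p)) j = 0")
    case False
    then have "gs M \<sigma> (c(\<sigma> p := j)) = gs M \<sigma> c"
      using Khat_nz[OF False] by (intro gs_cong) auto
    then show ?thesis by simp
  qed simp
  have "(\<Sum>j<3. gs M \<sigma> c * (Khat K2 (c (\<sigma> p)) j * w ((c \<circ> \<sigma>)(p := j)))) =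
    (\<Sum>j<3. Khat K2 (c (\<sigma> p)) j * (gs M \<sigma> (c(\<sigma> p := j)) * w ((c \<circ> \<sigma>)(p := j))))"
    by (rule sum.cong[OF refl h])
  then show "app (Pop M \<sigma> * Kop K2 p) w c = app (Kop K2 (\<sigma> p) * Pop M \<sigma>) w c"
    by (simp only: app_ring app_ops u sum_distrib_left comp_apply)
qed

lemma sw_permutes: "a < M \<Longrightarrow> b < M \<Longrightarrow> sw a b permutes {..<M}"
  by (rule permutes_swap_id) auto

text \<open>Koszul sign for exchanging the basis states \<open>i\<close> and \<open>j\<close>, kept
  as a ring element so that it moves through products like every scalar.\<close>

definition ks :: "nat \<Rightarrow> nat \<Rightarrow> lop" where "ks i j = sc (if i \<noteq> 0 \<and> j \<noteq> 0 then - 1 else 1)"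

lemma ks_sq: "ks i j * (ks i j * X) = X"
  by (simp add: ks_def sc_minus flip: mult.assoc)
lemma ks_comm: "ks i j = ks j i"
  by (simp add: ks_def conj_commute)

lemma ins_ins: "a \<noteq> b \<Longrightarrow> ins a i * ins b j = ks i j * (ins b j * ins a i)"
  by (rule lop_eqI) (auto simp: app_lin app_ops ks_def jw_upd sg_def fun_upd_twist)
lemma ext_ext: "a \<noteq> b \<Longrightarrow> ext a i * ext b j = ks i j * (ext b j * ext a i)"
  by (rule lop_eqI) (auto simp: app_lin app_ops ks_def jw_upd sg_def fun_upd_twist)
lemma ext_ins: "a \<noteq> b \<Longrightarrow> ext a i * ins b j = ks i j * (ins b j * ext a i)"
  by (rule lop_eqI) (auto simp: app_lin app_ops ks_def jw_upd sg_def fun_upd_twist)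

lemma K_ins: "a \<noteq> b \<Longrightarrow> Kop K2 a * ins b j = ins b j * Kop K2 a"
  by (rule lop_eqI) (auto simp: app_lin app_ops jw_upd sg_def fun_upd_twist Khat_def sum_distrib_left intro!: sum.cong)
lemma K_ext: "a \<noteq> b \<Longrightarrow> Kop K2 a * ext b j = ext b j * Kop K2 a"
  by (rule lop_eqI) (auto simp: app_lin app_ops jw_upd sg_def fun_upd_twist Khat_def sum_distrib_left intro!: sum.cong)
lemma K_comm: assumes "a \<noteq> b" shows "Kop K2 a * Kop K2 b = Kop K2 b * Kop K2 a"
proof (rule lop_eqI)
  fix w :: "cfg \<Rightarrow> complex" and c :: cfg
  have "app (Kop K2 a * Kop K2 b) w c =
      (\<Sum>i<3. \<Sum>j<3. Khat K2 (c a) i * (Khat K2 (c b) j * w (c(a := i, b := j))))"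
    using assms by (simp add: app_ring app_ops sum_distrib_left)
  also have "\<dots> = (\<Sum>j<3. \<Sum>i<3. Khat K2 (c b) j * (Khat K2 (c a) i * w (c(b := j, a := i))))"
    by (subst sum.swap) (intro sum.cong refl, simp add: fun_upd_twist[OF assms])
  also have "\<dots> = app (Kop K2 b * Kop K2 a) w c"
    using assms by (simp add: app_ring app_ops sum_distrib_left)
  finally show "app (Kop K2 a * Kop K2 b) w c = app (Kop K2 b * Kop K2 a) w c" .
qed

text \<open>The two Jordan-Wigner signs cancel, since a nonzero entry of \<open>Khat\<close> has
  both indices odd. What remains besides the entry is the projection onto the even state.\<close>

lemma ext_K_ins:
  assumes ij: "i < 3" "j < 3"
  shows "ext p i * (Kop K2 p * ins p j) = sc (Khat K2 i j) * vac p"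
proof (rule lop_eqI)
  fix w :: "cfg \<Rightarrow> complex" and c :: cfg
  have *: "(\<Sum>k<3. Khat K2 l k * (if k = j then y k else 0)) = Khat K2 l j * y j" for y l
    using ij by (subst sum.remove[of _ j]) auto
  note v = app_vac
  have ext: "app (ext p i * (Kop K2 p * ins p j)) w c = (if c p = 0 then
     (if i = 0 then 1 else jw p c) * (Khat K2 i j * ((if j = 0 then 1 else jw p c) * w (c(p := 0)))) else 0)"
    by (simp add: app_ring app_ops * cong: if_cong)
  show "app (ext p i * (Kop K2 p * ins p j)) w c = app (sc (Khat K2 i j) * vac p) w c"
  proof (cases "c p = 0 \<and> Khat K2 i j \<noteq> 0")
    case True
    then have "i \<noteq> 0" "j \<noteq> 0" using Khat_nz[of K2 i j] by auto
    moreover have "c(p := 0) = c" using True by auto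
    ultimately show ?thesis unfolding ext using True by (simp add: app_ring v)
  next
    case False
    then show ?thesis unfolding ext by (auto simp: app_ring v)
  qed
qed

lemma ext_0: "ext p 0 = vac p"
  by (rule lop_eqI) (simp add: app_ops vac_def)
lemma vac_ext: "vac p * ext p i = ext p i"
  by (rule lop_eqI) (simp add: app_lin app_ops app_vac)
lemma ins_vac: "ins p i * vac p = ins p i"
  by (rule lop_eqI) (simp add: app_lin app_ops app_vac)
lemma vac_vac: "vac p * vac p = vac p"
  using ins_vac[of p 0] by (simp add: vac_def)

lemma P_vac: "Pt M a b * (vac a * vac b) = vac a * vac b"
proof (rule lop_eqI)
  fix w :: "cfg \<Rightarrow> complex" and c :: cfg
  note v = app_vac
  have "c \<circ> sw a b = c" if "c a = 0" "c b = 0"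
    using that by (auto simp: fun_eq_iff Transposition.transpose_def)
  then show "app (Pt M a b * (vac a * vac b)) w c = app (vac a * vac b) w c"
    by (auto simp: app_ring Pop.rep_eq v gs_sw_vac Transposition.transpose_def)
qed

subsection \<open>Partial supertraces\<close>

text \<open>Commutation without signs, although \<open>ins\<close> and \<open>ext\<close> may be
  odd: this encodes an even operator that acts away from site \<open>p\<close>.\<close>

definition free :: "nat \<Rightarrow> lop \<Rightarrow> bool" where
  "free p X \<longleftrightarrow> (\<forall>i. X * ins p i = ins p i * X \<and> X * ext p i = ext p i * X)"

definition pstr :: "nat \<Rightarrow> lop \<Rightarrow> lop" where
  "pstr p X = (\<Sum>i<3. sc (sg i) * (ext p i * (X * ins p i)))"

lemma sc_sc: "sc a * (sc b * X) = sc (a * b) * X"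
  by (simp add: sc_mult mult.assoc)

lemmas sc_pull = sc_left_comm[of "ext p i" for p i] sc_left_comm[of "ins p i" for p i]
  sc_left_comm[of "Pop M s" for M s] sc_left_comm[of "Kop K p" for K p] sc_sc
  sc_comm[of "ext p i" for p i] sc_comm[of "ins p i" for p i]

lemma pstr_add: "pstr p (X + Y) = pstr p X + pstr p Y"
  by (simp add: pstr_def algebra_simps sum.distrib)
lemma pstr_0: "pstr p 0 = 0"
  by (simp add: pstr_def)
lemma pstr_sc: "pstr p (sc z * X) = sc z * pstr p X"
  by (simp add: pstr_def sum_distrib_left sc_pull mult.assoc mult.commute[of z])
lemma pstr_sum: "pstr p (\<Sum>i\<in>A. F i) = (\<Sum>i\<in>A. pstr p (F i))"
  by (induction A rule: infinite_finite_induct) (simp_all add: pstr_0 pstr_add)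

lemma freeD: "free p X \<Longrightarrow> X * ins p i = ins p i * X" "free p X \<Longrightarrow> X * ext p i = ext p i * X"
  by (auto simp: free_def)

lemma free_left:
  "free p X \<Longrightarrow> X * (ins p i * Z) = ins p i * (X * Z)" "free p X \<Longrightarrow> X * (ext p i * Z) = ext p i * (X * Z)"
  by (simp_all add: freeD flip: mult.assoc)

lemma free_sc [simp]: "free p (sc z)"
  by (simp add: free_def sc_comm)
lemma free_1 [simp]: "free p 1"
  by (simp add: free_def)
lemma free_add: "free p X \<Longrightarrow> free p Y \<Longrightarrow> free p (X + Y)"
  by (simp add: free_def algebra_simps)
lemma free_mult: "free p X \<Longrightarrow> free p Y \<Longrightarrow> free p (X * Y)"
  by (simp add: free_def[of p "X * Y"] freeD free_left mult.assoc)
lemma free_K: "p \<noteq> q \<Longrightarrow> free p (Kop K2 q)"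
  by (metis free_def K_ins K_ext)
lemma free_P: "p < M \<Longrightarrow> a < M \<Longrightarrow> b < M \<Longrightarrow> p \<noteq> a \<Longrightarrow> p \<noteq> b \<Longrightarrow> free p (Pt M a b)"
  by (simp add: free_def Pop_ins[OF sw_permutes] Pop_ext[OF sw_permutes])

lemma free_vac: "free p X \<Longrightarrow> X * vac p = vac p * X"
  unfolding vac_def by (rule freeD)

text \<open>An operator \<open>ins a k\<close> or \<open>ext a k\<close> has to pass both
  \<open>ins b i\<close> and \<open>ext b i\<close>. Each passage costs the sign
  \<open>ks i k\<close>, so every summand of the supertrace commutes with it.\<close>

lemma free_pstr: assumes "free a Y" "a \<noteq> b" shows "free a (pstr b Y)"
proof -
  have "pstr b Y * ins a k = ins a k * pstr b Y" for k
  proof -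
    have "ext b i * (Y * (ins b i * ins a k)) = ins a k * (ext b i * (Y * ins b i))" for i
    proof -
      have "ext b i * (Y * (ins b i * ins a k)) = ks i k * (ext b i * (Y * ins a k * ins b i))"
        using assms(2) by (simp add: ins_ins[of b a] ks_def sc_pull sc_left_comm[of Y] mult.assoc)
      also have "\<dots> = ks i k * (ext b i * ins a k * (Y * ins b i))"
        by (simp add: freeD(1)[OF assms(1)] mult.assoc)
      also have "\<dots> = ins a k * (ext b i * (Y * ins b i))"
        using assms(2) by (simp add: ext_ins[of b a] ks_sq mult.assoc)
      finally show ?thesis .
    qed
    then show ?thesis
      by (simp add: pstr_def sum_distrib_left sum_distrib_right mult.assoc sc_pull)
  qed
  moreover have "pstr b Y * ext a k = ext a k * pstr b Y" for k
  proof -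
    have JI: "ins b i * ext a k = ks i k * (ext a k * ins b i)" for i
      using ext_ins[of a b k i] assms(2) by (simp add: ks_sq ks_comm[of i k])
    have "ext b i * (Y * (ins b i * ext a k)) = ext a k * (ext b i * (Y * ins b i))" for i
    proof -
      have "ext b i * (Y * (ins b i * ext a k)) = ks i k * (ext b i * (Y * ext a k * ins b i))"
        by (simp add: JI) (simp add: ks_def sc_pull sc_left_comm[of Y] mult.assoc)
      also have "\<dots> = ks i k * (ext b i * ext a k * (Y * ins b i))"
        by (simp add: freeD(2)[OF assms(1)] mult.assoc)
      also have "\<dots> = ext a k * (ext b i * (Y * ins b i))"
        using assms(2) by (simp add: ext_ext[of b a] ks_sq mult.assoc)
      finally show ?thesis .
    qed
    then show ?thesis
      by (simp add: pstr_def sum_distrib_left sum_distrib_right mult.assoc sc_pull)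
  qed
  ultimately show ?thesis by (simp add: free_def)
qed

lemma pstr_free_left: "free b X \<Longrightarrow> X * pstr b Y = pstr b (X * Y)"
  by (simp add: pstr_def sum_distrib_left sc_left_comm[of X] free_left mult.assoc)

lemma pstr_free_right: "free b X \<Longrightarrow> pstr b Y * X = pstr b (Y * X)"
  by (simp add: pstr_def sum_distrib_right mult.assoc freeD)

lemma pstr_pstr_comm: assumes "a \<noteq> b" shows "pstr a (pstr b X) = pstr b (pstr a X)"
proof -
  have *: "ext a i * (ext b j * (X * (ins b j * ins a i))) = ext b j * (ext a i * (X * (ins a i * ins b j)))" for i j
  proof -
    have "ext a i * (ext b j * Z) = ks i j * (ext b j * (ext a i * Z))" for Z
      using ext_ext[OF assms, of i j] by (metis mult.assoc)
    moreover have "ins a i * ins b j = ks i j * (ins b j * ins a i)" by (rule ins_ins[OF assms])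
    moreover have "Y * (ks i j * Z) = ks i j * (Y * Z)" for Y Z
      by (simp only: ks_def sc_left_comm[of Y])
    ultimately show ?thesis by (simp add: ks_sq)
  qed
  have "pstr a (pstr b X) = (\<Sum>i<3. \<Sum>j<3. sc (sg i) * (sc (sg j) * (ext a i * (ext b j * (X * (ins b j * ins a i))))))"
    by (simp add: pstr_def sum_distrib_left sum_distrib_right mult.assoc sc_pull sc_left_comm[of X])
  also have "\<dots> = (\<Sum>j<3. \<Sum>i<3. sc (sg j) * (sc (sg i) * (ext b j * (ext a i * (X * (ins a i * ins b j))))))"
    by (subst sum.swap) (simp add: * sc_sc mult.commute)
  also have "\<dots> = pstr b (pstr a X)"
    by (simp add: pstr_def sum_distrib_left sum_distrib_right mult.assoc sc_pull sc_left_comm[of X])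
  finally show ?thesis .
qed

text \<open>A product of transfer matrices on two auxiliary sites thereby becomes one double
  supertrace, inside which exchange relations between the monodromies can act.\<close>

lemma pstr_mult: assumes "free b X" "free a Y" "a \<noteq> b" shows "pstr a X * pstr b Y = pstr a (pstr b (X * Y))"
  using assms pstr_pstr_comm[of a b "X * Y"] by (simp add: pstr_free_right free_pstr pstr_free_left)

lemma Pop_id: "Pop M id = 1"
proof (rule lop_eqI)
  fix w :: "cfg \<Rightarrow> complex" and c :: cfg
  have "gs M id c = 1"
    unfolding gs_def by (rule prod.neutral) (auto simp: invd_def)
  then show "app (Pop M id) w c = app 1 w c" by (simp add: app_ring app_ops)
qed

lemma P_P: assumes "a < M" "b < M" shows "Pt M a b * Pt M a b = 1"
  using Pop_comp[OF sw_permutes[OF assms] sw_permutes[OF assms]]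
  by (simp add: Transposition.transpose_comp_involutory Pop_id)

text \<open>Moved to the right through both insertions, the transposition meets the even states at
  \<open>a\<close> and \<open>b\<close>, where it acts as the identity.\<close>

lemma P_ins_ins:
  assumes ab: "a < M" "b < M" "a \<noteq> b"
  shows "Pt M a b * (ins b j * ins a i) = ins a j * ins b i"
proof -
  note PI = Pop_ins[OF sw_permutes[OF ab(1,2)]]
  have Iv: "ins a i * vac b = vac b * ins a i" "ins b i * vac a = vac a * ins b i"
    "vac b * vac a = vac a * vac b" for i
    using ab(3) ins_ins[of a b i 0] ins_ins[of b a i 0] ins_ins[of b a 0 0] by (simp_all add: vac_def ks_def)
  have I2vac: "ins b j * (ins a i * (vac a * vac b)) = ins b j * ins a i"
      "ins a j * (ins b i * (vac a * vac b)) = ins a j * ins b i" for i j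
  proof -
    have "ins b j * (ins a i * (vac a * vac b)) = ins b j * ((ins a i * vac a) * vac b)"
      by (simp add: mult.assoc)
    also have "\<dots> = ins b j * (vac b * ins a i)"
      by (simp only: ins_vac Iv)
    finally show "ins b j * (ins a i * (vac a * vac b)) = ins b j * ins a i" by (simp add: ins_vac flip: mult.assoc)
    have "ins a j * (ins b i * (vac a * vac b)) = ins a j * ((ins b i * vac b) * vac a)"
      by (simp add: mult.assoc Iv(3))
    also have "\<dots> = ins a j * (vac a * ins b i)"
      by (simp only: ins_vac Iv)
    finally show "ins a j * (ins b i * (vac a * vac b)) = ins a j * ins b i" by (simp add: ins_vac flip: mult.assoc)
  qed
  have P_Iab: "Pt M a b * ins a i = ins b i * Pt M a b" "Pt M a b * ins b i = ins a i * Pt M a b" for i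
    using PI[OF ab(1)] PI[OF ab(2)] by simp_all
  have vP: "vac a * (vac b * Pt M a b) = vac a * vac b"
  proof -
    have "vac a * (vac b * Pt M a b) = (vac a * Pt M a b) * vac a"
      using P_Iab(1)[of 0] by (simp add: vac_def mult.assoc)
    also have "\<dots> = (Pt M a b * vac b) * vac a"
      using P_Iab(2)[of 0] by (simp add: vac_def)
    also have "\<dots> = Pt M a b * (vac b * vac a)" by (rule mult.assoc)
    finally show ?thesis by (simp add: Iv P_vac)
  qed
  have PII: "Pt M a b * (ins b j * ins a i) = ins a j * ins b i" for i j
  proof -
    have "Pt M a b * (ins b j * ins a i) = ins a j * (Pt M a b * ins a i)"
      by (simp add: P_Iab(2) flip: mult.assoc)
    also have "\<dots> = ins a j * ins b i * Pt M a b"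
      by (simp add: P_Iab(1) mult.assoc)
    also have "\<dots> = ins a j * (ins b i * (vac a * (vac b * Pt M a b)))"
      by (subst I2vac(2)[symmetric]) (simp add: mult.assoc)
    finally show ?thesis by (simp add: vP I2vac)
  qed
  show ?thesis by (rule PII)
qed

text \<open>The cyclicity needed later concerns a transposition only. It exchanges the labels
  \<open>i\<close> and \<open>j\<close> in the extractions or in the insertions, and renaming the
  summation indices turns one case into the other; the signs for reordering the two extractions and
  the two insertions cancel.\<close>

lemma pstr_swap_cyclic:
  assumes ab: "a < M" "b < M" "a \<noteq> b"
  shows "pstr a (pstr b (Pt M a b * X)) = pstr a (pstr b (X * Pt M a b))"
proof -
  note PI = Pop_ins[OF sw_permutes[OF ab(1,2)]]
  note PJ = Pop_ext[OF sw_permutes[OF ab(1,2)]]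
  note P2 = P_P[OF ab(1,2)]
  have J_P: "ext p i * Pt M a b = Pt M a b * ext (sw a b p) i" if "p < M" for p i
  proof -
    have "sw a b p < M" using that ab by (auto simp: Transposition.transpose_def)
    then show ?thesis using PJ[of "sw a b p" i] by simp
  qed
  have vac2J: "vac a * (vac b * (ext b j * ext a i)) = ext b j * ext a i" for i j
  proof -
    have "vac a * (ext b j * ext a i) = ext b j * (vac a * ext a i)"
      using ab(3) ext_ext[of a b 0 j] by (simp add: ext_0 ks_def flip: mult.assoc)
    then have "vac a * (ext b j * ext a i) = ext b j * ext a i" by (simp add: vac_ext)
    moreover have "vac b * (ext b j * ext a i) = ext b j * ext a i" by (simp add: vac_ext flip: mult.assoc)
    ultimately show ?thesis by simp
  qed
  have JJP: "ext a i * (ext b j * Pt M a b) = ext b i * ext a j" for i j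
  proof -
    have "ext a i * (ext b j * Pt M a b) = Pt M a b * (ext b i * ext a j)"
      using ab by (simp add: J_P flip: mult.assoc)
    also have "\<dots> = Pt M a b * (vac a * vac b) * (ext b i * ext a j)"
      by (simp add: vac2J mult.assoc)
    finally show ?thesis by (simp add: P_vac mult.assoc vac2J)
  qed
  note PII = P_ins_ins[OF ab]
  have ksm: "Y * (ks i j * Z) = ks i j * (Y * Z)" for Y Z i j
    by (simp only: ks_def sc_left_comm[of Y])
  have "pstr a (pstr b (Pt M a b * X)) =
    (\<Sum>i<3. \<Sum>j<3. sc (sg i) * (sc (sg j) * (ext a i * (ext b j * Pt M a b) * (X * (ins b j * ins a i)))))"
    by (simp add: pstr_def sum_distrib_left sum_distrib_right mult.assoc sc_pull sc_left_comm[of X])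
  also have "\<dots> = (\<Sum>i<3. \<Sum>j<3. sc (sg i) * (sc (sg j) * (ext a j * (ext b i * (X * (ins a i * ins b j))))))"
  proof (intro sum.cong refl)
    fix i j :: nat
    have f1: "ext b i * ext a j * Z = ks i j * (ext a j * (ext b i * Z))" for Z
      using ext_ext[OF ab(3)[symmetric], of i j] by (simp add: mult.assoc)
    have f2: "ins b j * ins a i = ks i j * (ins a i * ins b j)"
      using ins_ins[OF ab(3)[symmetric], of j i] by (simp add: ks_comm)
    show "sc (sg i) * (sc (sg j) * (ext a i * (ext b j * Pt M a b) * (X * (ins b j * ins a i)))) =
       sc (sg i) * (sc (sg j) * (ext a j * (ext b i * (X * (ins a i * ins b j)))))"
      by (simp only: JJP f1 f2 ksm[of X] ksm[of "ext b i"] ksm[of "ext a j"] ks_sq)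
  qed
  also have "\<dots> = (\<Sum>i<3. \<Sum>j<3. sc (sg i) * (sc (sg j) * (ext a i * (ext b j * (X * (ins a j * ins b i))))))"
    by (subst sum.swap) (simp add: sc_sc mult.commute)
  also have "\<dots> = (\<Sum>i<3. \<Sum>j<3. sc (sg i) * (sc (sg j) * (ext a i * (ext b j * (X * (Pt M a b * (ins b j * ins a i)))))))"
    by (simp add: PII)
  also have "\<dots> = pstr a (pstr b (X * Pt M a b))"
    by (simp add: pstr_def sum_distrib_left sum_distrib_right mult.assoc sc_pull sc_left_comm[of X])
  finally show ?thesis .
qed

subsection \<open>Relations between graded transpositions\<close>

lemma Pop_eqI: "\<sigma> permutes {..<M} \<Longrightarrow> \<tau> permutes {..<M} \<Longrightarrow> \<sigma>' permutes {..<M} \<Longrightarrow> \<tau>' permutes {..<M} \<Longrightarrow>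
   \<sigma> \<circ> \<tau> = \<sigma>' \<circ> \<tau>' \<Longrightarrow> Pop M \<sigma> * Pop M \<tau> = Pop M \<sigma>' * Pop M \<tau>'"
  by (metis Pop_comp)

lemma P_commute:
  assumes "a < M" "b < M" "c < M" "d < M" "a \<noteq> c" "a \<noteq> d" "b \<noteq> c" "b \<noteq> d"
  shows "Pt M a b * Pt M c d = Pt M c d * Pt M a b"
  using assms
  by (intro Pop_eqI sw_permutes; auto simp: fun_eq_iff Transposition.transpose_def)

text \<open>\<open>A\<close>, \<open>B\<close>, \<open>C\<close> multiply like the transpositions (12), (13), (23).\<close>
locale s3 =
  fixes A B C :: lop
  assumes AB: "A * B = B * C" and CA: "C * A = B * C" and AC: "A * C = C * B" and BA: "B * A = C * B"
    and A2: "A * A = 1" and B2: "B * B = 1" and C2: "C * C = 1"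
begin

lemma apps: "app A (app B w) = app B (app C w)" "app C (app A w) = app B (app C w)"
  "app A (app C w) = app C (app B w)" "app B (app A w) = app C (app B w)"
  "app A (app A w) = w" "app B (app B w) = w" "app C (app C w) = w"
  using AB CA AC BA A2 B2 C2 by (metis times_lop.rep_eq one_lop.rep_eq)+

lemma yang_baxter: "(sc (u - v) + sc \<eta> * A) * ((sc u + sc \<eta> * B) * (sc v + sc \<eta> * C)) =
   (sc v + sc \<eta> * C) * ((sc u + sc \<eta> * B) * (sc (u - v) + sc \<eta> * A))"
  by (rule lop_eqI) (simp add: app_lin apps algebra_simps)

text \<open>Since \<open>B * C = C * A\<close> and \<open>A * (1 + A) = 1 + A\<close>, the quadratic
  term \<open>B * C * (1 + A)\<close> equals \<open>C * (1 + A)\<close>. Then \<open>B\<close> and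
  \<open>C\<close> have the same coefficient and the scalar \<open>u + \<eta>\<close> factors
  out.\<close>

lemma fuse: "(sc u + sc \<eta> * B) * ((sc (u + \<eta>) + sc \<eta> * C) * (1 + A)) =
   sc (u + \<eta>) * ((sc u + sc \<eta> * (B + C)) * (1 + A))"
  by (rule lop_eqI) (simp add: app_lin apps algebra_simps)

lemma kill: "(1 - A) * ((sc \<eta> * B) * (sc \<eta> + sc \<eta> * C)) = 0"
  by (rule lop_eqI) (simp add: app_lin apps algebra_simps)

end

lemma s3_P:
  assumes "a < M" "b < M" "n < M" "a \<noteq> b" "b \<noteq> n" "a \<noteq> n"
  shows "s3 (Pt M a b) (Pt M a n) (Pt M b n)"
proof
  show "Pt M a b * Pt M a n = Pt M a n * Pt M b n" "Pt M b n * Pt M a b = Pt M a n * Pt M b n"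
       "Pt M a b * Pt M b n = Pt M b n * Pt M a n" "Pt M a n * Pt M a b = Pt M b n * Pt M a n"
    using assms
    by (intro Pop_eqI sw_permutes; auto simp: fun_eq_iff Transposition.transpose_def)+
qed (use assms P_P in auto)

text \<open>The exchange fixes \<open>c\<close>. Emptying the two sites in turn with
  \<open>gs_peel2\<close> leaves a transposition without sign, but the collected strings do not
  quite cancel: exactly one of them has lost the sign of the other odd site.\<close>

lemma gs_sw_equal_odd:
  assumes "a < M" "b < M" "a \<noteq> b" "c a = c b" "c a \<noteq> 0"
  shows "gs M (sw a b) c = - 1"
proof -
  have id: "c \<circ> sw a b = c"
    using assms(4) by (auto simp: fun_eq_iff Transposition.transpose_def)
  let ?c = "c(b := 0)"
  have id2: "?c \<circ> sw a b = c(a := 0)"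
    using assms(3,4) by (auto simp: fun_eq_iff Transposition.transpose_def)
  have "gs M (sw a b) (c(b := 0)) = jw b c * gs M (sw a b) c * jw a c"
    using gs_peel2[where c = c, OF sw_permutes[OF assms(1,2)] assms(1)] assms(4,5) id by simp
  moreover have "gs M (sw a b) (?c(a := 0)) = jw a ?c * gs M (sw a b) ?c * jw b (c(a := 0))"
    using gs_peel2[where c = ?c, OF sw_permutes[OF assms(1,2)] assms(2)] assms(3,5) id2 by simp
  moreover have "gs M (sw a b) (?c(a := 0)) = 1"
    using assms(3) by (intro gs_sw_vac) auto
  moreover have "jw a ?c * jw b (c(a := 0)) = - (jw a c * jw b c)"
    using assms(3,4,5) by (cases a b rule: linorder_cases) (auto simp: jw_upd sg_def)
  ultimately have "1 = - (jw a c * jw b c * (jw b c * gs M (sw a b) c * jw a c))"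
    by (metis (no_types, opaque_lifting) mult.assoc mult.commute mult_minus_left)
  also have "\<dots> = - gs M (sw a b) c"
    by (simp add: mult.assoc mult.left_commute[of "jw a c"] mult.commute[of _ "jw a c"])
  finally show ?thesis by (metis add.inverse_inverse)
qed

text \<open>The twists read only the states 1 and 2 at the three sites, so two of these states
  coincide. There the transposition that fixes \<open>Q\<close> acts by -1, and the value of
  \<open>Q\<close> vanishes.\<close>

lemma KKK_antisymmetric:
  assumes lt: "a < M" "b < M" "c < M" and ne: "a \<noteq> b" "b \<noteq> c" "a \<noteq> c"
    and Q: "Pt M a b * Q = Q" "Pt M b c * Q = Q" "Pt M a c * Q = Q"
  shows "Kop K2 a * (Kop K2 b * (Kop K2 c * Q)) = 0"
proof (rule lop_eqI)
  fix w :: "cfg \<Rightarrow> complex" and z :: cfg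
  have zero: "app Q w d = 0" if "Pt M x y * Q = Q" "x < M" "y < M" "x \<noteq> y" "d x = d y" "d x \<noteq> 0" for x y d
  proof -
    have "app Q w d = gs M (sw x y) d * app Q w (d \<circ> sw x y)"
      using that(1) by (metis times_lop.rep_eq Pop.rep_eq)
    also have "d \<circ> sw x y = d"
      using that(5) by (auto simp: fun_eq_iff Transposition.transpose_def)
    finally show ?thesis using gs_sw_equal_odd[OF that(2-6)] by simp
  qed
  have h: "Khat K2 (z a) i * (Khat K2 (z b) j * (Khat K2 (z c) k * app Q w (z(a := i, b := j, c := k)))) = 0"
    for i j k
  proof (cases "Khat K2 (z a) i = 0 \<or> Khat K2 (z b) j = 0 \<or> Khat K2 (z c) k = 0")
    case False
    then have r: "i \<in> {1,2}" "j \<in> {1,2}" "k \<in> {1,2}" using Khat_nz by blast+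
    then consider "i = j" | "j = k" | "i = k" by auto
    then have "app Q w (z(a := i, b := j, c := k)) = 0"
    proof cases
      case 1 then show ?thesis using zero[OF Q(1) lt(1,2) ne(1)] r ne by auto
    next
      case 2 then show ?thesis using zero[OF Q(2) lt(2,3) ne(2)] r ne by auto
    next
      case 3 then show ?thesis using zero[OF Q(3) lt(1,3) ne(3)] r ne by auto
    qed
    then show ?thesis by simp
  qed auto
  have "(\<Sum>i<3. \<Sum>j<3. \<Sum>k<3. Khat K2 (z a) i * (Khat K2 (z b) j * (Khat K2 (z c) k * app Q w (z(a := i, b := j, c := k))))) = 0"
    by (intro sum.neutral ballI h)
  then show "app (Kop K2 a * (Kop K2 b * (Kop K2 c * Q))) w z = app 0 w z"
    using ne by (simp add: app_ring Kop.rep_eq sum_distrib_left)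
qed

subsection \<open>Interpolation\<close>

definition lag :: "nat \<Rightarrow> (nat \<Rightarrow> complex) \<Rightarrow> nat \<Rightarrow> complex \<Rightarrow> complex" where
  "lag N z a x = (\<Prod>b\<in>{1..N} - {a}. (x - z b) / (z a - z b))"

lemma fcoef_1: "fcoef N \<eta> z (Suc 0) a x = lag N z a x"
  by (simp add: fcoef_def lag_def)

lemma lag_node:
  assumes "inj_on z {1..N}" "a \<in> {1..N}" "b \<in> {1..N}"
  shows "lag N z a (z b) = (if a = b then 1 else 0)"
proof (cases "a = b")
  case True
  have "z b \<noteq> z c" if "c \<in> {1..N} - {b}" for c using assms that by (auto dest: inj_onD)
  then show ?thesis using True by (auto simp: lag_def intro!: prod.neutral)
next
  case False
  then have "lag N z a (z b) = 0"
    unfolding lag_def using assms(3) by (intro prod_zero) (auto intro!: bexI[of _ b])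
  then show ?thesis using False by simp
qed

lemma lagrange:
  assumes inj: "inj_on z {1..N}" and deg: "degree p < N"
  shows "poly p x = (\<Sum>a\<in>{1..N}. poly p (z a) * lag N z a x)"
proof -
  define L where "L a = Polynomial.smult (poly p (z a) / (\<Prod>b\<in>{1..N} - {a}. z a - z b)) (\<Prod>b\<in>{1..N} - {a}. [:- z b, 1:])" for a
  define q where "q = p - (\<Sum>a\<in>{1..N}. L a)"
  have L: "poly (L a) y = poly p (z a) * lag N z a y" for a y
    by (simp add: L_def lag_def poly_prod prod_dividef)
  have "degree (L a) < N" if "a \<in> {1..N}" for a
  proof -
    have "degree (L a) \<le> degree (\<Prod>b\<in>{1..N} - {a}. [:- z b, 1:])" by (simp add: L_def)
    also have "\<dots> \<le> (\<Sum>b\<in>{1..N} - {a}. degree [:- z b, 1:])" by (rule degree_prod_sum_le[unfolded o_def]) simp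
    also have "\<dots> < N" using that by simp
    finally show ?thesis .
  qed
  then have "degree q < N"
    unfolding q_def using deg by (intro degree_diff_less degree_sum_less) auto
  moreover have "poly q (z b) = 0" if "b \<in> {1..N}" for b
    using that by (simp add: q_def poly_sum L lag_node[OF inj] if_distrib cong: if_cong)
  then have "z ` {1..N} \<subseteq> {x. poly q x = 0}" by auto
  moreover have "card (z ` {1..N}) = N" using card_image[OF inj] by simp
  ultimately have "q = 0"
    by (metis card_mono card_poly_roots_bound poly_roots_finite leD le_trans)
  then show ?thesis
    by (metis (no_types, lifting) L poly_sum q_def eq_iff_diff_eq_0 sum.cong)
qed

lemma degree_monic_diff:
  assumes "degree p = N" "degree q = N" "coeff p N = coeff q N" "0 < N"
  shows "degree (p - q :: complex poly) < N"
proof -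
  have "degree (p - q) \<le> N" using assms by (metis degree_diff_le_max max.idem)
  moreover have "degree (p - q) \<noteq> N"
  proof
    assume "degree (p - q) = N"
    then have "lead_coeff (p - q) = 0" using assms(3) by simp
    then have "p - q = 0" by (simp only: leading_coeff_0_iff)
    then show False using \<open>degree (p - q) = N\<close> assms(4) by simp
  qed
  ultimately show ?thesis by simp
qed

definition nodepoly :: "nat \<Rightarrow> (nat \<Rightarrow> complex) \<Rightarrow> complex poly" where
  "nodepoly N z = (\<Prod>b\<in>{1..N}. [:- z b, 1:])"

lemma degree_nodepoly: "degree (nodepoly N z) = N" "coeff (nodepoly N z) N = 1"
proof -
  show d: "degree (nodepoly N z) = N"
    unfolding nodepoly_def by (subst degree_prod_eq_sum_degree) auto
  show "coeff (nodepoly N z) N = 1"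
    using lead_coeff_prod[of "\<lambda>b. [:- z b, 1:]" "{1..N}"] d by (simp add: nodepoly_def)
qed

lemma poly_nodepoly: "poly (nodepoly N z) x = (\<Prod>b\<in>{1..N}. x - z b)"
  by (simp add: nodepoly_def poly_prod)

lemma lagrange_monic:
  assumes inj: "inj_on z {1..N}" and N: "0 < N" and p: "degree p = N" "coeff p N = 1"
  shows "poly p x = (\<Prod>b\<in>{1..N}. x - z b) + (\<Sum>a\<in>{1..N}. poly p (z a) * lag N z a x)"
proof -
  have "degree (p - nodepoly N z) < N"
    using p N by (intro degree_monic_diff) (simp_all add: degree_nodepoly)
  from lagrange[OF inj this, of x]
  have "poly p x - (\<Prod>b\<in>{1..N}. x - z b) =
     (\<Sum>a\<in>{1..N}. (poly p (z a) - (\<Prod>b\<in>{1..N}. z a - z b)) * lag N z a x)"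
    by (simp add: poly_nodepoly)
  also have "\<dots> = (\<Sum>a\<in>{1..N}. poly p (z a) * lag N z a x)"
  proof (rule sum.cong[OF refl])
    fix a assume "a \<in> {1..N}"
    then have "(\<Prod>b\<in>{1..N}. z a - z b) = 0" by (intro prod_zero) auto
    then show "(poly p (z a) - (\<Prod>b\<in>{1..N}. z a - z b)) * lag N z a x = poly p (z a) * lag N z a x"
      by simp
  qed
  finally show ?thesis by (simp add: algebra_simps)
qed

lemma lagrange_dpoly:
  assumes inj: "inj_on z {1..N}" and N: "0 < N"
  shows "dpoly N y x = dpoly N z x + (\<Sum>a\<in>{1..N}. dpoly N y (z a) * lag N z a x)"
  using lagrange_monic[OF inj N degree_nodepoly, of y x] by (simp add: poly_nodepoly dpoly_def)

lemma lagrange_lag: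
  assumes inj: "inj_on z {1..N}" and N: "0 < N" and c: "c \<in> {1..N}"
  shows "lag N y c x = (\<Sum>a\<in>{1..N}. lag N y c (z a) * lag N z a x)"
proof -
  define p where "p = Polynomial.smult (1 / (\<Prod>b\<in>{1..N} - {c}. y c - y b)) (\<Prod>b\<in>{1..N} - {c}. [:- y b, 1:])"
  have "degree p \<le> (\<Sum>b\<in>{1..N} - {c}. degree [:- y b, 1:])"
    unfolding p_def by (rule order_trans[OF degree_smult_le degree_prod_sum_le[unfolded o_def]]) simp
  also have "\<dots> < N" using c by simp
  finally have "degree p < N" .
  from lagrange[OF inj this, of x]
  show ?thesis by (simp add: p_def lag_def poly_prod prod_dividef)
qed

section \<open>Operator-valued polynomials in the spectral parameter\<close>

definition lpoly :: "nat \<Rightarrow> (complex \<Rightarrow> lop) \<Rightarrow> lop \<Rightarrow> bool" where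
  "lpoly k F G \<longleftrightarrow> (\<exists>D. D k = G \<and> (\<forall>l. F l = (\<Sum>j\<le>k. sc (l ^ j) * D j)))"

lemma lpoly_step: assumes "lpoly k F G" shows "lpoly (Suc k) (\<lambda>l. (sc (l - c) + X) * F l) G"
proof -
  obtain D where D: "D k = G" "\<And>l. F l = (\<Sum>j\<le>k. sc (l ^ j) * D j)"
    using assms by (auto simp: lpoly_def)
  define D1 where "D1 j = (if j = 0 then 0 else D (j - 1))" for j
  define D2 where "D2 j = (if j \<le> k then (X - sc c) * D j else 0)" for j
  have "(sc (l - c) + X) * F l = (\<Sum>j\<le>Suc k. sc (l ^ j) * (D1 j + D2 j))" for l
  proof -
    have "(\<Sum>j\<le>Suc k. sc (l ^ j) * D1 j) = (\<Sum>j\<le>k. sc (l ^ Suc j) * D j)"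
      by (subst sum.atMost_Suc_shift) (simp add: D1_def)
    also have "\<dots> = sc l * F l"
      by (simp add: D(2) sum_distrib_left sc_mult mult.assoc)
    finally have 1: "(\<Sum>j\<le>Suc k. sc (l ^ j) * D1 j) = sc l * F l" .
    have "(\<Sum>j\<le>Suc k. sc (l ^ j) * D2 j) = (\<Sum>j\<le>k. sc (l ^ j) * ((X - sc c) * D j))"
      by (simp add: D2_def)
    also have "\<dots> = (X - sc c) * F l"
      by (simp add: D(2) sum_distrib_left sc_left_comm[of "X - sc c"])
    finally show ?thesis using 1
      by (simp add: algebra_simps sum.distrib sc_diff del: sum.atMost_Suc)
  qed
  then show ?thesis
    unfolding lpoly_def by (intro exI[of _ "\<lambda>j. D1 j + D2 j"]) (simp add: D1_def D2_def D(1))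
qed

lemma lpoly_left: assumes "lpoly k F G" shows "lpoly k (\<lambda>l. X * F l) (X * G)"
proof -
  obtain D where "D k = G" "\<And>l. F l = (\<Sum>j\<le>k. sc (l ^ j) * D j)"
    using assms by (auto simp: lpoly_def)
  then show ?thesis unfolding lpoly_def
    by (intro exI[of _ "\<lambda>j. X * D j"]) (simp add: sum_distrib_left sc_left_comm[of X])
qed

lemma lpoly_right: assumes "lpoly k F G" shows "lpoly k (\<lambda>l. F l * X) (G * X)"
proof -
  obtain D where "D k = G" "\<And>l. F l = (\<Sum>j\<le>k. sc (l ^ j) * D j)"
    using assms by (auto simp: lpoly_def)
  then show ?thesis unfolding lpoly_def
    by (intro exI[of _ "\<lambda>j. D j * X"]) (simp add: sum_distrib_right mult.assoc)
qed

lemma lpoly_pstr: assumes "lpoly k F G" shows "lpoly k (\<lambda>l. pstr p (F l)) (pstr p G)"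
proof -
  obtain D where "D k = G" "\<And>l. F l = (\<Sum>j\<le>k. sc (l ^ j) * D j)"
    using assms by (auto simp: lpoly_def)
  then show ?thesis unfolding lpoly_def
    by (intro exI[of _ "\<lambda>j. pstr p (D j)"]) (simp add: pstr_sum pstr_sc)
qed

text \<open>Powers below N are determined by the N nodes. The power \<open>l ^ N\<close> leaves the
  extra term \<open>dpoly N z l\<close>, which vanishes at all nodes and carries the top coefficient
  \<open>G\<close>.\<close>

lemma lpoly_interpolate:
  assumes F: "lpoly N F G" and inj: "inj_on z {1..N}" and N: "0 < N"
  shows "F l = sc (dpoly N z l) * G + (\<Sum>a\<in>{1..N}. sc (lag N z a l) * F (z a))"
proof -
  obtain D where D: "D N = G" "\<And>l. F l = (\<Sum>j\<le>N. sc (l ^ j) * D j)"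
    using F by (auto simp: lpoly_def)
  have pw: "l ^ j = (\<Sum>a\<in>{1..N}. z a ^ j * lag N z a l)" if "j < N" for j
    using lagrange[OF inj, of "monom 1 j" l] that by (simp add: degree_monom_eq poly_monom)
  have top: "l ^ N = dpoly N z l + (\<Sum>a\<in>{1..N}. z a ^ N * lag N z a l)"
    using lagrange_monic[OF inj N, of "monom 1 N" l] by (simp add: degree_monom_eq poly_monom dpoly_def)
  have "(\<Sum>a\<in>{1..N}. sc (lag N z a l) * F (z a)) = (\<Sum>a\<in>{1..N}. \<Sum>j\<le>N. sc (z a ^ j * lag N z a l) * D j)"
    by (simp add: D(2) sum_distrib_left sc_sc mult.commute)
  also have "\<dots> = (\<Sum>j\<le>N. sc (\<Sum>a\<in>{1..N}. z a ^ j * lag N z a l) * D j)"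
    by (subst sum.swap) (simp add: sc_sum sum_distrib_right)
  finally have "sc (dpoly N z l) * G + (\<Sum>a\<in>{1..N}. sc (lag N z a l) * F (z a)) =
      sc (dpoly N z l) * G + (\<Sum>j\<le>N. sc (\<Sum>a\<in>{1..N}. z a ^ j * lag N z a l) * D j)" by simp
  also have "\<dots> = (\<Sum>j<N. sc (l ^ j) * D j) + sc (l ^ N) * D N"
    by (simp add: lessThan_Suc_atMost[symmetric] pw top D(1) sc_add distrib_right)
  also have "\<dots> = F l" by (simp add: D(2) lessThan_Suc_atMost[symmetric])
  finally show ?thesis by simp
qed

subsection \<open>Monodromy and transfer matrices\<close>

lemma fixed_by: "(1 - p) * z = (0 :: 'a :: ring_1) \<Longrightarrow> p * z = z"
  by (simp add: left_diff_distrib)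

locale chain =
  fixes N :: nat and \<eta> :: complex and \<xi> :: "nat \<Rightarrow> complex" and K2 :: "nat \<Rightarrow> nat \<Rightarrow> complex"
begin

abbreviation M :: nat where "M \<equiv> N + 3"
abbreviation K :: "nat \<Rightarrow> lop" where "K \<equiv> Kop K2"

definition R :: "nat \<Rightarrow> nat \<Rightarrow> complex \<Rightarrow> lop" where
  "R a n u = sc u + sc \<eta> * Pt M a n"

fun MM :: "nat \<Rightarrow> nat \<Rightarrow> complex \<Rightarrow> lop" where
  "MM a 0 l = 1"
| "MM a (Suc k) l = R a (Suc k) (l - \<xi> (Suc k)) * MM a k l"

text \<open>Sites \<open>1..N\<close> are quantum; \<open>0\<close>, \<open>N+1\<close>, \<open>N+2\<close> are three copies of the auxiliary space.\<close>
definition aux :: "nat \<Rightarrow> bool" where "aux a \<longleftrightarrow> a = 0 \<or> a = N + 1 \<or> a = N + 2"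

lemma aux_lt: "aux a \<Longrightarrow> a < M" by (auto simp: aux_def)
lemma aux_site: "aux a \<Longrightarrow> 0 < n \<Longrightarrow> n \<le> N \<Longrightarrow> a \<noteq> n" by (auto simp: aux_def)

lemma R_comm_disjoint:
  assumes "a < M" "b < M" "m < M" "n < M" "a \<noteq> b" "a \<noteq> n" "m \<noteq> b" "m \<noteq> n"
  shows "R a m u * R b n v = R b n v * R a m u"
proof (rule lop_eqI)
  fix w :: "cfg \<Rightarrow> complex" and c :: cfg
  have "app (Pt M a m) (app (Pt M b n) w) = app (Pt M b n) (app (Pt M a m) w)" for w
    using P_commute[OF assms(1,3,2,4,5,6,7,8)] by (metis times_lop.rep_eq)
  then show "app (R a m u * R b n v) w c = app (R b n v * R a m u) w c"
    by (simp add: R_def app_lin algebra_simps)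
qed

lemma R_MM_comm:
  assumes "aux a" "aux b" "a \<noteq> b" "k < n" "n \<le> N"
  shows "R b n u * MM a k l = MM a k l * R b n u"
  using assms(4)
proof (induction k)
  case (Suc k)
  have "R b n u * R a (Suc k) v = R a (Suc k) v * R b n u" for v
    using assms Suc.prems aux_lt[OF assms(1)] aux_lt[OF assms(2)]
      aux_site[OF assms(1), of n] aux_site[OF assms(1), of "Suc k"]
      aux_site[OF assms(2), of n] aux_site[OF assms(2), of "Suc k"]
    by (intro R_comm_disjoint) auto
  then have "R b n u * MM a (Suc k) l = R a (Suc k) (l - \<xi> (Suc k)) * (R b n u * MM a k l)"
    by (simp flip: mult.assoc)
  then show ?case using Suc by (simp add: mult.assoc)
qed simp

lemma free_R: "p < M \<Longrightarrow> a < M \<Longrightarrow> n < M \<Longrightarrow> p \<noteq> a \<Longrightarrow> p \<noteq> n \<Longrightarrow> free p (R a n u)"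
  unfolding R_def by (intro free_add free_mult free_sc free_P)

lemma free_MM:
  assumes "aux p" "aux a" "p \<noteq> a" "k \<le> N" shows "free p (MM a k l)"
  using assms(4)
proof (induction k)
  case (Suc k)
  then show ?case
    using assms aux_lt[OF assms(1)] aux_lt[OF assms(2)] aux_site[OF assms(1), of "Suc k"]
    by (auto intro!: free_mult free_R)
qed simp

lemma K_R_comm: "a < M \<Longrightarrow> n < M \<Longrightarrow> b \<noteq> a \<Longrightarrow> b \<noteq> n \<Longrightarrow> R a n u * K b = K b * R a n u"
  using Pop_K[OF sw_permutes[of a M n], of K2 b]
  by (simp add: R_def algebra_simps sc_comm[of "K b"] sc_left_comm[of "K b"])

lemma MM_K_comm:
  assumes "aux a" "aux b" "a \<noteq> b" "k \<le> N" shows "MM a k l * K b = K b * MM a k l"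
  using assms(4)
proof (induction k)
  case (Suc k)
  have "R a (Suc k) u * K b = K b * R a (Suc k) u" for u
    using Suc.prems assms aux_lt[OF assms(1)] aux_site[OF assms(2), of "Suc k"] by (intro K_R_comm) auto
  then show ?case using Suc by (simp add: mult.assoc) (simp flip: mult.assoc)
qed simp

lemma s3_site:
  assumes "aux a" "aux b" "a \<noteq> b" "0 < n" "n \<le> N" shows "s3 (Pt M a b) (Pt M a n) (Pt M b n)"
  using assms aux_lt[OF assms(1)] aux_lt[OF assms(2)] aux_site[OF assms(1,4,5)] aux_site[OF assms(2,4,5)]
  by (intro s3_P) auto

lemma RRR:
  assumes "aux a" "aux b" "a \<noteq> b" "0 < n" "n \<le> N"
  shows "R a b (u - v) * (R a n u * R b n v) = R b n v * (R a n u * R a b (u - v))"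
  unfolding R_def by (rule s3.yang_baxter[OF s3_site[OF assms]])

lemma MM_pair:
  assumes "aux a" "aux b" "a \<noteq> b" "Suc k \<le> N"
  shows "MM a (Suc k) l * MM b (Suc k) m =
    R a (Suc k) (l - \<xi> (Suc k)) * R b (Suc k) (m - \<xi> (Suc k)) * (MM a k l * MM b k m)"
proof -
  have "MM a k l * R b (Suc k) v = R b (Suc k) v * MM a k l" for v
    using R_MM_comm[OF assms(1-3) lessI assms(4)] by simp
  then have "MM a k l * (R b (Suc k) v * Z) = R b (Suc k) v * (MM a k l * Z)" for v Z
    by (simp flip: mult.assoc)
  then show ?thesis by (simp add: mult.assoc)
qed

text \<open>Train argument: the Yang-Baxter equation carries \<open>R a b\<close> through one site
  at a time, after the factors of that site have been collected by \<open>MM_pair\<close>.\<close>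

lemma RTT:
  assumes "aux a" "aux b" "a \<noteq> b" "k \<le> N"
  shows "R a b (l - m) * (MM a k l * MM b k m) = MM b k m * MM a k l * R a b (l - m)"
  using assms(4)
proof (induction k)
  case (Suc k)
  let ?u = "l - \<xi> (Suc k)" and ?v = "m - \<xi> (Suc k)"
  have YB: "R a b (l - m) * (R a (Suc k) ?u * R b (Suc k) ?v) = R b (Suc k) ?v * (R a (Suc k) ?u * R a b (l - m))"
    using RRR[OF assms(1-3), of "Suc k" ?u ?v] Suc.prems by simp
  have "R a b (l - m) * (MM a (Suc k) l * MM b (Suc k) m) =
      R a b (l - m) * (R a (Suc k) ?u * R b (Suc k) ?v) * (MM a k l * MM b k m)"
    unfolding MM_pair[OF assms(1-3) Suc.prems] by (simp add: mult.assoc)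
  also have "\<dots> = R b (Suc k) ?v * (R a (Suc k) ?u * (R a b (l - m) * (MM a k l * MM b k m)))"
    unfolding YB by (simp add: mult.assoc)
  also have "\<dots> = R b (Suc k) ?v * (R a (Suc k) ?u * (MM b k m * MM a k l * R a b (l - m)))"
    using Suc by simp
  also have "\<dots> = MM b (Suc k) m * MM a (Suc k) l * R a b (l - m)"
    unfolding MM_pair[OF assms(2,1) assms(3)[symmetric] Suc.prems] by (simp add: mult.assoc)
  finally show ?case .
qed simp

definition T :: "nat \<Rightarrow> complex \<Rightarrow> lop" where "T a l = pstr a (K a * MM a N l)"

lemma T_mult_pstr:
  assumes "aux a" "aux b" "a \<noteq> b"
  shows "T a l * T b m = pstr a (pstr b (K a * K b * (MM a N l * MM b N m)))"
proof -
  have "free b (K a * MM a N l)" "free a (K b * MM b N m)"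
    using assms by (auto intro!: free_mult free_K free_MM)
  from pstr_mult[OF this assms(3)]
  have "T a l * T b m = pstr a (pstr b (K a * MM a N l * (K b * MM b N m)))" by (simp add: T_def)
  also have "K a * MM a N l * (K b * MM b N m) = K a * (MM a N l * K b) * MM b N m"
    by (simp add: mult.assoc)
  also have "\<dots> = K a * K b * (MM a N l * MM b N m)"
    by (simp only: MM_K_comm[OF assms order_refl] mult.assoc)
  finally show ?thesis .
qed

lemma P_KK: assumes "a < M" "b < M" "a \<noteq> b" shows "Pt M a b * (K a * K b) = K a * K b * Pt M a b"
proof -
  have "Pt M a b * K a = K b * Pt M a b" "Pt M a b * K b = K a * Pt M a b"
    using Pop_K[OF sw_permutes[OF assms(1,2)], of K2 a] Pop_K[OF sw_permutes[OF assms(1,2)], of K2 b] by simp_all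
  then have "Pt M a b * (K a * K b) = K b * K a * Pt M a b"
    by (metis mult.assoc)
  then show ?thesis using K_comm[OF assms(3), of K2] by simp
qed

lemma pstr_R_cyclic:
  assumes "a < M" "b < M" "a \<noteq> b"
  shows "pstr a (pstr b (R a b u * X)) = pstr a (pstr b (X * R a b u))"
  using pstr_swap_cyclic[OF assms]
  by (simp add: R_def algebra_simps pstr_add pstr_sc sc_comm[of X] sc_left_comm[of X] mult.assoc)

lemma R_unitarity: assumes "a < M" "b < M" shows "R a b u * R a b (- u) = sc (\<eta>\<^sup>2 - u\<^sup>2)"
proof (rule lop_eqI)
  fix w :: "cfg \<Rightarrow> complex" and c :: cfg
  have "app (Pt M a b) (app (Pt M a b) w) = w" for w
    using P_P[OF assms] by (metis times_lop.rep_eq one_lop.rep_eq)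
  then show "app (R a b u * R a b (- u)) w c = app (sc (\<eta>\<^sup>2 - u\<^sup>2)) w c"
    by (simp add: R_def app_lin algebra_simps power2_eq_square)
qed

text \<open>\<open>R a b (l - m)\<close> and its inverse are inserted, the first reverses the order
  of the monodromies, and cyclicity joins the two again. The inverse exists up to the scalar
  \<open>\<eta>\<^sup>2 - (l - m)\<^sup>2\<close>, which has to be cancelled; at the nodes this is
  possible by non-resonance.\<close>

lemma T_commute:
  assumes ab: "aux a" "aux b" "a \<noteq> b" and ne: "(l - m)\<^sup>2 \<noteq> \<eta>\<^sup>2"
  shows "T a l * T b m = T b m * T a l"
proof -
  note lt = aux_lt[OF ab(1)] aux_lt[OF ab(2)]
  let ?u = "l - m" and ?KK = "K a * K b"
  let ?W = "MM a N l * MM b N m" and ?W' = "MM b N m * MM a N l"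
  have KR: "R a b u * ?KK = ?KK * R a b u" for u
    using P_KK[OF lt ab(3)]
    by (simp add: R_def distrib_left distrib_right mult.assoc sc_comm[of "K a"] sc_comm[of "K b"] sc_left_comm[of "K a"] sc_left_comm[of "K b"])
  have "sc (\<eta>\<^sup>2 - ?u\<^sup>2) * (?KK * ?W) = ?KK * (sc (\<eta>\<^sup>2 - ?u\<^sup>2) * ?W)"
    by (simp add: sc_left_comm[of "K a"] sc_left_comm[of "K b"] mult.assoc)
  also have "\<dots> = ?KK * (R a b (- ?u) * (R a b ?u * ?W))"
    using R_unitarity[OF lt, of "- ?u"] by (simp add: power2_commute[of m l] flip: mult.assoc)
  also have "\<dots> = R a b (- ?u) * (?KK * ?W' * R a b ?u)"
    unfolding RTT[OF ab order_refl] by (simp add: KR[symmetric] flip: mult.assoc)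
  finally have "pstr a (pstr b (sc (\<eta>\<^sup>2 - ?u\<^sup>2) * (?KK * ?W))) = pstr a (pstr b (?KK * ?W' * R a b ?u * R a b (- ?u)))"
    by (simp add: pstr_R_cyclic[OF lt ab(3)])
  also have "\<dots> = pstr a (pstr b (sc (\<eta>\<^sup>2 - ?u\<^sup>2) * (?KK * ?W')))"
    using R_unitarity[OF lt, of ?u]
    by (simp add: mult.assoc sc_comm[of "?W'"] sc_comm[of "MM a N l"]
        sc_left_comm[of "K a"] sc_left_comm[of "K b"] sc_left_comm[of "MM b N m"])
  finally have "sc (\<eta>\<^sup>2 - ?u\<^sup>2) * pstr a (pstr b (?KK * ?W)) = sc (\<eta>\<^sup>2 - ?u\<^sup>2) * pstr a (pstr b (?KK * ?W'))"
    by (simp add: pstr_sc)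
  then have "pstr a (pstr b (?KK * ?W)) = pstr a (pstr b (?KK * ?W'))"
    using ne by (subst (asm) sc_cancel) auto
  also have "\<dots> = pstr b (pstr a (K b * K a * ?W'))"
    using pstr_pstr_comm[OF ab(3)] K_comm[OF ab(3), of K2] by simp
  finally show ?thesis
    using ab by (simp add: T_mult_pstr)
qed

subsection \<open>Fusion\<close>

text \<open>At this argument R degenerates to a multiple of the antisymmetrizer. This is the origin
  of the shift by \<eta> in all fusion relations.\<close>

lemma PR: "sc (- \<eta>) * (1 - Pt M a b) = R a b (- \<eta>)"
  by (simp add: R_def sc_minus right_diff_distrib)

lemma antisym_MM:
  assumes eta: "\<eta> \<noteq> 0" and ab: "aux a" "aux b" "a \<noteq> b"
  shows "(1 - Pt M a b) * (MM a N l * MM b N (l + \<eta>)) = MM b N (l + \<eta>) * MM a N l * (1 - Pt M a b)"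
proof -
  have "sc (- \<eta>) * ((1 - Pt M a b) * (MM a N l * MM b N (l + \<eta>))) =
    sc (- \<eta>) * (MM b N (l + \<eta>) * MM a N l * (1 - Pt M a b))"
    using RTT[OF ab order_refl, of l "l + \<eta>"]
    by (simp add: PR[symmetric] mult.assoc sc_left_comm[of "MM b N (l + \<eta>)"] sc_left_comm[of "MM a N l"])
  then show ?thesis using eta by (subst (asm) sc_cancel) auto
qed

lemma sym_MM:
  assumes eta: "\<eta> \<noteq> 0" and ab: "aux a" "aux b" "a \<noteq> b"
  shows "Pt M a b * (MM a N l * MM b N (l + \<eta>) * (1 + Pt M a b)) = MM a N l * MM b N (l + \<eta>) * (1 + Pt M a b)"
proof -
  have "(1 - Pt M a b) * (1 + Pt M a b) = 0"
    using P_P[OF aux_lt[OF ab(1)] aux_lt[OF ab(2)]] by (simp add: algebra_simps)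
  then have "(1 - Pt M a b) * (MM a N l * MM b N (l + \<eta>)) * (1 + Pt M a b) = 0"
    unfolding antisym_MM[OF assms] by (simp add: mult.assoc)
  then show ?thesis by (intro fixed_by) (simp only: mult.assoc)
qed

lemma antisym_R:
  assumes eta: "\<eta> \<noteq> 0" and ab: "aux a" "aux b" "a \<noteq> b" and n: "0 < n" "n \<le> N"
  shows "(1 - Pt M a b) * (R a n u * R b n (u + \<eta>)) = R b n (u + \<eta>) * R a n u * (1 - Pt M a b)"
proof -
  have "sc (- \<eta>) * ((1 - Pt M a b) * (R a n u * R b n (u + \<eta>))) =
    sc (- \<eta>) * (R b n (u + \<eta>) * R a n u * (1 - Pt M a b))"
    using RRR[OF ab n, of u "u + \<eta>"]
    by (simp add: PR[symmetric] mult.assoc sc_left_comm[of "R b n (u + \<eta>)"] sc_left_comm[of "R a n u"])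
  then show ?thesis using eta by (subst (asm) sc_cancel) auto
qed

text \<open>At \<open>\<xi>\<^sub>n\<close> the factors of site \<open>n\<close> are \<open>\<eta>\<^sup>2 P\<^sub>a\<^sub>n (1 + P\<^sub>b\<^sub>n)\<close>, which the antisymmetrizer of
  \<open>a, b\<close> turns into \<open>P\<^sub>a\<^sub>n (1 - P\<^sub>b\<^sub>n) (1 + P\<^sub>b\<^sub>n) = 0\<close>.\<close>
lemma antisym_MM_node:
  assumes eta: "\<eta> \<noteq> 0" and ab: "aux a" "aux b" "a \<noteq> b" and n: "0 < n" "n \<le> k" "k \<le> N"
  shows "(1 - Pt M a b) * (MM a k (\<xi> n) * MM b k (\<xi> n + \<eta>)) = 0"
  using n(2,3)
proof (induction k rule: dec_induct)
  case base
  obtain j where j: "n = Suc j" using n(1) by (cases n) auto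
  have "(1 - Pt M a b) * (R a n 0 * R b n \<eta>) = 0"
    unfolding R_def using s3.kill[OF s3_site[OF ab n(1)]] n by simp
  then show ?case
    using base MM_pair[OF ab, of j "\<xi> n" "\<xi> n + \<eta>"] by (simp add: j del: MM.simps flip: mult.assoc)
next
  case (step k)
  have *: "(1 - Pt M a b) * (R a (Suc k) u * R b (Suc k) (u + \<eta>)) = R b (Suc k) (u + \<eta>) * R a (Suc k) u * (1 - Pt M a b)" for u
    by (rule antisym_R[OF eta ab]) (use step in auto)
  have e: "\<xi> n + \<eta> - \<xi> (Suc k) = (\<xi> n - \<xi> (Suc k)) + \<eta>" by simp
  show ?case
    unfolding MM_pair[OF ab step.prems] e mult.assoc[symmetric] *[unfolded mult.assoc[symmetric]]
    using step by (simp add: mult.assoc)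
qed

text \<open>What is left of the two monodromies at \<open>l\<close> and \<open>l + \<eta>\<close> on
  the symmetric subspace when a scalar factor has been divided out at each site: linear instead of
  quadratic in \<open>l\<close> per site.\<close>

fun LL :: "nat \<Rightarrow> nat \<Rightarrow> nat \<Rightarrow> complex \<Rightarrow> lop" where
  "LL a b 0 l = 1"
| "LL a b (Suc k) l = (sc (l - \<xi> (Suc k)) + sc \<eta> * (Pt M a (Suc k) + Pt M b (Suc k))) * LL a b k l"

lemma P_LL:
  assumes ab: "aux a" "aux b" "a \<noteq> b" and k: "k \<le> N"
  shows "LL a b k l * Pt M a b = Pt M a b * LL a b k l"
  using k
proof (induction k)
  case (Suc k)
  interpret s3 "Pt M a b" "Pt M a (Suc k)" "Pt M b (Suc k)"
    using Suc.prems by (intro s3_site ab) auto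
  have *: "(sc u + sc \<eta> * (Pt M a (Suc k) + Pt M b (Suc k))) * Pt M a b = Pt M a b * (sc u + sc \<eta> * (Pt M a (Suc k) + Pt M b (Suc k)))" for u
    by (rule lop_eqI) (simp add: app_lin apps algebra_simps)
  have "LL a b (Suc k) l * Pt M a b = (sc (l - \<xi> (Suc k)) + sc \<eta> * (Pt M a (Suc k) + Pt M b (Suc k))) * Pt M a b * LL a b k l"
    using Suc by (simp add: mult.assoc)
  then show ?case unfolding * by (simp add: mult.assoc)
qed simp

text \<open>The relation \<open>fuse\<close> wants the symmetrizer directly to the right of the
  factors of the current site; \<open>P_LL\<close> moves it past the sites already treated.\<close>

lemma MM_LL:
  assumes ab: "aux a" "aux b" "a \<noteq> b" and k: "k \<le> N"
  shows "MM a k l * MM b k (l + \<eta>) * (1 + Pt M a b) = sc (dpoly k \<xi> (l + \<eta>)) * (LL a b k l * (1 + Pt M a b))"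
  using k
proof (induction k)
  case 0 then show ?case by (simp add: dpoly_def)
next
  case (Suc k)
  let ?u = "l - \<xi> (Suc k)" and ?L = "sc (l - \<xi> (Suc k)) + sc \<eta> * (Pt M a (Suc k) + Pt M b (Suc k))"
  interpret s3 "Pt M a b" "Pt M a (Suc k)" "Pt M b (Suc k)"
    using Suc.prems by (intro s3_site ab) auto
  have c: "LL a b k l * (1 + Pt M a b) = (1 + Pt M a b) * LL a b k l"
    using P_LL[OF ab, of k l] Suc.prems by (simp add: algebra_simps)
  have e: "l + \<eta> - \<xi> (Suc k) = ?u + \<eta>" by simp
  have "MM a (Suc k) l * MM b (Suc k) (l + \<eta>) * (1 + Pt M a b) =
     R a (Suc k) ?u * R b (Suc k) (?u + \<eta>) * (MM a k l * MM b k (l + \<eta>) * (1 + Pt M a b))"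
    unfolding MM_pair[OF ab Suc.prems] e by (simp add: mult.assoc)
  also have "\<dots> = sc (dpoly k \<xi> (l + \<eta>)) * (R a (Suc k) ?u * (R b (Suc k) (?u + \<eta>) * (1 + Pt M a b)) * LL a b k l)"
    using Suc by (simp add: c sc_left_comm[of "R a (Suc k) ?u"] sc_left_comm[of "R b (Suc k) (?u + \<eta>)"] mult.assoc)
  also have "\<dots> = sc (dpoly k \<xi> (l + \<eta>)) * (sc (?u + \<eta>) * (?L * (1 + Pt M a b)) * LL a b k l)"
    unfolding R_def fuse ..
  also have "\<dots> = sc (dpoly (Suc k) \<xi> (l + \<eta>)) * (LL a b (Suc k) l * (1 + Pt M a b))"
  proof -
    have d: "dpoly (Suc k) \<xi> (l + \<eta>) = dpoly k \<xi> (l + \<eta>) * (?u + \<eta>)"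
      by (simp add: dpoly_def algebra_simps)
    show ?thesis by (simp only: d sc_mult LL.simps mult.assoc c)
  qed
  finally show ?case .
qed

text \<open>Twice the second fused transfer matrix, divided by its trivial factor \<open>d(l + \<eta>)\<close>.\<close>
definition T2 :: "nat \<Rightarrow> nat \<Rightarrow> complex \<Rightarrow> lop" where
  "T2 b c l = pstr b (pstr c (K b * K c * (LL b c N l * (1 + Pt M b c))))"

lemma T2_MM:
  assumes "aux b" "aux c" "b \<noteq> c"
  shows "sc (dpoly N \<xi> (l + \<eta>)) * T2 b c l =
    pstr b (pstr c (K b * K c * (MM b N l * MM c N (l + \<eta>) * (1 + Pt M b c))))"
  unfolding MM_LL[OF assms order_refl] T2_def
  by (simp add: sc_left_comm[of "K b"] sc_left_comm[of "K c"] pstr_sc mult.assoc)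

text \<open>At \<open>\<xi> n\<close> the antisymmetrizer kills the product of the monodromies, so
  the transposition in \<open>T2\<close> can be cycled to the front and absorbed. Hence
  \<open>1 + Pt M a b\<close> merely doubles the supertrace.\<close>

lemma fusion_node:
  assumes eta: "\<eta> \<noteq> 0" and ab: "aux a" "aux b" "a \<noteq> b" and n: "n \<in> {1..N}"
  shows "sc 2 * (T a (\<xi> n) * T b (\<xi> n + \<eta>)) = sc (dpoly N \<xi> (\<xi> n + \<eta>)) * T2 a b (\<xi> n)"
proof -
  note lt = aux_lt[OF ab(1)] aux_lt[OF ab(2)]
  let ?KK = "K a * K b" and ?W = "MM a N (\<xi> n) * MM b N (\<xi> n + \<eta>)"
  have PW: "Pt M a b * ?W = ?W"
    using antisym_MM_node[OF eta ab, of n N] n by (intro fixed_by) simp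
  have "pstr a (pstr b (?KK * ?W * Pt M a b)) = pstr a (pstr b (Pt M a b * (?KK * ?W)))"
    by (rule pstr_swap_cyclic[OF lt ab(3), symmetric])
  also have "Pt M a b * (?KK * ?W) = ?KK * ?W"
    using P_KK[OF lt ab(3)] PW by (metis mult.assoc)
  finally have "pstr a (pstr b (?KK * ?W * Pt M a b)) = pstr a (pstr b (?KK * ?W))" .
  moreover have "sc 2 = 1 + 1" by (simp flip: sc_add sc_1)
  ultimately show ?thesis
    unfolding T2_MM[OF ab] T_mult_pstr[OF ab]
    by (simp add: distrib_left distrib_right pstr_add mult.assoc mult_2)
qed

text \<open>Inserting the full symmetrizer of the three auxiliary spaces multiplies the supertrace
  of \<open>Y * (1 + Pt M b c)\<close> by 3. By cyclicity the symmetrizer can also stand in front,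
  where it meets the three twists and gives 0. The fused transfer matrix occurs here with its scalar
  factor at \<open>\<xi> n + \<eta>\<close>, and \<open>nz\<close> permits cancelling it.\<close>

lemma cubic_node:
  assumes eta: "\<eta> \<noteq> 0" and abc: "aux a" "aux b" "aux c" "a \<noteq> b" "b \<noteq> c" "a \<noteq> c" and n: "n \<in> {1..N}"
    and nz: "dpoly N \<xi> (\<xi> n + \<eta> + \<eta>) \<noteq> 0"
  shows "T a (\<xi> n) * T2 b c (\<xi> n + \<eta>) = 0"
proof -
  note lt = aux_lt[OF abc(1)] aux_lt[OF abc(2)] aux_lt[OF abc(3)]
  let ?s = "Pt M a b" and ?t = "Pt M b c"
  let ?KKK = "K a * (K b * K c)"
  let ?A = "MM a N (\<xi> n)" and ?B = "MM b N (\<xi> n + \<eta>)" and ?C = "MM c N (\<xi> n + \<eta> + \<eta>)"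
  let ?W = "?A * (?B * ?C)" and ?e = "1 + ?t"
  define tr where "tr X = pstr a (pstr b (pstr c X))" for X
  have add: "tr (X + Y) = tr X + tr Y" for X Y by (simp add: tr_def pstr_add)
  have trt: "tr (?t * X) = tr (X * ?t)" for X
    unfolding tr_def using pstr_swap_cyclic[OF lt(2,3) abc(5), of X] by simp
  have trs: "tr (?s * X) = tr (X * ?s)" for X
    using pstr_swap_cyclic[OF lt(1,2) abc(4), of "pstr c X"]
  proof -
    have *: "tr X = pstr c (pstr a (pstr b X))" for X
      using pstr_pstr_comm[OF abc(5)] pstr_pstr_comm[OF abc(6)] by (simp add: tr_def)
    show ?thesis unfolding * using pstr_swap_cyclic[OF lt(1,2) abc(4), of X] by simp
  qed
  have sK: "?s * ?KKK = ?KKK * ?s"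
  proof -
    have "?s * K c = K c * ?s"
      using Pop_K[OF sw_permutes[OF lt(1,2)], of K2 c] abc by (simp add: Transposition.transpose_def)
    moreover have "?s * (K a * K b) = K a * K b * ?s" by (rule P_KK[OF lt(1,2) abc(4)])
    ultimately show ?thesis by (metis mult.assoc)
  qed
  have tK: "?t * ?KKK = ?KKK * ?t"
  proof -
    have "?t * K a = K a * ?t"
      using Pop_K[OF sw_permutes[OF lt(2,3)], of K2 a] abc by (simp add: Transposition.transpose_def)
    moreover have "?t * (K b * K c) = K b * K c * ?t" by (rule P_KK[OF lt(2,3) abc(5)])
    ultimately show ?thesis by (metis mult.assoc)
  qed
  have sW: "?s * ?W = ?W"
  proof -
    have "(1 - ?s) * (?A * ?B) = 0"
      using antisym_MM_node[OF eta abc(1,2,4), of n N] n by simp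
    then have "?s * (?A * ?B) = ?A * ?B" by (rule fixed_by)
    then show ?thesis by (metis mult.assoc)
  qed
  have tW: "?t * (?W * ?e) = ?W * ?e"
  proof -
    have "?t * ?A = ?A * ?t"
    proof -
      have R: "?t * R a m u = R a m u * ?t" if "0 < m" "m \<le> N" for m u
        using P_commute[of b M c a m] lt abc that aux_site[OF abc(2) that] aux_site[OF abc(3) that]
        by (simp add: R_def distrib_left distrib_right sc_comm[of ?t] sc_left_comm[of ?t] mult.assoc)
      have "?t * MM a k l = MM a k l * ?t" if "k \<le> N" for k l
        using that
      proof (induction k)
        case (Suc k)
        have "?t * MM a (Suc k) l = R a (Suc k) (l - \<xi> (Suc k)) * (?t * MM a k l)"
          using R[of "Suc k"] Suc.prems by (simp flip: mult.assoc)
        then show ?case using Suc by (simp add: mult.assoc)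
      qed simp
      then show ?thesis by simp
    qed
    then have "?t * (?W * ?e) = ?A * (?t * (?B * ?C * ?e))" by (metis mult.assoc)
    then show ?thesis using sym_MM[OF eta abc(2,3,5), of "\<xi> n + \<eta>"] by (simp add: mult.assoc)
  qed
  define Y where "Y = ?KKK * ?W"
  have tYe: "?t * (Y * ?e) = Y * ?e"
  proof -
    have "?t * (Y * ?e) = (?t * ?KKK) * (?W * ?e)" unfolding Y_def by (simp only: mult.assoc)
    also have "\<dots> = ?KKK * (?t * (?W * ?e))" unfolding tK by (simp only: mult.assoc)
    also have "\<dots> = Y * ?e" unfolding tW Y_def by (simp only: mult.assoc)
    finally show ?thesis .
  qed
  have sY: "?s * Y = Y"
  proof -
    have "?s * Y = (?s * ?KKK) * ?W" unfolding Y_def by (simp only: mult.assoc)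
    also have "\<dots> = ?KKK * (?s * ?W)" unfolding sK by (simp only: mult.assoc)
    finally show ?thesis unfolding sW Y_def .
  qed
  \<comment> \<open>Cyclicity moves \<open>Pt M a b\<close> to the front, where it is absorbed
    because the antisymmetrizer vanishes at \<open>\<xi> n\<close>.\<close>
  have X1: "tr (Y * ?e * ?s) = tr (Y * ?e)"
  proof -
    have "tr (Y * ?e * ?s) = tr (?s * Y * ?e)" using trs[of "Y * ?e"] by (simp add: mult.assoc)
    then show ?thesis by (simp only: sY)
  qed
  have X2: "tr (Y * ?e * ?s * ?t) = tr (Y * ?e)"
  proof -
    have "tr (Y * ?e * ?s * ?t) = tr (?t * (Y * ?e) * ?s)" using trt[of "Y * ?e * ?s"] by (simp add: mult.assoc)
    then show ?thesis by (simp only: tYe X1)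
  qed
  \<comment> \<open>The sum over all six permutations, factored by coset representatives of the
    subgroup generated by \<open>Pt M b c\<close>; each representative contributes the same
    supertrace.\<close>
  define Q where "Q = ?e * (1 + ?s + ?s * ?t)"
  have "Y * Q = Y * ?e + Y * ?e * ?s + Y * ?e * ?s * ?t"
    unfolding Q_def by (simp add: distrib_left distrib_right mult.assoc add_ac)
  then have "tr (Y * Q) = tr (Y * ?e) + tr (Y * ?e * ?s) + tr (Y * ?e * ?s * ?t)"
    by (simp only: add)
  moreover have "sc 3 = 1 + 1 + 1"
    using sc_add[of 2 1] sc_add[of 1 1] by simp
  ultimately have sum3: "tr (Y * Q) = sc 3 * tr (Y * ?e)"
    unfolding X1 X2 by (simp only: distrib_right mult_1_left)
  interpret p: s3 ?s "Pt M a c" ?t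
    by (rule s3_P[OF lt abc(4,5,6)])
  have Qs: "?s * Q = Q" "?t * Q = Q" "Pt M a c * Q = Q"
  proof -
    have x: "app ?t (app (Pt M a c) (app ?t w)) = app ?s w" "app (Pt M a c) (app ?t (app (Pt M a c) w)) = app ?s w" for w
      using p.apps by metis+
    show "?s * Q = Q" "?t * Q = Q" "Pt M a c * Q = Q"
      by (rule lop_eqI, simp add: Q_def app_lin p.apps x algebra_simps)+
  qed
  have Qeq: "Q = 1 + ?s + ?s * ?t + ?t + ?t * ?s + ?t * ?s * ?t"
    by (simp add: Q_def algebra_simps)
  have "tr (Y * Q) = tr (Q * Y)"
  proof -
    have st: "tr (Y * (?s * ?t)) = tr (?s * ?t * Y)"
      by (metis trs trt mult.assoc)
    have ts: "tr (Y * (?t * ?s)) = tr (?t * ?s * Y)"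
      by (metis trs trt mult.assoc)
    have tst: "tr (Y * (?t * ?s * ?t)) = tr (?t * ?s * ?t * Y)"
      using trt[of "Y * (?t * ?s)"] trs[of "?t * (Y * ?t)"] trt[of "?s * (?t * Y)"]
      by (simp only: mult.assoc)
    show ?thesis unfolding Qeq distrib_left distrib_right add
      using st ts tst trs[of Y] trt[of Y] by simp
  qed
  \<comment> \<open>The symmetrizer commutes with the product of the three twists, so it can stand
    on either side of it.\<close>
  also have "Q * Y = 0"
  proof -
    define cm where "cm g \<longleftrightarrow> g * ?KKK = ?KKK * g" for g
    have cm: "cm 1" "cm ?s" "cm ?t" "\<And>g h. cm g \<Longrightarrow> cm h \<Longrightarrow> cm (g + h)" "\<And>g h. cm g \<Longrightarrow> cm h \<Longrightarrow> cm (g * h)"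
      unfolding cm_def using sK tK
      by (simp, simp, simp, simp only: distrib_left distrib_right, metis mult.assoc)
    have QK: "Q * ?KKK = ?KKK * Q"
      unfolding cm_def[symmetric] Q_def by (intro cm)
    have "?KKK * Q = 0"
      using KKK_antisymmetric[OF lt abc(4,5,6) Qs, of K2] by (simp add: mult.assoc)
    then show ?thesis unfolding Y_def by (metis QK mult.assoc mult_zero_left)
  qed
  finally have "tr (Y * Q) = 0" by (simp add: tr_def pstr_0)
  then have "tr (Y * ?e) = 0"
    using sum3 sc_eq_0[of 3] by simp
  moreover have "tr (Y * ?e) = sc (dpoly N \<xi> (\<xi> n + \<eta> + \<eta>)) * (T a (\<xi> n) * T2 b c (\<xi> n + \<eta>))"
  proof -
    let ?X = "K a * ?A" and ?Z = "K b * K c * (?B * ?C * ?e)"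
    have fX: "free b ?X" "free c ?X"
      using abc by (auto intro!: free_mult free_K free_MM)
    have fZ: "free a ?Z"
      using abc lt by (auto intro!: free_mult free_K free_MM free_add free_P)
    have "T a (\<xi> n) * pstr b (pstr c ?Z) = pstr a (pstr b (pstr c (?X * ?Z)))"
    proof -
      have 1: "free a (pstr b (pstr c ?Z))" by (intro free_pstr fZ abc(4,6))
      show ?thesis
        by (simp only: T_def pstr_free_right[OF 1] pstr_free_left[OF fX(1)] pstr_free_left[OF fX(2)])
    qed
    moreover have "?X * ?Z = Y * ?e"
    proof -
      have "?A * (K b * K c) = K b * K c * ?A"
        using MM_K_comm[OF abc(1,2,4) order_refl] MM_K_comm[OF abc(1,3,6) order_refl] by (metis mult.assoc)
      then show ?thesis unfolding Y_def by (metis mult.assoc)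
    qed
    ultimately show ?thesis
      unfolding tr_def T2_MM[OF abc(2,3,5), symmetric] by (simp add: sc_left_comm[of "T a (\<xi> n)"])
  qed
  ultimately show ?thesis using nz sc_eq_0 by metis
qed

end

subsection \<open>Reduction of polynomials in solutions of the cubic system\<close>

definition tX :: "nat \<Rightarrow> (nat \<Rightarrow> complex) \<Rightarrow> complex \<Rightarrow> complex \<Rightarrow> (nat \<Rightarrow> lop) \<Rightarrow> complex \<Rightarrow> lop" where
  "tX N \<xi> k2 k3 X l = sc (- (k2 + k3) * dpoly N \<xi> l) + (\<Sum>a\<in>{1..N}. sc (lag N \<xi> a l) * X a)"

text \<open>Solutions in the ring of operators; scalar solutions \<open>x\<close> are included as \<open>sc \<circ> x\<close>.\<close>
definition sol :: "nat \<Rightarrow> complex \<Rightarrow> (nat \<Rightarrow> complex) \<Rightarrow> complex \<Rightarrow> complex \<Rightarrow> (nat \<Rightarrow> lop) \<Rightarrow> bool" where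
  "sol N \<eta> \<xi> k2 k3 X \<longleftrightarrow> (\<forall>a\<in>{1..N}. \<forall>b\<in>{1..N}. X a * X b = X b * X a) \<and>
     (\<forall>a\<in>{1..N}. X a * (sc (k2 * k3 * dpoly N \<xi> (\<xi> a + \<eta>)) +
        (\<Sum>r\<in>{1..N}. sc (fcoef N \<eta> \<xi> 2 r (\<xi> a + \<eta>)) * (tX N \<xi> k2 k3 X (\<xi> r + \<eta>) * X r))) = 0)"

inductive_set alg :: "nat \<Rightarrow> (nat \<Rightarrow> lop) \<Rightarrow> lop set" for N X where
  alg_sc: "sc z \<in> alg N X"
| alg_X: "a \<in> {1..N} \<Longrightarrow> X a \<in> alg N X"
| alg_add: "Y \<in> alg N X \<Longrightarrow> Z \<in> alg N X \<Longrightarrow> Y + Z \<in> alg N X"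
| alg_mult: "Y \<in> alg N X \<Longrightarrow> Z \<in> alg N X \<Longrightarrow> Y * Z \<in> alg N X"

lemma alg_0: "0 \<in> alg N X" and alg_1: "1 \<in> alg N X"
  using alg_sc[of 0 N X] alg_sc[of 1 N X] by simp_all

lemma alg_sum: "(\<And>i. i \<in> A \<Longrightarrow> F i \<in> alg N X) \<Longrightarrow> (\<Sum>i\<in>A. F i) \<in> alg N X"
  by (induction A rule: infinite_finite_induct) (auto intro: alg_0 alg_add)

lemma alg_power: "Y \<in> alg N X \<Longrightarrow> Y ^ m \<in> alg N X"
  by (induction m) (auto intro: alg_1 alg_mult)

lemma alg_comm:
  assumes c: "\<And>a b. a \<in> {1..N} \<Longrightarrow> b \<in> {1..N} \<Longrightarrow> X a * X b = X b * X a"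
    and Y: "Y \<in> alg N X" and Z: "Z \<in> alg N X"
  shows "Y * Z = Z * Y"
  using Y
proof induction
  case a: (alg_X a)
  show ?case using Z
  proof induction
    case (alg_X b)
    show ?case using c a alg_X by blast
  next
    case (alg_mult Y Z)
    then show ?case by (metis mult.assoc)
  qed (simp_all only: sc_comm distrib_left distrib_right)
next
  case (alg_mult Y Y')
  then show ?case by (metis mult.assoc)
qed (auto simp: sc_comm distrib_left distrib_right)

lemma cfgsH_upd: "h \<in> cfgsH N \<Longrightarrow> n \<in> {1..N} \<Longrightarrow> i < 3 \<Longrightarrow> h(n := i) \<in> cfgsH N"
  by (auto simp: cfgsH_def)

lemma finite_cfgsH: "finite (cfgsH N)"
proof (rule finite_subset)
  show "cfgsH N \<subseteq> {f. \<forall>x. (x \<in> {1..N} \<longrightarrow> f x \<in> {..<3}) \<and> (x \<notin> {1..N} \<longrightarrow> f x = 0)}"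
    by (auto simp: cfgsH_def) (metis One_nat_def Suc_leI not_gr0)
qed (intro finite_set_of_finite_funs; simp)

text \<open>With \<open>inj\<close>, the condition \<open>sep\<close> keeps the nodes distinct
  whenever one of \<open>\<xi> n\<close> and \<open>\<xi> n + \<eta>\<close> is chosen for each n;
  it also makes every \<open>dpoly N \<xi> (\<xi> n + \<eta>)\<close> invertible.\<close>

locale sov =
  fixes N :: nat and \<eta> :: complex and \<xi> :: "nat \<Rightarrow> complex" and k2 k3 :: complex
  assumes N: "0 < N" and inj: "inj_on \<xi> {1..N}"
    and sep: "\<And>a b. a \<in> {1..N} \<Longrightarrow> b \<in> {1..N} \<Longrightarrow> \<xi> a + \<eta> \<noteq> \<xi> b"
begin

abbreviation "t \<equiv> tX N \<xi> k2 k3"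
abbreviation "sl \<equiv> sol N \<eta> \<xi> k2 k3"
abbreviation "d \<equiv> dpoly N \<xi>"
abbreviation "C \<equiv> cfgsH N"

lemma d_nz: "a \<in> {1..N} \<Longrightarrow> d (\<xi> a + \<eta>) \<noteq> 0"
  using sep by (auto simp: dpoly_def)

lemma d_node: "a \<in> {1..N} \<Longrightarrow> d (\<xi> a) = 0"
  by (auto simp: dpoly_def)

lemma fcoef_2: "fcoef N \<eta> \<xi> 2 r l = lag N \<xi> r l * (1 / d (\<xi> r + \<eta>))"
proof -
  have "{Suc 0..<2} = {1}" by auto
  then have "(\<Prod>b\<in>{1..N}. \<Prod>s\<in>{1..<2}. 1 / (\<xi> r - \<xi> b + of_nat s * \<eta>)) = (\<Prod>b\<in>{1..N}. 1 / (\<xi> r + \<eta> - \<xi> b))"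
    by (simp add: algebra_simps)
  then show ?thesis by (simp add: fcoef_def lag_def dpoly_def prod_dividef)
qed

definition Y :: "(nat \<Rightarrow> lop) \<Rightarrow> nat \<Rightarrow> lop" where
  "Y X n = sc (1 / d (\<xi> n + \<eta>)) * (t X (\<xi> n + \<eta>) * X n)"

text \<open>Abstract counterpart of half of \<open>T2\<close>: leading coefficient
  \<open>k2 * k3\<close> and values \<open>Y X r\<close> at the nodes. The cubic system says that
  \<open>X a\<close> annihilates its value at \<open>\<xi> a + \<eta>\<close>.\<close>

definition ta :: "(nat \<Rightarrow> lop) \<Rightarrow> complex \<Rightarrow> lop" where
  "ta X l = sc (k2 * k3 * d l) + (\<Sum>r\<in>{1..N}. sc (lag N \<xi> r l) * Y X r)"

lemma sol_comm: "sl X \<Longrightarrow> V \<in> alg N X \<Longrightarrow> W \<in> alg N X \<Longrightarrow> V * W = W * V"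
  by (rule alg_comm) (auto simp: sol_def)

lemma t_alg: "t X l \<in> alg N X"
  unfolding tX_def by (intro alg_add alg_sum alg_mult alg_sc alg_X) auto
lemma Y_alg: "n \<in> {1..N} \<Longrightarrow> Y X n \<in> alg N X"
  unfolding Y_def by (intro alg_mult alg_sc t_alg alg_X)
lemma ta_alg: "ta X l \<in> alg N X"
  unfolding ta_def by (intro alg_add alg_sum alg_mult alg_sc Y_alg) auto

lemma sol_ta: assumes "sl X" "a \<in> {1..N}" shows "X a * ta X (\<xi> a + \<eta>) = 0"
proof -
  have "ta X l = sc (k2 * k3 * d l) + (\<Sum>r\<in>{1..N}. sc (fcoef N \<eta> \<xi> 2 r l) * (t X (\<xi> r + \<eta>) * X r))" for l
    unfolding ta_def by (simp only: fcoef_2 Y_def sc_mult mult.assoc)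
  then show ?thesis using assms unfolding sol_def by metis
qed

lemma t_node: assumes "a \<in> {1..N}" shows "t X (\<xi> a) = X a"
proof -
  have "(\<Sum>b\<in>{1..N}. sc (lag N \<xi> b (\<xi> a)) * X b) = (\<Sum>b\<in>{1..N}. if b = a then X a else 0)"
    using assms by (intro sum.cong) (auto simp: lag_node[OF inj])
  then show ?thesis using assms by (simp add: tX_def d_node)
qed

lemma ta_node: assumes "a \<in> {1..N}" shows "ta X (\<xi> a) = Y X a"
proof -
  have "(\<Sum>b\<in>{1..N}. sc (lag N \<xi> b (\<xi> a)) * Y X b) = (\<Sum>b\<in>{1..N}. if b = a then Y X a else 0)"
    using assms by (intro sum.cong) (auto simp: lag_node[OF inj])
  then show ?thesis using assms by (simp add: ta_def d_node)
qed

text \<open>Both \<open>d\<close> and the Lagrange polynomials for \<xi> can be re-expanded at the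
  nodes \<open>z\<close>, with the same leading coefficient. This transfers \<open>t\<close> and
  \<open>ta\<close> to nodes where their action on a given product is known.\<close>

lemma ring_interpolate:
  assumes z: "inj_on z {1..N}"
    and F: "\<And>l. F l = sc (\<kappa> * d l) + (\<Sum>a\<in>{1..N}. sc (lag N \<xi> a l) * Z a)"
  shows "F l = sc (\<kappa> * dpoly N z l) + (\<Sum>n\<in>{1..N}. sc (lag N z n l) * F (z n))"
proof -
  have 1: "(\<Sum>n\<in>{1..N}. sc (lag N z n l) * F (z n)) =
      (\<Sum>n\<in>{1..N}. sc (lag N z n l * (\<kappa> * d (z n)))) + (\<Sum>n\<in>{1..N}. \<Sum>a\<in>{1..N}. sc (lag N \<xi> a (z n) * lag N z n l) * Z a)"
    by (simp add: F distrib_left sum.distrib sum_distrib_left sc_sc mult.commute[of "lag N z n l" for n] flip: sc_mult)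
  have 2: "(\<Sum>n\<in>{1..N}. \<Sum>a\<in>{1..N}. sc (lag N \<xi> a (z n) * lag N z n l) * Z a) = (\<Sum>a\<in>{1..N}. sc (lag N \<xi> a l) * Z a)"
    by (subst sum.swap, intro sum.cong refl) (subst lagrange_lag[OF z N], auto simp: sc_sum sum_distrib_right)
  have "\<kappa> * d l = \<kappa> * dpoly N z l + (\<Sum>n\<in>{1..N}. lag N z n l * (\<kappa> * d (z n)))"
    by (subst lagrange_dpoly[OF z N]) (simp add: algebra_simps sum_distrib_left)
  then show ?thesis
    unfolding 1 2 F[of l] by (simp add: sc_add sc_sum add.assoc)
qed

section \<open>Products of one factor per site and their multiplication by t\<close>

definition g :: "(nat \<Rightarrow> lop) \<Rightarrow> nat \<Rightarrow> nat \<Rightarrow> lop" where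
  "g X n i = (if i = 0 then 1 else if i = 1 then X n else Y X n)"

fun u :: "(nat \<Rightarrow> lop) \<Rightarrow> cfg \<Rightarrow> nat \<Rightarrow> lop" where
  "u X h 0 = 1"
| "u X h (Suc k) = u X h k * g X (Suc k) (h (Suc k))"

abbreviation "U X h \<equiv> u X h N"

lemma g_alg: "n \<in> {1..N} \<Longrightarrow> g X n i \<in> alg N X"
  by (auto simp: g_def intro: alg_1 alg_X Y_alg)

lemma u_alg: "k \<le> N \<Longrightarrow> u X h k \<in> alg N X"
  by (induction k) (auto intro!: alg_1 alg_mult g_alg)

lemma u_upd_beyond: "k < n \<Longrightarrow> u X (h(n := i)) k = u X h k"
  by (induction k) auto

lemma u_upd:
  assumes "sl X" "n \<in> {1..N}" "n \<le> k" "k \<le> N" "h n = 0"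
  shows "g X n i * u X h k = u X (h(n := i)) k"
  using assms(3,4)
proof (induction k)
  case (Suc k)
  show ?case
  proof (cases "n = Suc k")
    case True
    then have "u X (h(n := i)) (Suc k) = u X h k * g X n i" by (simp add: u_upd_beyond)
    also have "\<dots> = g X n i * u X h k"
      using Suc.prems assms(2) by (intro sol_comm[OF assms(1)] u_alg g_alg) auto
    also have "u X h k = u X h (Suc k)" using True assms(5) by (simp add: g_def)
    finally show ?thesis by (rule sym)
  next
    case False
    then show ?thesis using Suc by (simp flip: mult.assoc)
  qed
qed (use assms(2) in auto)

lemma U_upd: "sl X \<Longrightarrow> n \<in> {1..N} \<Longrightarrow> h n = 0 \<Longrightarrow> g X n i * U X h = U X (h(n := i))"
  by (rule u_upd) auto

lemma U_factor: "sl X \<Longrightarrow> n \<in> {1..N} \<Longrightarrow> U X h = g X n (h n) * U X (h(n := 0))"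
  using U_upd[of X n "h(n := 0)" "h n"] by simp

text \<open>The coefficients \<open>L\<close> are the same for all solutions \<open>X\<close>.\<close>
definition spn :: "((nat \<Rightarrow> lop) \<Rightarrow> lop) \<Rightarrow> bool" where
  "spn F \<longleftrightarrow> (\<exists>L. \<forall>X. sl X \<longrightarrow> F X = (\<Sum>h\<in>C. sc (L h) * U X h))"

lemma spn_cong: "(\<And>X. sl X \<Longrightarrow> F X = G X) \<Longrightarrow> spn G \<Longrightarrow> spn F"
  by (auto simp: spn_def)

lemma spn_0: "spn (\<lambda>X. 0)"
  unfolding spn_def by (rule exI[of _ "\<lambda>_. 0"]) simp

lemma spn_add: assumes "spn F" "spn G" shows "spn (\<lambda>X. F X + G X)"
proof -
  obtain L L' where "\<And>X. sl X \<Longrightarrow> F X = (\<Sum>h\<in>C. sc (L h) * U X h)" "\<And>X. sl X \<Longrightarrow> G X = (\<Sum>h\<in>C. sc (L' h) * U X h)"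
    using assms by (auto simp: spn_def)
  then show ?thesis unfolding spn_def
    by (intro exI[of _ "\<lambda>h. L h + L' h"]) (simp add: sc_add distrib_right sum.distrib)
qed

lemma spn_sc: assumes "spn F" shows "spn (\<lambda>X. sc z * F X)"
proof -
  obtain L where "\<And>X. sl X \<Longrightarrow> F X = (\<Sum>h\<in>C. sc (L h) * U X h)"
    using assms by (auto simp: spn_def)
  then show ?thesis unfolding spn_def
    by (intro exI[of _ "\<lambda>h. z * L h"]) (simp add: sc_mult sum_distrib_left mult.assoc)
qed

lemma spn_sum: "finite A \<Longrightarrow> (\<And>i. i \<in> A \<Longrightarrow> spn (F i)) \<Longrightarrow> spn (\<lambda>X. \<Sum>i\<in>A. F i X)"
  by (induction A rule: finite_induct) (auto intro: spn_0 spn_add)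

lemma spn_U: "h \<in> C \<Longrightarrow> spn (\<lambda>X. U X h)"
  unfolding spn_def
proof (intro exI[of _ "\<lambda>k. if k = h then 1 else 0"] allI impI)
  fix X assume "h \<in> C"
  have "(\<Sum>k\<in>C. sc (if k = h then 1 else 0) * U X k) = (\<Sum>k\<in>C. if k = h then U X h else 0)"
    by (intro sum.cong) auto
  then show "U X h = (\<Sum>k\<in>C. sc (if k = h then 1 else 0) * U X k)"
    using \<open>h \<in> C\<close> finite_cfgsH by simp
qed

text \<open>Interpolating at \<open>\<xi>\<^sub>n\<close> where \<open>h n = 0\<close> and at \<open>\<xi>\<^sub>n + \<eta>\<close> elsewhere, the nodes of the
  second kind do not contribute because \<open>ta\<close> is killed there by both \<open>X n\<close> and \<open>Y X n\<close>.\<close>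
lemma spn_ta_U: assumes h: "h \<in> C" shows "spn (\<lambda>X. ta X l * U X h)"
proof -
  define z where "z n = (if h n = 0 then \<xi> n else \<xi> n + \<eta>)" for n
  have z: "inj_on z {1..N}"
  proof (rule inj_onI)
    fix a b assume "a \<in> {1..N}" "b \<in> {1..N}" "z a = z b"
    then show "a = b"
      using sep[of a b] sep[of b a] inj_onD[OF inj, of a b] by (auto simp: z_def split: if_splits)
  qed
  define G where "G n X = (if h n = 0 then U X (h(n := 2)) else 0)" for n X
  have G: "ta X (z n) * U X h = G n X" if X: "sl X" and n: "n \<in> {1..N}" for X n
  proof (cases "h n = 0")
    case True
    then show ?thesis using U_upd[where h = h, OF X n True, of 2] n by (simp add: z_def G_def ta_node g_def)
  next
    case False
    have 1: "ta X (\<xi> n + \<eta>) * X n = 0"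
      using sol_ta[OF X n] sol_comm[OF X ta_alg[of X "\<xi> n + \<eta>"] alg_X[OF n]] by simp
    moreover have "ta X (\<xi> n + \<eta>) * Y X n = 0"
    proof -
      have "Y X n = X n * (sc (1 / d (\<xi> n + \<eta>)) * t X (\<xi> n + \<eta>))"
        unfolding Y_def using sol_comm[OF X alg_X[OF n], of "sc (1 / d (\<xi> n + \<eta>)) * t X (\<xi> n + \<eta>)"]
        by (simp add: alg_mult alg_sc t_alg mult.assoc)
      then show ?thesis using 1 by (metis mult.assoc mult_zero_left)
    qed
    ultimately have "ta X (\<xi> n + \<eta>) * g X n (h n) = 0" using False by (simp add: g_def)
    then show ?thesis
      using False by (subst U_factor[OF X n]) (simp add: z_def G_def flip: mult.assoc)
  qed
  show ?thesis
  proof (rule spn_cong)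
    fix X assume X: "sl X"
    have "ta X l = sc (k2 * k3 * dpoly N z l) + (\<Sum>n\<in>{1..N}. sc (lag N z n l) * ta X (z n))"
      by (rule ring_interpolate[OF z]) (simp add: ta_def)
    moreover have "(\<Sum>n\<in>{1..N}. sc (lag N z n l) * (ta X (z n) * U X h)) = (\<Sum>n\<in>{1..N}. sc (lag N z n l) * G n X)"
      by (rule sum.cong[OF refl]) (simp only: G[OF X])
    ultimately show "ta X l * U X h = sc (k2 * k3 * dpoly N z l) * U X h + (\<Sum>n\<in>{1..N}. sc (lag N z n l) * G n X)"
      by (simp only: distrib_right sum_distrib_right mult.assoc)
  next
    have "spn (G n)" if "n \<in> {1..N}" for n
      using that h by (cases "h n = 0") (auto simp: G_def[abs_def] spn_0 intro!: spn_U cfgsH_upd)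
    then show "spn (\<lambda>X. sc (k2 * k3 * dpoly N z l) * U X h + (\<Sum>n\<in>{1..N}. sc (lag N z n l) * G n X))"
      by (intro spn_add spn_sc spn_U h spn_sum) auto
  qed
qed

text \<open>The node at site n is chosen by \<open>h n\<close>. For 0, the value at
  \<open>\<xi> n\<close> supplies a factor \<open>X n\<close>; for 1, the value at
  \<open>\<xi> n + \<eta>\<close> turns \<open>X n\<close> into a multiple of \<open>Y X n\<close>;
  for 2, the value at \<open>\<xi> n\<close> gives \<open>X n * Y X n\<close>, which is read as
  \<open>ta X (\<xi> n)\<close> acting on a product with \<open>X n\<close> and is reduced by
  \<open>spn_ta_U\<close>.\<close>

lemma spn_t_U: assumes h: "h \<in> C" shows "spn (\<lambda>X. t X l * U X h)"
proof -
  define z where "z n = (if h n = 1 then \<xi> n + \<eta> else \<xi> n)" for n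
  have z: "inj_on z {1..N}"
  proof (rule inj_onI)
    fix a b assume "a \<in> {1..N}" "b \<in> {1..N}" "z a = z b"
    then show "a = b"
      using sep[of a b] sep[of b a] inj_onD[OF inj, of a b] by (auto simp: z_def split: if_splits)
  qed
  have node: "spn (\<lambda>X. t X (z n) * U X h)" if n: "n \<in> {1..N}" for n
  proof -
    have "h n < 3" using h by (auto simp: cfgsH_def)
    then consider "h n = 0" | "h n = 1" | "h n = 2" by linarith
    then show ?thesis
    proof cases
      case 1
      have "t X (z n) * U X h = U X (h(n := 1))" if "sl X" for X
        using U_upd[where h = h, OF that n 1, of 1] 1 n by (simp add: z_def t_node g_def)
      then show ?thesis by (rule spn_cong) (assumption, intro spn_U cfgsH_upd h n, simp)
    next
      case 2
      have "t X (z n) * U X h = sc (d (\<xi> n + \<eta>)) * U X (h(n := 2))" if X: "sl X" for X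
      proof -
        have "t X (z n) * U X h = t X (\<xi> n + \<eta>) * X n * U X (h(n := 0))"
          using 2 by (subst U_factor[OF X n]) (simp add: z_def g_def mult.assoc)
        also have "t X (\<xi> n + \<eta>) * X n = sc (d (\<xi> n + \<eta>)) * Y X n"
          using d_nz[OF n] by (simp add: Y_def flip: mult.assoc sc_mult)
        also have "\<dots> * U X (h(n := 0)) = sc (d (\<xi> n + \<eta>)) * U X (h(n := 2))"
          using U_upd[OF X n, of "h(n := 0)" 2] by (simp add: g_def mult.assoc)
        finally show ?thesis .
      qed
      then show ?thesis by (rule spn_cong) (assumption, intro spn_sc spn_U cfgsH_upd h n, simp)
    next
      case 3
      have "t X (z n) * U X h = ta X (\<xi> n) * U X (h(n := 1))" if X: "sl X" for X
      proof -
        have "t X (z n) * U X h = (X n * Y X n) * U X (h(n := 0))"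
          using 3 n by (subst U_factor[OF X n]) (simp add: z_def g_def mult.assoc t_node)
        also have "X n * Y X n = Y X n * X n"
          by (rule sol_comm[OF X alg_X[OF n] Y_alg[OF n]])
        also have "Y X n * X n * U X (h(n := 0)) = ta X (\<xi> n) * U X (h(n := 1))"
          using U_upd[OF X n, of "h(n := 0)" 1] n by (simp add: g_def mult.assoc ta_node)
        finally show ?thesis .
      qed
      then show ?thesis by (rule spn_cong) (assumption, intro spn_ta_U cfgsH_upd h n, simp)
    qed
  qed
  show ?thesis
  proof (rule spn_cong)
    fix X assume X: "sl X"
    have "t X l = sc (- (k2 + k3) * dpoly N z l) + (\<Sum>n\<in>{1..N}. sc (lag N z n l) * t X (z n))"
      by (rule ring_interpolate[OF z]) (simp add: tX_def)
    then show "t X l * U X h = sc (- (k2 + k3) * dpoly N z l) * U X h + (\<Sum>n\<in>{1..N}. sc (lag N z n l) * (t X (z n) * U X h))"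
      by (simp add: distrib_right sum_distrib_right mult.assoc)
  next
    show "spn (\<lambda>X. sc (- (k2 + k3) * dpoly N z l) * U X h + (\<Sum>n\<in>{1..N}. sc (lag N z n l) * (t X (z n) * U X h)))"
      by (intro spn_add spn_sc spn_U h spn_sum node) auto
  qed
qed

lemma spn_t: assumes "spn F" shows "spn (\<lambda>X. t X l * F X)"
proof -
  obtain L where L: "\<And>X. sl X \<Longrightarrow> F X = (\<Sum>h\<in>C. sc (L h) * U X h)"
    using assms by (auto simp: spn_def)
  show ?thesis
  proof (rule spn_cong)
    fix X assume "sl X"
    then show "t X l * F X = (\<Sum>h\<in>C. sc (L h) * (t X l * U X h))"
      by (simp add: L sum_distrib_left sc_left_comm[of "t X l"])
  next
    show "spn (\<lambda>X. \<Sum>h\<in>C. sc (L h) * (t X l * U X h))"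
      by (intro spn_sum finite_cfgsH spn_sc spn_t_U)
  qed
qed

lemma spn_X: assumes "a \<in> {1..N}" "spn F" shows "spn (\<lambda>X. X a * F X)"
  using spn_t[OF assms(2), of "\<xi> a"] assms(1) by (simp add: t_node)

lemma U_0: "U X (\<lambda>_. 0) = 1"
proof -
  have "u X (\<lambda>_. 0) k = 1" for k by (induction k) (auto simp: g_def)
  then show ?thesis .
qed

lemma spn_1: "spn (\<lambda>X. 1)"
  using spn_U[of "\<lambda>_. 0"] by (simp add: U_0 cfgsH_def)

lemma spn_X_power: assumes "a \<in> {1..N}" "spn F" shows "spn (\<lambda>X. X a ^ m * F X)"
  by (induction m) (use assms in \<open>auto simp: mult.assoc intro: spn_X\<close>)

fun w :: "(nat \<Rightarrow> lop) \<Rightarrow> cfg \<Rightarrow> nat \<Rightarrow> lop" where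
  "w X h 0 = 1"
| "w X h (Suc k) = w X h k * X (Suc k) ^ h (Suc k)"

lemma w_alg: "k \<le> N \<Longrightarrow> w X h k \<in> alg N X"
  by (induction k) (auto intro!: alg_1 alg_mult alg_power alg_X)

lemma spn_w: "k \<le> N \<Longrightarrow> spn (\<lambda>X. w X h k)"
proof (induction k)
  case (Suc k)
  show ?case
  proof (rule spn_cong)
    fix X assume X: "sl X"
    show "w X h (Suc k) = X (Suc k) ^ h (Suc k) * w X h k"
      using Suc.prems by (simp, intro sol_comm[OF X] w_alg alg_power alg_X) auto
  qed (use Suc in \<open>intro spn_X_power; simp\<close>)
qed (simp add: spn_1)

text \<open>The induction on \<open>Z\<close> multiplies an arbitrary spanned expression instead of
  1, so that the case of a product is a composition of the two induction hypotheses.\<close>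

lemma alg_span:
  assumes X: "sl X" and Z: "Z \<in> alg N X"
  shows "\<exists>L. Z = (\<Sum>h\<in>C. sc (L h) * U X h)"
proof -
  have "spn F \<Longrightarrow> \<exists>G. spn G \<and> G X = Z * F X" for F
    using Z
  proof (induction arbitrary: F)
    case (alg_sc z) then show ?case by (intro exI[of _ "\<lambda>X. sc z * F X"]) (simp add: spn_sc)
  next
    case (alg_X a) then show ?case by (intro exI[of _ "\<lambda>X. X a * F X"]) (simp add: spn_X)
  next
    case (alg_add Y Z)
    then obtain G H where "spn G" "G X = Y * F X" "spn H" "H X = Z * F X" by blast
    then show ?case by (intro exI[of _ "\<lambda>X. G X + H X"]) (simp add: spn_add distrib_right)
  next
    case (alg_mult Y Z)
    then obtain H where H: "spn H" "H X = Z * F X" by blast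
    then obtain G where "spn G" "G X = Y * H X" using alg_mult.IH(1) by blast
    then show ?case using H by (auto simp: mult.assoc)
  qed
  from this[OF spn_1] show ?thesis using X by (auto simp: spn_def)
qed

end

subsection \<open>The cubic system for the transfer matrix\<close>

lemma vac_comm: "a \<noteq> b \<Longrightarrow> vac a * vac b = vac b * vac a"
  using ins_ins[of a b 0 0] by (simp add: vac_def ks_def)

lemma pstr_vac: "vac p * pstr p X = pstr p X" "pstr p X * vac p = pstr p X"
proof -
  have "vac p * (sc z * (ext p i * Y)) = sc z * (ext p i * Y)" for z i Y
    by (simp add: sc_left_comm[of "vac p"] vac_ext flip: mult.assoc)
       (simp add: vac_ext sc_left_comm[of "vac p"] mult.assoc)
  then show "vac p * pstr p X = pstr p X" by (simp add: pstr_def sum_distrib_left)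
  show "pstr p X * vac p = pstr p X" by (simp add: pstr_def sum_distrib_right mult.assoc ins_vac)
qed

section \<open>Leading coefficients of the transfer matrices\<close>

lemma pstr_K: "pstr p (Kop K2 p) = sc (- (K2 1 1 + K2 2 2)) * vac p"
proof -
  have "pstr p (Kop K2 p) = (\<Sum>i<3. sc (sg i * Khat K2 i i) * vac p)"
    unfolding pstr_def by (intro sum.cong refl) (simp add: ext_K_ins sc_mult mult.assoc)
  also have "\<dots> = sc (\<Sum>i<3. sg i * Khat K2 i i) * vac p"
    by (simp add: sc_sum sum_distrib_right)
  finally show ?thesis
    by (simp add: lessThan_nat_numeral lessThan_Suc Khat_def sg_def algebra_simps)
qed

lemma pstr_K_K: assumes "a \<noteq> b"
  shows "pstr a (pstr b (Kop K2 a * Kop K2 b)) = sc ((K2 1 1 + K2 2 2)\<^sup>2) * (vac a * vac b)"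
proof -
  have "pstr a (pstr b (Kop K2 a * Kop K2 b)) = pstr a (Kop K2 a) * pstr b (Kop K2 b)"
    using assms by (intro pstr_mult[symmetric] free_K) auto
  also have "\<dots> = sc ((K2 1 1 + K2 2 2)\<^sup>2) * (vac a * vac b)"
    by (simp add: pstr_K sc_sc sc_left_comm[of "vac a"] mult.assoc) (simp add: power2_eq_square algebra_simps)
  finally show ?thesis .
qed

text \<open>The transposition merges the two supertraces into the single supertrace of the squared
  twist, which is minus the trace of the square of \<open>K2\<close> because only odd states
  occur.\<close>

lemma pstr_K_K_P: assumes ab: "a < M" "b < M" "a \<noteq> b"
  shows "pstr a (pstr b (Kop K2 a * Kop K2 b * Pt M a b)) =
    sc (- ((K2 1 1)\<^sup>2 + 2 * (K2 1 2 * K2 2 1) + (K2 2 2)\<^sup>2)) * (vac a * vac b)"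
proof -
  let ?Ka = "Kop K2 a" and ?Kb = "Kop K2 b"
  \<comment> \<open>The sign of moving the extraction at \<open>b\<close> past the insertion of the
    same state at \<open>a\<close>.\<close>
  define s :: "nat \<Rightarrow> complex" where "s j = (if j = 0 then 1 else - 1)" for j
  have entry: "ext a i * (ext b j * (?Ka * ?Kb * Pt M a b * (ins b j * ins a i))) =
      sc (s j * (Khat K2 i j * Khat K2 j i)) * (vac a * vac b)" if "i < 3" "j < 3" for i j
  proof -
    have "ext a i * (ext b j * (?Ka * ?Kb * Pt M a b * (ins b j * ins a i))) =
        ext a i * (ext b j * (?Ka * (?Kb * (ins a j * ins b i))))"
      by (simp add: P_ins_ins[OF ab] mult.assoc)
    also have "\<dots> = ext a i * ((ext b j * ?Ka) * ((?Kb * ins a j) * ins b i))"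
      by (simp only: mult.assoc)
    also have "\<dots> = ext a i * ((?Ka * ext b j) * ((ins a j * ?Kb) * ins b i))"
      using K_ext[OF ab(3), of K2 j] K_ins[OF ab(3)[symmetric], of K2 j] by simp
    also have "\<dots> = ext a i * (?Ka * ((ext b j * ins a j) * (?Kb * ins b i)))"
      by (simp only: mult.assoc)
    also have "ext b j * ins a j = sc (s j) * (ins a j * ext b j)"
      using ext_ins[OF ab(3)[symmetric], of j j] by (simp add: ks_def s_def)
    also have "ext a i * (?Ka * (sc (s j) * (ins a j * ext b j) * (?Kb * ins b i))) =
        sc (s j) * ((ext a i * (?Ka * ins a j)) * (ext b j * (?Kb * ins b i)))"
      by (simp only: sc_left_comm[of ?Ka] sc_left_comm[of "ext a i"] mult.assoc)
    also have "\<dots> = sc (s j * (Khat K2 i j * Khat K2 j i)) * (vac a * vac b)"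
      using that by (simp add: ext_K_ins sc_mult sc_left_comm[of "vac a"] mult.assoc)
    finally show ?thesis .
  qed
  have "pstr a (pstr b (?Ka * ?Kb * Pt M a b)) =
    (\<Sum>i<3. \<Sum>j<3. sc (sg i) * (sc (sg j) * (ext a i * (ext b j * (?Ka * ?Kb * Pt M a b * (ins b j * ins a i))))))"
    by (simp add: pstr_def sum_distrib_left sum_distrib_right sc_left_comm[of "ext a i" for i] mult.assoc)
  also have "\<dots> = (\<Sum>i<3. \<Sum>j<3. sc (sg i * (sg j * (s j * (Khat K2 i j * Khat K2 j i)))) * (vac a * vac b))"
    by (intro sum.cong refl) (simp only: entry lessThan_iff sc_sc)
  also have "\<dots> = sc (\<Sum>i<3. \<Sum>j<3. sg i * (sg j * (s j * (Khat K2 i j * Khat K2 j i)))) * (vac a * vac b)"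
    by (simp add: sc_sum sum_distrib_right)
  also have "(\<Sum>i<3. \<Sum>j<3. sg i * (sg j * (s j * (Khat K2 i j * Khat K2 j i)))) =
      - ((K2 1 1)\<^sup>2 + 2 * (K2 1 2 * K2 2 1) + (K2 2 2)\<^sup>2)"
    by (simp add: lessThan_nat_numeral lessThan_Suc Khat_def sg_def s_def power2_eq_square algebra_simps)
  finally show ?thesis .
qed

context chain
begin

lemma lpoly_MM: "lpoly k (MM a k) 1"
proof (induction k)
  case 0
  show ?case unfolding lpoly_def by (rule exI[of _ "\<lambda>_. 1"]) simp
next
  case (Suc k)
  show ?case using lpoly_step[OF Suc, of "\<xi> (Suc k)" "sc \<eta> * Pt M a (Suc k)"] by (simp add: R_def)
qed

lemma lpoly_LL: "lpoly k (LL a b k) 1"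
proof (induction k)
  case 0
  show ?case unfolding lpoly_def by (rule exI[of _ "\<lambda>_. 1"]) simp
next
  case (Suc k)
  show ?case using lpoly_step[OF Suc, of "\<xi> (Suc k)" "sc \<eta> * (Pt M a (Suc k) + Pt M b (Suc k))"] by simp
qed

lemma lpoly_T: "lpoly N (T a) (sc (- (K2 1 1 + K2 2 2)) * vac a)"
  using lpoly_pstr[OF lpoly_left[OF lpoly_MM[of N a], of "K a"], of a]
  unfolding T_def pstr_K[symmetric] by simp

text \<open>The two halves of the symmetrizer contribute the squared trace of \<open>K2\<close> and
  minus the trace of its square; the difference is twice the determinant.\<close>

lemma lpoly_T2:
  assumes "aux b" "aux c" "b \<noteq> c"
  shows "lpoly N (T2 b c) (sc (2 * (K2 1 1 * K2 2 2 - K2 1 2 * K2 2 1)) * (vac b * vac c))"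
proof -
  note lt = aux_lt[OF assms(1)] aux_lt[OF assms(2)]
  have "pstr b (pstr c (K b * K c * (1 * (1 + Pt M b c)))) =
    pstr b (pstr c (K b * K c)) + pstr b (pstr c (K b * K c * Pt M b c))"
    by (simp add: distrib_left pstr_add)
  also have "\<dots> = sc ((K2 1 1 + K2 2 2)\<^sup>2 + - ((K2 1 1)\<^sup>2 + 2 * (K2 1 2 * K2 2 1) + (K2 2 2)\<^sup>2)) * (vac b * vac c)"
    unfolding pstr_K_K[OF assms(3)] pstr_K_K_P[OF lt assms(3)] by (simp only: sc_add distrib_right)
  also have "(K2 1 1 + K2 2 2)\<^sup>2 + - ((K2 1 1)\<^sup>2 + 2 * (K2 1 2 * K2 2 1) + (K2 2 2)\<^sup>2) =
      2 * (K2 1 1 * K2 2 2 - K2 1 2 * K2 2 1)"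
    by (simp add: power2_eq_square algebra_simps)
  finally show ?thesis
    using lpoly_pstr[OF lpoly_pstr[OF lpoly_left[OF lpoly_right[OF lpoly_LL[of N b c], of "1 + Pt M b c"], of "K b * K c"], of c], of b]
    unfolding T2_def by simp
qed

lemma free_T: "aux a \<Longrightarrow> aux b \<Longrightarrow> a \<noteq> b \<Longrightarrow> free b (T a l)"
  unfolding T_def by (intro free_pstr free_mult free_K free_MM) auto

lemma P_T:
  assumes ab: "aux a" "aux b" "a \<noteq> b"
  shows "Pt M a b * T a l = T b l * Pt M a b"
proof -
  note lt = aux_lt[OF ab(1)] aux_lt[OF ab(2)]
  have MMP: "Pt M a b * MM a k l = MM b k l * Pt M a b" if "k \<le> N" for k
    using that
  proof (induction k)
    case (Suc k)
    have "Pt M a b * Pt M a (Suc k) = Pt M b (Suc k) * Pt M a b"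
      using s3_site[OF ab, of "Suc k"] Suc.prems by (simp add: s3_def)
    then have "Pt M a b * R a (Suc k) v = R b (Suc k) v * Pt M a b" for v
      by (simp add: R_def distrib_left distrib_right sc_comm[of "Pt M a b"] sc_left_comm[of "Pt M a b"] mult.assoc)
    then have "Pt M a b * MM a (Suc k) l = R b (Suc k) (l - \<xi> (Suc k)) * (Pt M a b * MM a k l)"
      by (simp flip: mult.assoc)
    then show ?case using Suc by (simp add: mult.assoc)
  qed simp
  have PK: "Pt M a b * K a = K b * Pt M a b"
    using Pop_K[OF sw_permutes[OF lt], of K2 a] by simp
  have PJ: "Pt M a b * ext a i = ext b i * Pt M a b" and PI: "Pt M a b * ins a i = ins b i * Pt M a b" for i
    using Pop_ext[OF sw_permutes[OF lt] lt(1), of i] Pop_ins[OF sw_permutes[OF lt] lt(1), of i] by simp_all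
  have "Pt M a b * (ext a i * (K a * MM a N l * ins a i)) = ext b i * (K b * MM b N l * ins b i) * Pt M a b" for i
    using MMP[OF order_refl] PK PJ PI by (metis mult.assoc)
  then show ?thesis
    by (simp add: T_def pstr_def sum_distrib_left sum_distrib_right sc_left_comm[of "Pt M a b"] mult.assoc)
qed

lemma T_vac_swap:
  assumes ab: "aux a" "aux b" "a \<noteq> b"
  shows "T a l * vac b = T b l * vac a"
proof -
  note lt = aux_lt[OF ab(1)] aux_lt[OF ab(2)]
  have ca: "T a l * vac b = vac b * T a l" by (rule free_vac[OF free_T[OF ab]])
  have cb: "T b l * vac a = vac a * T b l" by (rule free_vac[OF free_T[OF ab(2,1) ab(3)[symmetric]]])
  have va: "vac a * T a l = T a l" "T a l * vac a = T a l" "vac b * T b l = T b l" "T b l * vac b = T b l"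
    unfolding T_def by (simp_all add: pstr_vac)
  have "T b l * vac a = T b l * (vac a * vac b)"
    by (metis va cb vac_comm mult.assoc)
  also have "\<dots> = T b l * (Pt M a b * (vac a * vac b))" by (simp add: P_vac)
  also have "\<dots> = Pt M a b * (T a l * (vac a * vac b))"
    using P_T[OF ab, of l] by (metis mult.assoc)
  also have "\<dots> = Pt M a b * (vac a * vac b) * T a l"
    by (metis va ca vac_comm mult.assoc)
  also have "\<dots> = T a l * vac b"
    unfolding P_vac by (metis va ca mult.assoc)
  finally show ?thesis by simp
qed

text \<open>Transfer matrices on different auxiliary sites differ by their projections
  \<open>vac a\<close> only. Next to the projection onto the even state at all three sites they
  become one operator \<open>Tt\<close>, so relations between different sites turn into relations in
  one commuting family.\<close>

definition Vac :: lop where "Vac = vac 0 * (vac (N + 1) * vac (N + 2))"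
definition Tt :: "complex \<Rightarrow> lop" where "Tt l = T 0 l * Vac"

lemma vac_Vac: assumes "aux a" shows "vac a * Vac = Vac"
proof -
  let ?a = "vac 0" and ?b = "vac (N + 1)" and ?c = "vac (N + 2)"
  have c: "?b * ?a = ?a * ?b" "?c * ?a = ?a * ?c" "?c * ?b = ?b * ?c"
    by (intro vac_comm; simp)+
  have "?a * Vac = Vac" by (simp add: Vac_def vac_vac flip: mult.assoc)
  moreover have "?b * Vac = Vac" by (metis Vac_def c(1) vac_vac mult.assoc)
  moreover have "?c * Vac = Vac" by (metis Vac_def c vac_vac mult.assoc)
  ultimately show ?thesis using assms by (auto simp: aux_def)
qed

lemma Vac_Vac: "Vac * Vac = Vac"
  using vac_Vac[of 0] vac_Vac[of "N + 1"] vac_Vac[of "N + 2"]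
  by (subst Vac_def) (simp add: aux_def mult.assoc)

lemma T_Vac_comm: assumes "aux a" shows "T a l * Vac = Vac * T a l"
proof -
  have "T a l * vac b = vac b * T a l" if "aux b" for b
  proof (cases "a = b")
    case True then show ?thesis unfolding T_def by (simp add: pstr_vac)
  next
    case False then show ?thesis by (rule free_vac[OF free_T[OF assms that]])
  qed
  then have "T a l * vac 0 = vac 0 * T a l" "T a l * vac (N + 1) = vac (N + 1) * T a l" "T a l * vac (N + 2) = vac (N + 2) * T a l"
    by (simp_all add: aux_def)
  then show ?thesis unfolding Vac_def by (metis mult.assoc)
qed

lemma T_Vac: assumes "aux a" shows "T a l * Vac = Tt l"
proof (cases "a = 0")
  case False
  have a0: "aux 0" by (simp add: aux_def)
  have "T a l * Vac = T a l * vac 0 * Vac" by (simp add: vac_Vac[OF a0] mult.assoc)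
  also have "\<dots> = T 0 l * (vac a * Vac)"
    unfolding T_vac_swap[OF assms a0 False] by (simp only: mult.assoc)
  finally show ?thesis by (simp add: vac_Vac[OF assms] Tt_def)
qed (simp add: Tt_def)

lemma Tt_mult: assumes "aux a" "aux b" shows "Tt l * Tt m = T a l * T b m * Vac"
proof -
  have "Tt l * Tt m = T a l * (Vac * T b m) * Vac"
    by (simp only: mult.assoc T_Vac[OF assms(2)]) (simp only: T_Vac[OF assms(1)] flip: mult.assoc)
  also have "\<dots> = T a l * (T b m * Vac) * Vac"
    by (simp only: T_Vac_comm[OF assms(2)])
  also have "\<dots> = T a l * T b m * (Vac * Vac)" by (simp only: mult.assoc)
  finally show ?thesis by (simp add: Vac_Vac)
qed

lemma Tt_Vac: "Tt l * Vac = Tt l" "Vac * Tt l = Tt l"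
proof -
  show 1: "Tt l * Vac = Tt l" by (simp add: Tt_def Vac_Vac mult.assoc)
  have "Vac * Tt l = T 0 l * Vac * Vac"
    unfolding Tt_def using T_Vac_comm[of 0 l] by (metis aux_def mult.assoc)
  then show "Vac * Tt l = Tt l" by (simp add: Tt_def Vac_Vac mult.assoc)
qed

lemma Tt_commute: assumes "(l - m)\<^sup>2 \<noteq> \<eta>\<^sup>2" shows "Tt l * Tt m = Tt m * Tt l"
proof -
  have a: "aux 0" "aux (N + 1)" "0 \<noteq> N + 1" by (auto simp: aux_def)
  show ?thesis
    unfolding Tt_mult[OF a(1,2), of l m] Tt_mult[OF a(2,1), of m l] T_commute[OF a assms] ..
qed

lemma Tt_interpolate:
  assumes "inj_on \<xi> {1..N}" "0 < N"
  shows "Tt l = sc (- (K2 1 1 + K2 2 2) * dpoly N \<xi> l) * Vac + (\<Sum>a\<in>{1..N}. sc (lag N \<xi> a l) * Tt (\<xi> a))"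
proof -
  have "Tt l = sc (dpoly N \<xi> l) * (sc (- (K2 1 1 + K2 2 2)) * vac 0) * Vac + (\<Sum>a\<in>{1..N}. sc (lag N \<xi> a l) * T 0 (\<xi> a) * Vac)"
    unfolding Tt_def by (subst lpoly_interpolate[OF lpoly_T assms, of 0 l]) (simp add: distrib_right sum_distrib_right)
  also have "sc (dpoly N \<xi> l) * (sc (- (K2 1 1 + K2 2 2)) * vac 0) * Vac = sc (- (K2 1 1 + K2 2 2) * dpoly N \<xi> l) * Vac"
    by (simp only: mult.assoc vac_Vac[of 0, unfolded aux_def, simplified] sc_sc mult.commute)
  finally show ?thesis by (simp add: Tt_def mult.assoc)
qed

end

locale twisted_chain = chain N \<eta> \<xi> K2 + sov N \<eta> \<xi> k2 k3
  for N \<eta> \<xi> K2 k2 k3 +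
  assumes eta: "\<eta> \<noteq> 0" and nr: "nonres N \<eta> \<xi>"
    and trK: "K2 1 1 + K2 2 2 = k2 + k3" and detK: "K2 1 1 * K2 2 2 - K2 1 2 * K2 2 1 = k2 * k3"
begin

definition X :: "nat \<Rightarrow> lop" where "X a = Tt (\<xi> a)"

lemma X_comm: assumes "a \<in> {1..N}" "b \<in> {1..N}" shows "X a * X b = X b * X a"
proof (cases "a = b")
  case False
  have "\<xi> a - \<xi> b \<noteq> of_int 1 * \<eta>" "\<xi> a - \<xi> b \<noteq> of_int (-1) * \<eta>"
    using nr False assms unfolding nonres_def by blast+
  then have "(\<xi> a - \<xi> b)\<^sup>2 \<noteq> \<eta>\<^sup>2" by (auto simp: power2_eq_iff)
  then show ?thesis unfolding X_def by (rule Tt_commute)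
qed simp

text \<open>The leading term of \<open>t X\<close> is a multiple of the identity, that of
  \<open>Tt\<close> a multiple of \<open>Vac\<close>; the two agree only next to
  \<open>Vac\<close>.\<close>

lemma t_Vac: "t X l * Vac = Tt l" "Vac * t X l = Tt l"
proof -
  show 1: "t X l * Vac = Tt l"
    unfolding tX_def distrib_right sum_distrib_right mult.assoc X_def Tt_Vac
    using Tt_interpolate[OF inj N, of l] unfolding trK by (rule sym)
  have "Vac * t X l = t X l * Vac"
    unfolding tX_def X_def
    by (simp add: distrib_right distrib_left sum_distrib_right sum_distrib_left sc_comm[of Vac] sc_left_comm[of Vac] Tt_Vac mult.assoc)
  then show "Vac * t X l = Tt l" using 1 by simp
qed

lemma app_t:
  assumes "b \<in> cfgsH N" shows "app (t X l) v b = app (T 0 l) v b"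
proof -
  have Vac: "app (Vac * Z) v b = app Z v b" for Z
    using assms by (simp add: Vac_def app_ring app_vac cfgsH_def)
  have "app (t X l) v b = app (Tt l) v b"
    using Vac[of "t X l"] by (simp add: t_Vac)
  also have "Tt l = Vac * T 0 l"
    unfolding Tt_def by (rule T_Vac_comm) (simp add: aux_def)
  finally show ?thesis by (simp add: Vac)
qed

lemma dpoly_nonzero_2: assumes n: "n \<in> {1..N}" shows "dpoly N \<xi> (\<xi> n + \<eta> + \<eta>) \<noteq> 0"
proof -
  have "\<xi> n + \<eta> + \<eta> \<noteq> \<xi> b" if b: "b \<in> {1..N}" for b
  proof (cases "n = b")
    case False
    then have "\<xi> n - \<xi> b \<noteq> of_int (-2) * \<eta>" using nr n b unfolding nonres_def by blast
    then show ?thesis by (auto simp: algebra_simps)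
  qed (use eta in auto)
  then show ?thesis by (auto simp: dpoly_def)
qed

lemma sol_X: "sl X"
proof -
  let ?a = "0" and ?b = "N + 1" and ?c = "N + 2"
  have abc: "aux ?a" "aux ?b" "aux ?c" "?a \<noteq> ?b" "?b \<noteq> ?c" "?a \<noteq> ?c" by (auto simp: aux_def)
  have "X n * (sc (k2 * k3 * d (\<xi> n + \<eta>)) +
      (\<Sum>r\<in>{1..N}. sc (fcoef N \<eta> \<xi> 2 r (\<xi> n + \<eta>)) * (t X (\<xi> r + \<eta>) * X r))) = 0" if n: "n \<in> {1..N}" for n
  proof -
    let ?l = "\<xi> n + \<eta>"
    define G where "G r = T2 ?b ?c (\<xi> r)" for r
    have G: "G r * Vac = sc (2 / d (\<xi> r + \<eta>)) * (t X (\<xi> r + \<eta>) * X r)" if r: "r \<in> {1..N}" for r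
    proof -
      have "sc (d (\<xi> r + \<eta>)) * (G r * Vac) = sc 2 * (T ?b (\<xi> r) * T ?c (\<xi> r + \<eta>)) * Vac"
        unfolding G_def fusion_node[OF eta abc(2,3,5) r] by (simp only: mult.assoc)
      also have "\<dots> = sc 2 * (X r * Tt (\<xi> r + \<eta>))"
        unfolding X_def Tt_mult[OF abc(2,3)] by (simp only: mult.assoc)
      also have "X r * Tt (\<xi> r + \<eta>) = t X (\<xi> r + \<eta>) * X r"
      proof -
        have "t X (\<xi> r + \<eta>) * X r = X r * t X (\<xi> r + \<eta>)"
          using alg_comm[OF X_comm t_alg alg_X[OF r]] .
        also have "X r * t X (\<xi> r + \<eta>) = X r * (Vac * t X (\<xi> r + \<eta>))"
          by (simp add: X_def Tt_Vac flip: mult.assoc)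
        finally show ?thesis by (simp add: t_Vac)
      qed
      finally have "sc (d (\<xi> r + \<eta>)) * (G r * Vac) = sc 2 * (t X (\<xi> r + \<eta>) * X r)" .
      also have "\<dots> = sc (d (\<xi> r + \<eta>)) * (sc (2 / d (\<xi> r + \<eta>)) * (t X (\<xi> r + \<eta>) * X r))"
        using d_nz[OF r] by (simp add: sc_sc)
      finally show ?thesis using sc_cancel[OF d_nz[OF r]] by blast
    qed
    have "T2 ?b ?c ?l = sc (d ?l) * (sc (2 * (K2 1 1 * K2 2 2 - K2 1 2 * K2 2 1)) * (vac ?b * vac ?c))
        + (\<Sum>r\<in>{1..N}. sc (lag N \<xi> r ?l) * G r)"
      unfolding G_def by (rule lpoly_interpolate[OF lpoly_T2[OF abc(2,3,5)] inj N])
    then have "T2 ?b ?c ?l * Vac = sc (d ?l) * (sc (2 * (k2 * k3)) * (vac ?b * (vac ?c * Vac)))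
        + (\<Sum>r\<in>{1..N}. sc (lag N \<xi> r ?l) * (G r * Vac))"
      by (simp only: detK distrib_right sum_distrib_right mult.assoc)
    also have "\<dots> = sc (d ?l) * (sc (2 * (k2 * k3)) * Vac)
        + (\<Sum>r\<in>{1..N}. sc (lag N \<xi> r ?l) * (sc (2 / d (\<xi> r + \<eta>)) * (t X (\<xi> r + \<eta>) * X r)))"
      by (simp only: vac_Vac[OF abc(2)] vac_Vac[OF abc(3)] G cong: sum.cong)
    also have "\<dots> = sc 2 * (sc (k2 * k3 * d ?l) * Vac + (\<Sum>r\<in>{1..N}. sc (fcoef N \<eta> \<xi> 2 r ?l) * (t X (\<xi> r + \<eta>) * X r)))"
      by (simp add: distrib_left sum_distrib_left sc_sc fcoef_2 mult.commute mult.left_commute)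
    finally have T2Vac: "T2 ?b ?c ?l * Vac = sc 2 * (sc (k2 * k3 * d ?l) * Vac + (\<Sum>r\<in>{1..N}. sc (fcoef N \<eta> \<xi> 2 r ?l) * (t X (\<xi> r + \<eta>) * X r)))" .
    \<comment> \<open>\<open>X n\<close> is written with the first auxiliary site while
      \<open>T2\<close> uses the other two, as \<open>cubic_node\<close> requires.\<close>
    have "X n * (T2 ?b ?c ?l * Vac) = 0"
    proof -
      have "X n = Vac * T ?a (\<xi> n)"
        unfolding X_def T_Vac_comm[OF abc(1), symmetric] T_Vac[OF abc(1)] ..
      then show ?thesis
        using cubic_node[OF eta abc n dpoly_nonzero_2[OF n]] by (metis mult.assoc mult_zero_left mult_zero_right)
    qed
    then have "sc 2 * (X n * (sc (k2 * k3 * d ?l) * Vac + (\<Sum>r\<in>{1..N}. sc (fcoef N \<eta> \<xi> 2 r ?l) * (t X (\<xi> r + \<eta>) * X r)))) = 0"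
      unfolding T2Vac by (simp only: sc_left_comm[of "X n"])
    then have "X n * (sc (k2 * k3 * d ?l) * Vac + (\<Sum>r\<in>{1..N}. sc (fcoef N \<eta> \<xi> 2 r ?l) * (t X (\<xi> r + \<eta>) * X r))) = 0"
      using sc_eq_0[of 2] by simp
    \<comment> \<open>\<open>X n\<close> absorbs \<open>Vac\<close>, which makes the leading term a
      scalar as demanded by \<open>sol\<close>.\<close>
    moreover have "X n * (sc z * Vac) = X n * sc z" for z
      by (simp only: sc_comm[of "X n"] sc_left_comm[of "X n"]) (simp add: X_def Tt_Vac)
    ultimately show ?thesis by (simp only: distrib_left)
  qed
  then show ?thesis using X_comm by (auto simp: sol_def)
qed

end

subsection \<open>Matrix elements of the transfer matrix\<close>

lemma finite_cfgs0: "finite (cfgs0 N)"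
proof (rule finite_subset)
  show "cfgs0 N \<subseteq> {f. \<forall>x. (x \<in> {..N} \<longrightarrow> f x \<in> {..<3}) \<and> (x \<notin> {..N} \<longrightarrow> f x = 0)}"
    by (auto simp: cfgs0_def)
qed (intro finite_set_of_finite_funs; simp)

lemma cfgs0_upd: "c \<in> cfgs0 N \<Longrightarrow> n \<le> N \<Longrightarrow> i < 3 \<Longrightarrow> c(n := i) \<in> cfgs0 N"
  by (auto simp: cfgs0_def)

lemma cfgs0_sw: "c \<in> cfgs0 N \<Longrightarrow> a \<le> N \<Longrightarrow> b \<le> N \<Longrightarrow> c \<circ> sw a b \<in> cfgs0 N"
  by (auto simp: cfgs0_def Transposition.transpose_def)

lemma sg_par: "(- 1) ^ par x = sg x"
  by (simp add: par_def sg_def)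

lemma jw_par: "(- 1) ^ (\<Sum>m<n. par (c m)) = jw n c"
  by (simp add: power_sum sg_par jw_def)

text \<open>Links the inversion sign in \<open>Pop\<close> with the Koszul signs of
  \<open>site_op\<close>. The string is that of the permuted configuration because the matrix
  computes its sign from the input, while \<open>gs\<close> is evaluated at the output.\<close>

lemma gs_sw_0:
  assumes n: "0 < n" "n < M"
  shows "gs M (sw 0 n) c = sg (c n) * jw n (c \<circ> sw 0 n) ^ (par (c n) + par (c 0))"
proof -
  \<comment> \<open>The sign of the states strictly between the sites 0 and \<open>n\<close>; every
    string below is \<open>mid\<close> up to the sign of one exchanged state.\<close>
  define mid where "mid = jw n (c(0 := 0))"
  have mid2: "mid * mid = 1" by (simp add: mid_def)
  have jn: "jw n c = sg (c 0) * mid"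
    using n by (simp add: mid_def jw_upd sg_def)
  have jn': "jw n (c \<circ> sw 0 n) = sg (c n) * mid"
  proof -
    have "jw n (c \<circ> sw 0 n) = jw n (c(0 := c n))"
      unfolding jw_def by (intro prod.cong) (auto simp: Transposition.transpose_def)
    then show ?thesis using n by (simp add: mid_def jw_upd sg_def)
  qed
  have jn'': "jw n (c(n := 0) \<circ> sw 0 n) = mid"
  proof -
    have "jw n (c(n := 0) \<circ> sw 0 n) = jw n (c(0 := 0))"
      unfolding jw_def using n by (intro prod.cong) (auto simp: Transposition.transpose_def)
    then show ?thesis by (simp add: mid_def)
  qed
  have j0: "jw 0 x = 1" for x by (simp add: jw_def)
  have sw: "sw 0 n permutes {..<M}" using n by (intro sw_permutes) auto
  show ?thesis
  proof (cases "c n = 0")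
    case True
    show ?thesis
    proof (cases "c 0 = 0")
      case True
      then show ?thesis using \<open>c n = 0\<close> by (simp add: gs_sw_vac sg_def par_def)
    next
      case False
      then have "gs M (sw 0 n) c * jw n (c \<circ> sw 0 n) = gs M (sw 0 n) (c(0 := 0))"
        using gs_peel[where c = c, OF sw n(2)] by (simp add: j0)
      moreover have "gs M (sw 0 n) (c(0 := 0)) = 1" by (rule gs_sw_vac) (use True in auto)
      ultimately have "gs M (sw 0 n) c * mid * mid = mid" using True by (simp add: jn' sg_def)
      then show ?thesis using True False by (simp add: mult.assoc mid2 jn' sg_def par_def)
    qed
  next
    case False
    then have 1: "gs M (sw 0 n) c = jw n c * gs M (sw 0 n) (c(n := 0))"
      using gs_peel[where c = c, OF sw, of 0] n by (simp add: j0)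
    show ?thesis
    proof (cases "c 0 = 0")
      case True
      then have "gs M (sw 0 n) (c(n := 0)) = 1" by (intro gs_sw_vac) auto
      then show ?thesis using 1 False True by (simp add: jn jn' sg_def par_def)
    next
      case c0: False
      then have "gs M (sw 0 n) (c(n := 0)) * jw n (c(n := 0) \<circ> sw 0 n) = gs M (sw 0 n) (c(n := 0, 0 := 0))"
        using gs_peel[where c = "c(n := 0)", OF sw n(2)] n by (simp add: j0)
      moreover have "gs M (sw 0 n) (c(n := 0, 0 := 0)) = 1" by (rule gs_sw_vac) auto
      ultimately have "gs M (sw 0 n) (c(n := 0)) * mid * mid = mid" by (simp add: jn'')
      then have "gs M (sw 0 n) (c(n := 0)) = mid" by (simp add: mult.assoc mid2)
      then show ?thesis using 1 False c0 mid2
        by (simp add: jn jn' sg_def par_def)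
    qed
  qed
qed

lemma gperm_eq:
  assumes c: "c \<in> cfgs0 N" and n: "0 < n" "n \<le> N"
  shows "gperm N n c' c = (if c' = c \<circ> sw 0 n
    then sg (c 0) * jw n c ^ (par (c 0) + par (c n)) else 0)"
proof -
  have c3: "c m < 3" for m using c by (auto simp: cfgs0_def)
  have upd: "c(n := c 0, 0 := c n) = c \<circ> sw 0 n"
    using n by (auto simp: fun_eq_iff Transposition.transpose_def)
  have mm: "mmul (cfgs0 N) (site_op 0 \<alpha> \<beta>) (site_op n \<beta> \<alpha>) c' c =
      (if \<alpha> = c n \<and> \<beta> = c 0 \<and> c' = c \<circ> sw 0 n then jw n c ^ (par (c 0) + par (c n)) else 0)"
    if "\<beta> < 3" for \<alpha> \<beta>
  proof -
    have "mmul (cfgs0 N) (site_op 0 \<alpha> \<beta>) (site_op n \<beta> \<alpha>) c' c =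
        (\<Sum>b\<in>cfgs0 N. if b = c(n := \<beta>) then site_op 0 \<alpha> \<beta> c' (c(n := \<beta>)) * site_op n \<beta> \<alpha> (c(n := \<beta>)) c else 0)"
      unfolding mmul_def by (intro sum.cong) (auto simp: site_op_def)
    also have "\<dots> = site_op 0 \<alpha> \<beta> c' (c(n := \<beta>)) * site_op n \<beta> \<alpha> (c(n := \<beta>)) c"
      using cfgs0_upd[OF c n(2) that] finite_cfgs0 by simp
    also have "\<dots> = (if \<alpha> = c n \<and> \<beta> = c 0 \<and> c' = c \<circ> sw 0 n then jw n c ^ (par (c 0) + par (c n)) else 0)"
      using n upd by (auto simp: site_op_def power_mult mult.commute[of "par (c 0) + par (c n)"] simp flip: jw_par)
    finally show ?thesis .
  qed
  have "gperm N n c' c = (\<Sum>\<alpha><3. \<Sum>\<beta><3. if \<alpha> = c n \<and> \<beta> = c 0 then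
      (if c' = c \<circ> sw 0 n then sg (c 0) * jw n c ^ (par (c 0) + par (c n)) else 0) else 0)"
    unfolding gperm_def by (intro sum.cong refl) (auto simp: mm sg_par)
  also have "\<dots> = (\<Sum>\<alpha><3. if \<alpha> = c n then \<Sum>\<beta><3. (if \<beta> = c 0 then
      (if c' = c \<circ> sw 0 n then sg (c 0) * jw n c ^ (par (c 0) + par (c n)) else 0) else 0) else 0)"
    by (intro sum.cong) auto
  finally show ?thesis using c3 by (simp add: sum.delta)
qed

text \<open>The bridge between finite matrices and operators on functions of all configurations: on
  \<open>cfgs0 N\<close> the image depends only on the values of \<open>v\<close> there, for every
  \<open>v\<close>.\<close>

definition rep :: "nat \<Rightarrow> (cfg \<Rightarrow> cfg \<Rightarrow> complex) \<Rightarrow> lop \<Rightarrow> bool" where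
  "rep N A Z \<longleftrightarrow> (\<forall>v. \<forall>c\<in>cfgs0 N. app Z v c = (\<Sum>a\<in>cfgs0 N. A c a * v a))"

lemma rep_mult: assumes "rep N A Z" "rep N B W" shows "rep N (mmul (cfgs0 N) A B) (Z * W)"
  unfolding rep_def
proof (intro allI ballI)
  fix v c assume c: "c \<in> cfgs0 N"
  have "app (Z * W) v c = (\<Sum>b\<in>cfgs0 N. A c b * (\<Sum>a\<in>cfgs0 N. B b a * v a))"
    using assms c by (simp add: rep_def app_ring)
  also have "\<dots> = (\<Sum>a\<in>cfgs0 N. \<Sum>b\<in>cfgs0 N. A c b * (B b a * v a))"
    by (subst sum.swap) (simp add: sum_distrib_left)
  finally show "app (Z * W) v c = (\<Sum>a\<in>cfgs0 N. mmul (cfgs0 N) A B c a * v a)"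
    by (simp add: mmul_def sum_distrib_right mult.assoc)
qed

lemma rep_idm: "rep N idm 1"
  unfolding rep_def
proof (intro allI ballI)
  fix v :: "cfg \<Rightarrow> complex" and c assume "c \<in> cfgs0 N"
  moreover have "(\<Sum>a\<in>cfgs0 N. idm c a * v a) = (\<Sum>a\<in>cfgs0 N. if a = c then v c else 0)"
    by (intro sum.cong) (auto simp: idm_def)
  ultimately show "app 1 v c = (\<Sum>a\<in>cfgs0 N. idm c a * v a)"
    using finite_cfgs0 by (simp add: app_ring)
qed

lemma rep_gperm: assumes n: "0 < n" "n \<le> N" shows "rep N (gperm N n) (Pt (N + 3) 0 n)"
  unfolding rep_def
proof (intro allI ballI)
  fix v :: "cfg \<Rightarrow> complex" and c assume c: "c \<in> cfgs0 N"
  have inv: "c \<circ> sw 0 n \<circ> sw 0 n = c" for c :: cfg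
    by (simp add: comp_assoc Transposition.transpose_comp_involutory)
  have "(\<Sum>a\<in>cfgs0 N. gperm N n c a * v a) =
      (\<Sum>a\<in>cfgs0 N. if a = c \<circ> sw 0 n then gperm N n c (c \<circ> sw 0 n) * v (c \<circ> sw 0 n) else 0)"
    by (intro sum.cong) (auto simp: gperm_eq[OF _ n] inv)
  also have "\<dots> = gperm N n c (c \<circ> sw 0 n) * v (c \<circ> sw 0 n)"
    using finite_cfgs0 cfgs0_sw[OF c] n by simp
  also have "gperm N n c (c \<circ> sw 0 n) = gs (N + 3) (sw 0 n) c"
    using n by (simp add: gperm_eq[OF cfgs0_sw[OF c] n] inv gs_sw_0)
  finally show "app (Pt (N + 3) 0 n) v c = (\<Sum>a\<in>cfgs0 N. gperm N n c a * v a)"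
    by (simp add: Pop.rep_eq comp_def)
qed

lemma rep_Rmat: assumes n: "0 < n" "n \<le> N" shows "rep N (Rmat N \<eta> n \<mu>) (chain.R N \<eta> 0 n \<mu>)"
  unfolding rep_def
proof (intro allI ballI)
  fix v c assume c: "c \<in> cfgs0 N"
  have "(\<Sum>a\<in>cfgs0 N. Rmat N \<eta> n \<mu> c a * v a) =
      \<mu> * (\<Sum>a\<in>cfgs0 N. idm c a * v a) + \<eta> * (\<Sum>a\<in>cfgs0 N. gperm N n c a * v a)"
    by (simp add: Rmat_def distrib_right sum.distrib sum_distrib_left mult.assoc)
  also have "(\<Sum>a\<in>cfgs0 N. idm c a * v a) = v c"
    using rep_idm[of N] c by (simp add: rep_def app_ring)
  also have "(\<Sum>a\<in>cfgs0 N. gperm N n c a * v a) = app (Pt (N + 3) 0 n) v c"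
    using rep_gperm[OF n] c by (simp add: rep_def)
  finally show "app (chain.R N \<eta> 0 n \<mu>) v c = (\<Sum>a\<in>cfgs0 N. Rmat N \<eta> n \<mu> c a * v a)"
    by (simp add: chain.R_def app_ring)
qed

lemma rep_Kaux: "rep N (Kaux (Khat K2)) (Kop K2 0)"
  unfolding rep_def
proof (intro allI ballI)
  fix v :: "cfg \<Rightarrow> complex" and c assume c: "c \<in> cfgs0 N"
  then have c3: "c 0 < 3" by (auto simp: cfgs0_def)
  have "(\<Sum>a\<in>cfgs0 N. Kaux (Khat K2) c a * v a) =
      (\<Sum>i<3. \<Sum>j<3. \<Sum>a\<in>cfgs0 N. Khat K2 i j * site_op 0 i j c a * v a)"
    unfolding Kaux_def sum_distrib_right
    by (subst sum.swap, intro sum.cong refl, subst sum.swap) simp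
  also have "\<dots> = (\<Sum>i<3. \<Sum>j<3. if i = c 0 then Khat K2 (c 0) j * v (c(0 := j)) else 0)"
  proof (intro sum.cong refl)
    fix i j :: nat assume j: "j \<in> {..<3}"
    have "(\<Sum>a\<in>cfgs0 N. Khat K2 i j * site_op 0 i j c a * v a) =
        (\<Sum>a\<in>cfgs0 N. if a = c(0 := j) then (if i = c 0 then Khat K2 i j * v (c(0 := j)) else 0) else 0)"
    proof (rule sum.cong[OF refl])
      fix a
      have "(a 0 = j \<and> c = a(0 := i)) = (a = c(0 := j) \<and> i = c 0)"
        by (metis fun_upd_same fun_upd_triv fun_upd_upd)
      then show "Khat K2 i j * site_op 0 i j c a * v a =
          (if a = c(0 := j) then (if i = c 0 then Khat K2 i j * v (c(0 := j)) else 0) else 0)"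
        by (simp add: site_op_def)
    qed
    then show "(\<Sum>a\<in>cfgs0 N. Khat K2 i j * site_op 0 i j c a * v a) = (if i = c 0 then Khat K2 (c 0) j * v (c(0 := j)) else 0)"
      using cfgs0_upd[OF c, of 0 j] j finite_cfgs0 by simp
  qed
  also have "\<dots> = (\<Sum>i<3. if i = c 0 then \<Sum>j<3. Khat K2 (c 0) j * v (c(0 := j)) else 0)"
    by (intro sum.cong) auto
  finally show "app (Kop K2 0) v c = (\<Sum>a\<in>cfgs0 N. Kaux (Khat K2) c a * v a)"
    using c3 by (simp add: Kop.rep_eq)
qed

lemma rep_monoR: "k \<le> N \<Longrightarrow> rep N (monoR N \<eta> \<xi> k l) (chain.MM N \<eta> \<xi> 0 k l)"
  by (induction k) (auto simp: chain.MM.simps intro!: rep_idm rep_mult rep_Rmat)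

lemma rep_monodromy: "rep N (monodromy N \<eta> \<xi> (Khat K2) l) (Kop K2 0 * chain.MM N \<eta> \<xi> 0 N l)"
  unfolding monodromy_def by (intro rep_mult rep_Kaux rep_monoR order_refl)

text \<open>Evenness of the monodromy makes the sign with exponent
  \<open>par i * (pH N a + pH N b)\<close> in \<open>transfer\<close> equal to 1 on all nonzero
  entries.\<close>

definition even_op :: "nat \<Rightarrow> (cfg \<Rightarrow> cfg \<Rightarrow> complex) \<Rightarrow> bool" where
  "even_op N A \<longleftrightarrow> (\<forall>c\<in>cfgs0 N. \<forall>a\<in>cfgs0 N. A c a \<noteq> 0 \<longrightarrow> even ((\<Sum>m\<le>N. par (c m)) + (\<Sum>m\<le>N. par (a m))))"

lemma even_op_mmul: assumes "even_op N A" "even_op N B" shows "even_op N (mmul (cfgs0 N) A B)"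
  unfolding even_op_def
proof (intro ballI impI)
  fix c a assume ca: "c \<in> cfgs0 N" "a \<in> cfgs0 N" "mmul (cfgs0 N) A B c a \<noteq> 0"
  have "\<exists>b\<in>cfgs0 N. A c b * B b a \<noteq> 0"
  proof (rule ccontr)
    assume "\<not> ?thesis"
    then have "mmul (cfgs0 N) A B c a = 0" unfolding mmul_def by (intro sum.neutral) blast
    then show False using ca(3) by contradiction
  qed
  then obtain b where "b \<in> cfgs0 N" "A c b \<noteq> 0" "B b a \<noteq> 0" by auto
  then have "even ((\<Sum>m\<le>N. par (c m)) + (\<Sum>m\<le>N. par (b m)))" "even ((\<Sum>m\<le>N. par (b m)) + (\<Sum>m\<le>N. par (a m)))"
    using assms ca by (auto simp: even_op_def)
  then show "even ((\<Sum>m\<le>N. par (c m)) + (\<Sum>m\<le>N. par (a m)))" by presburger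
qed

lemma even_op_Rmat: assumes n: "0 < n" "n \<le> N" shows "even_op N (Rmat N \<eta> n \<mu>)"
  unfolding even_op_def
proof (intro ballI impI)
  fix c a assume ca: "c \<in> cfgs0 N" "a \<in> cfgs0 N" "Rmat N \<eta> n \<mu> c a \<noteq> 0"
  then consider "c = a" | "c = a \<circ> sw 0 n"
    by (auto simp: Rmat_def idm_def gperm_eq[OF _ n] split: if_splits)
  then have "(\<Sum>m\<le>N. par (c m)) = (\<Sum>m\<le>N. par (a m))"
  proof cases
    case 2
    have "sw 0 n permutes {..N}" using n by (intro permutes_swap_id) auto
    from sum.permute[OF this, of "\<lambda>m. par (a m)"] show ?thesis by (simp add: 2 comp_def)
  qed simp
  then show "even ((\<Sum>m\<le>N. par (c m)) + (\<Sum>m\<le>N. par (a m)))" by simp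
qed

lemma even_op_Kaux: "even_op N (Kaux (Khat K2))"
  unfolding even_op_def
proof (intro ballI impI)
  fix c a assume "Kaux (Khat K2) c a \<noteq> 0"
  then obtain i j where "Khat K2 i j * site_op 0 i j c a \<noteq> 0"
    unfolding Kaux_def by (meson sum.neutral)
  then have "Khat K2 i j \<noteq> 0" "a 0 = j" "c = a(0 := i)" by (auto simp: site_op_def split: if_splits)
  then have "par (c m) = par (a m)" for m
    using Khat_nz[of K2 i j] by (auto simp: par_def)
  then show "even ((\<Sum>m\<le>N. par (c m)) + (\<Sum>m\<le>N. par (a m)))" by simp
qed

lemma even_op_monodromy: "even_op N (monodromy N \<eta> \<xi> (Khat K2) l)"
proof -
  have "even_op N idm" by (auto simp: even_op_def idm_def)
  then have "k \<le> N \<Longrightarrow> even_op N (monoR N \<eta> \<xi> k l)" for k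
    by (induction k) (auto intro!: even_op_mmul even_op_Rmat)
  then show ?thesis unfolding monodromy_def by (intro even_op_mmul even_op_Kaux) auto
qed

lemma app_T_transfer:
  assumes b: "b \<in> cfgsH N"
  shows "app (chain.T N \<eta> \<xi> K2 0 l) v b = (\<Sum>a\<in>cfgsH N. transfer N \<eta> \<xi> (Khat K2) l b a * v a)"
proof -
  let ?m = "monodromy N \<eta> \<xi> (Khat K2) l" and ?Z = "Kop K2 0 * chain.MM N \<eta> \<xi> 0 N l"
  have b0: "b 0 = 0" using b by (auto simp: cfgsH_def)
  have H0: "a(0 := i) \<in> cfgs0 N" if "a \<in> cfgsH N" "i < 3" for a i
    using that by (auto simp: cfgsH_def cfgs0_def)
  have tp: "(\<Sum>m\<le>N. par ((a(0 := i)) m)) = par i + pH N a" for a i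
  proof -
    have "{..N} = insert 0 {1..N}" by auto
    moreover have "(\<Sum>m\<in>{1..N}. par ((a(0 := i)) m)) = pH N a"
      unfolding pH_def by (intro sum.cong) auto
    ultimately show ?thesis by simp
  qed
  have sgn: "(- 1) ^ (par i * (pH N a + pH N b)) * ?m (b(0 := i)) (a(0 := i)) = ?m (b(0 := i)) (a(0 := i))"
    if "a \<in> cfgsH N" "i < 3" for a i
  proof (cases "?m (b(0 := i)) (a(0 := i)) = 0")
    case False
    then have "even (par i + pH N b + (par i + pH N a))"
      using even_op_monodromy[of N \<eta> \<xi> K2 l] H0[OF that] H0[OF b that(2)]
      unfolding even_op_def tp[symmetric] by blast
    then have "even (par i * (pH N a + pH N b))" by auto
    then show ?thesis by simp
  qed simp
  have term_i: "app (ext 0 i * (?Z * ins 0 i)) v b = (\<Sum>a\<in>cfgsH N. ?m (b(0 := i)) (a(0 := i)) * v a)" if i: "i < 3" for i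
  proof -
    have j0: "jw 0 x = 1" for x by (simp add: jw_def)
    have bij: "bij_betw (\<lambda>a. a(0 := i)) (cfgsH N) {a\<in>cfgs0 N. a 0 = i}"
    proof (rule bij_betw_byWitness[where f' = "\<lambda>a. a(0 := 0)"])
      show "\<forall>a\<in>cfgsH N. a(0 := i, 0 := 0) = a" by (auto simp: cfgsH_def)
    qed (use i in \<open>auto simp: cfgsH_def cfgs0_def\<close>)
    have "app (ext 0 i * (?Z * ins 0 i)) v b = app ?Z (app (ins 0 i) v) (b(0 := i))"
      using b0 by (simp add: app_ring ext.rep_eq j0)
    also have "\<dots> = (\<Sum>a\<in>cfgs0 N. ?m (b(0 := i)) a * app (ins 0 i) v a)"
      using rep_monodromy[of N \<eta> \<xi> K2 l] H0[OF b i] by (simp add: rep_def)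
    also have "\<dots> = (\<Sum>a\<in>cfgs0 N. if a 0 = i then ?m (b(0 := i)) a * v (a(0 := 0)) else 0)"
      by (intro sum.cong) (auto simp: ins.rep_eq j0)
    also have "\<dots> = (\<Sum>a\<in>{a\<in>cfgs0 N. a 0 = i}. ?m (b(0 := i)) a * v (a(0 := 0)))"
      using finite_cfgs0 by (simp add: sum.inter_filter)
    also have "\<dots> = (\<Sum>a\<in>cfgsH N. ?m (b(0 := i)) (a(0 := i)) * v (a(0 := i, 0 := 0)))"
      by (rule sum.reindex_bij_betw[OF bij, symmetric])
    also have "\<dots> = (\<Sum>a\<in>cfgsH N. ?m (b(0 := i)) (a(0 := i)) * v a)"
      by (intro sum.cong) (auto simp: cfgsH_def fun_upd_idem)
    finally show ?thesis .
  qed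
  have "app (chain.T N \<eta> \<xi> K2 0 l) v b = (\<Sum>i<3. sg i * app (ext 0 i * (?Z * ins 0 i)) v b)"
    unfolding chain.T_def pstr_def app_sum_lop by (simp add: times_lop.rep_eq[of "sc _"] sc.rep_eq)
  also have "\<dots> = (\<Sum>i<3. \<Sum>a\<in>cfgsH N. sg i * ((- 1) ^ (par i * (pH N a + pH N b)) * ?m (b(0 := i)) (a(0 := i))) * v a)"
  proof (intro sum.cong refl)
    fix i :: nat assume "i \<in> {..<3}"
    then have i: "i < 3" by simp
    have "sg i * app (ext 0 i * (?Z * ins 0 i)) v b = (\<Sum>a\<in>cfgsH N. sg i * (?m (b(0 := i)) (a(0 := i)) * v a))"
      by (simp only: term_i[OF i] sum_distrib_left)
    also have "\<dots> = (\<Sum>a\<in>cfgsH N. sg i * ((- 1) ^ (par i * (pH N a + pH N b)) * ?m (b(0 := i)) (a(0 := i))) * v a)"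
      by (intro sum.cong refl) (simp only: sgn[OF _ i] mult.assoc)
    finally show "sg i * app (ext 0 i * (?Z * ins 0 i)) v b =
      (\<Sum>a\<in>cfgsH N. sg i * ((- 1) ^ (par i * (pH N a + pH N b)) * ?m (b(0 := i)) (a(0 := i))) * v a)" .
  qed
  also have "\<dots> = (\<Sum>a\<in>cfgsH N. transfer N \<eta> \<xi> (Khat K2) l b a * v a)"
    by (subst sum.swap) (simp add: transfer_def sum_distrib_right sg_par mult.assoc)
  finally show ?thesis .
qed

subsection \<open>Polynomial dependence and the limit of widely separated inhomogeneities\<close>

text \<open>The recursion of \<open>covp\<close> with the matrix used at each site as a free
  parameter, so that it can be rescaled and replaced by its limit.\<close>

fun covq :: "nat \<Rightarrow> (nat \<Rightarrow> cfg \<Rightarrow> cfg \<Rightarrow> complex) \<Rightarrow> (cfg \<Rightarrow> complex) \<Rightarrow> cfg \<Rightarrow> nat \<Rightarrow> cfg \<Rightarrow> complex" where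
  "covq N A S h 0 = S"
| "covq N A S h (Suc k) = rpow N (covq N A S h k) (A (Suc k)) (h (Suc k))"

lemma covp_covq: "covp N T \<xi> S h k = covq N (\<lambda>n. T (\<xi> n)) S h k"
  by (induction k) auto

lemma polyfun_diff: "polyfun V f \<Longrightarrow> polyfun V g \<Longrightarrow> polyfun V (\<lambda>x. f x - g x)"
  using polyfun.padd[of V f "\<lambda>x. (- 1) * g x"] polyfun.pmul[OF polyfun.pconst[of V "- 1"], of g] by simp

lemma polyfun_rpow:
  assumes "\<And>b. b \<in> cfgsH N \<Longrightarrow> polyfun V (\<lambda>x. v x b)"
    and "\<And>b a. b \<in> cfgsH N \<Longrightarrow> a \<in> cfgsH N \<Longrightarrow> polyfun V (\<lambda>x. A x b a)"
    and "a \<in> cfgsH N"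
  shows "polyfun V (\<lambda>x. rpow N (v x) (A x) m a)"
  using assms(3) by (induction m arbitrary: a) (auto intro!: assms polyfun_sum polyfun.pmul finite_cfgsH)

lemma polyfun_covq:
  assumes "\<And>b. b \<in> cfgsH N \<Longrightarrow> polyfun V (\<lambda>x. S x b)"
    and "\<And>n b a. n \<in> {1..N} \<Longrightarrow> b \<in> cfgsH N \<Longrightarrow> a \<in> cfgsH N \<Longrightarrow> polyfun V (\<lambda>x. A x n b a)"
    and "a \<in> cfgsH N" "k \<le> N"
  shows "polyfun V (\<lambda>x. covq N (A x) (S x) h k a)"
  using assms(3,4) by (induction k arbitrary: a) (auto intro!: assms(1,2) polyfun_rpow)

lemma polyfun_transfer:
  assumes n: "n \<in> {1..N}"
  shows "polyfun {1..N} (\<lambda>\<xi>. transfer N \<eta> \<xi> K (\<xi> n) b a)"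
proof -
  have "k \<le> N \<Longrightarrow> polyfun {1..N} (\<lambda>\<xi>. monoR N \<eta> \<xi> k (\<xi> n) c a)" for k c a
    by (induction k arbitrary: c)
      (use n in \<open>auto simp: mmul_def Rmat_def intro!: polyfun_sum polyfun.intros polyfun_diff finite_cfgs0\<close>)
  then show ?thesis
    unfolding transfer_def monodromy_def mmul_def
    by (intro polyfun_sum polyfun.pmul polyfun.pconst finite_cfgs0) auto
qed

lemma rpow_scale: "rpow N (\<lambda>a. q * v a) (\<lambda>b a. r * A b a) m a = q * r ^ m * rpow N v A m a"
  by (induction m arbitrary: a) (simp_all add: sum_distrib_left mult_ac)

lemma covq_scale: "covq N (\<lambda>n b a. r * A n b a) S h k = (\<lambda>a. r ^ (\<Sum>m\<in>{1..k}. h m) * covq N A S h k a)"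
proof (induction k)
  case (Suc k)
  show ?case
    by (rule ext) (simp add: Suc rpow_scale power_add)
qed auto

lemma tendsto_rpow:
  assumes "\<And>b. b \<in> cfgsH N \<Longrightarrow> ((\<lambda>x. v x b) \<longlongrightarrow> v' b) F"
    and "\<And>b a. b \<in> cfgsH N \<Longrightarrow> a \<in> cfgsH N \<Longrightarrow> ((\<lambda>x. A x b a) \<longlongrightarrow> A' b a) F"
    and "a \<in> cfgsH N"
  shows "((\<lambda>x. rpow N (v x) (A x) m a) \<longlongrightarrow> rpow N v' A' m a) F"
  using assms(3) by (induction m arbitrary: a) (auto intro!: assms tendsto_sum tendsto_mult)

lemma tendsto_covq:
  assumes "\<And>n b a. n \<in> {1..N} \<Longrightarrow> b \<in> cfgsH N \<Longrightarrow> a \<in> cfgsH N \<Longrightarrow> ((\<lambda>x. A x n b a) \<longlongrightarrow> A' n b a) F"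
    and "a \<in> cfgsH N" "k \<le> N"
  shows "((\<lambda>x. covq N (A x) S h k a) \<longlongrightarrow> covq N A' S h k a) F"
  using assms(2,3) by (induction k arbitrary: a) (auto intro!: assms(1) tendsto_rpow)

section \<open>Leading order along a ray of inhomogeneities\<close>

definition ray :: "real \<Rightarrow> nat \<Rightarrow> complex" where "ray s n = of_real s * of_nat n"
definition gap :: "nat \<Rightarrow> nat \<Rightarrow> complex" where "gap N n = (\<Prod>m\<in>{1..N} - {n}. of_nat n - of_nat m)"
definition Ksite :: "(nat \<Rightarrow> nat \<Rightarrow> complex) \<Rightarrow> nat \<Rightarrow> cfg \<Rightarrow> cfg \<Rightarrow> complex" where
  "Ksite K2 n b a = (if b = a(n := b n) then Khat K2 (b n) (a n) else 0)"

lemma gap_nz: "gap N n \<noteq> 0"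
  by (auto simp: gap_def)

lemma mmul_idm: assumes "c \<in> cfgs0 N" shows "mmul (cfgs0 N) idm X c a = X c a"
proof -
  have "mmul (cfgs0 N) idm X c a = (\<Sum>b\<in>cfgs0 N. if b = c then X c a else 0)"
    unfolding mmul_def by (intro sum.cong) (auto simp: idm_def)
  then show ?thesis using assms finite_cfgs0 by simp
qed

lemma idm_mmul: assumes "a \<in> cfgs0 N" shows "mmul (cfgs0 N) X idm c a = X c a"
proof -
  have "mmul (cfgs0 N) X idm c a = (\<Sum>b\<in>cfgs0 N. if b = a then X c a else 0)"
    unfolding mmul_def by (intro sum.cong) (auto simp: idm_def)
  then show ?thesis using assms finite_cfgs0 by simp
qed

lemma tendsto_const_over: "((\<lambda>s. z / of_real s :: complex) \<longlongrightarrow> 0) at_top"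
proof -
  have "((\<lambda>s::real. inverse s) \<longlongrightarrow> 0) at_top" by (rule tendsto_inverse_0_at_top[OF filterlim_ident])
  then have "((\<lambda>s. z * of_real (inverse s)) \<longlongrightarrow> z * of_real 0) at_top"
    by (intro tendsto_intros)
  then show ?thesis by (simp add: divide_inverse)
qed

lemma tendsto_Rmat:
  "((\<lambda>s. Rmat N \<eta> m (ray s n - ray s m) c a / of_real s) \<longlongrightarrow> (of_nat n - of_nat m) * idm c a) at_top"
proof -
  have "((\<lambda>s. (of_nat n - of_nat m) * idm c a + (\<eta> * gperm N m c a) / of_real s) \<longlongrightarrow>
      (of_nat n - of_nat m) * idm c a + 0) at_top"
    by (intro tendsto_add tendsto_const tendsto_const_over)
  moreover have "eventually (\<lambda>s. (of_nat n - of_nat m) * idm c a + (\<eta> * gperm N m c a) / of_real s =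
      Rmat N \<eta> m (ray s n - ray s m) c a / of_real s) at_top"
    using eventually_gt_at_top[of "0::real"]
    by eventually_elim (simp add: Rmat_def ray_def field_simps)
  ultimately show ?thesis by (simp add: Lim_transform_eventually)
qed

text \<open>At the spectral parameter \<open>ray s n\<close> the factor of site n is exactly \<eta>
  times the transposition. Every other factor m grows like s times \<open>n - m\<close> and is a
  multiple of the identity to leading order, hence one power of s for each site different from
  n.\<close>

lemma tendsto_monoR:
  assumes n: "n \<in> {1..N}" and k: "k \<le> N" and ca: "c \<in> cfgs0 N" "a \<in> cfgs0 N"
  shows "((\<lambda>s. monoR N \<eta> (ray s) k (ray s n) c a / of_real s ^ card ({1..k} - {n})) \<longlongrightarrow>
    (\<Prod>m\<in>{1..k} - {n}. of_nat n - of_nat m) * (if n \<le> k then \<eta> * gperm N n c a else idm c a)) at_top"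
  using k ca
proof (induction k arbitrary: c)
  case 0
  then show ?case using n by simp
next
  case (Suc k)
  let ?p = "\<lambda>k. \<Prod>m\<in>{1..k} - {n}. of_nat n - of_nat m :: complex"
  have IH: "((\<lambda>s. monoR N \<eta> (ray s) k (ray s n) b a / of_real s ^ card ({1..k} - {n})) \<longlongrightarrow>
      ?p k * (if n \<le> k then \<eta> * gperm N n b a else idm b a)) at_top" if "b \<in> cfgs0 N" for b
    using Suc that by simp
  show ?case
  proof (cases "n = Suc k")
    case True
    have set: "{1..Suc k} - {n} = {1..k} - {n}" using True by auto
    have "((\<lambda>s. \<Sum>b\<in>cfgs0 N. \<eta> * gperm N n c b * (monoR N \<eta> (ray s) k (ray s n) b a / of_real s ^ card ({1..k} - {n}))) \<longlongrightarrow>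
       (\<Sum>b\<in>cfgs0 N. \<eta> * gperm N n c b * (?p k * idm b a))) at_top"
      using IH True by (intro tendsto_sum tendsto_mult tendsto_const) auto
    also have "(\<Sum>b\<in>cfgs0 N. \<eta> * gperm N n c b * (?p k * idm b a)) = \<eta> * ?p k * mmul (cfgs0 N) (gperm N n) idm c a"
      unfolding mmul_def sum_distrib_left by (intro sum.cong refl) (simp only: mult_ac)
    also have "\<dots> = ?p (Suc k) * (\<eta> * gperm N n c a)"
      unfolding set by (simp add: idm_mmul[OF Suc.prems(3)])
    finally show ?thesis
      using True by (simp add: set mmul_def Rmat_def sum_divide_distrib)
  next
    case False
    have set: "{1..Suc k} - {n} = insert (Suc k) ({1..k} - {n})" using False by auto
    have "((\<lambda>s. \<Sum>b\<in>cfgs0 N. (Rmat N \<eta> (Suc k) (ray s n - ray s (Suc k)) c b / of_real s) *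
        (monoR N \<eta> (ray s) k (ray s n) b a / of_real s ^ card ({1..k} - {n}))) \<longlongrightarrow>
       (\<Sum>b\<in>cfgs0 N. (of_nat n - of_nat (Suc k)) * idm c b * (?p k * (if n \<le> k then \<eta> * gperm N n b a else idm b a)))) at_top"
      by (intro tendsto_sum tendsto_mult tendsto_Rmat IH)
    also have "(\<Sum>b\<in>cfgs0 N. (of_nat n - of_nat (Suc k)) * idm c b * (?p k * (if n \<le> k then \<eta> * gperm N n b a else idm b a))) =
        (of_nat n - of_nat (Suc k)) * ?p k * mmul (cfgs0 N) idm (\<lambda>b a. if n \<le> k then \<eta> * gperm N n b a else idm b a) c a"
      unfolding mmul_def sum_distrib_left by (intro sum.cong refl) (simp only: mult_ac)
    also have "\<dots> = ?p (Suc k) * (if n \<le> Suc k then \<eta> * gperm N n c a else idm c a)"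
      unfolding mmul_idm[OF Suc.prems(2)] set using False by (subst prod.insert) auto
    finally show ?thesis
      unfolding set by (simp add: mmul_def sum_divide_distrib)
  qed
qed

text \<open>The partial supertrace of the twist times the transposition is the twist at site n. For
  a nonzero entry both \<open>i\<close> and \<open>a n\<close> are odd: the strings occur squared,
  and the sign of the supertrace cancels that of the transposition.\<close>

lemma Kaux_gperm:
  assumes n: "n \<in> {1..N}" and ba: "b \<in> cfgsH N" "a \<in> cfgsH N" and i: "i < 3"
  shows "(- 1) ^ par i * (- 1) ^ (par i * (pH N a + pH N b)) *
     mmul (cfgs0 N) (Kaux (Khat K2)) (gperm N n) (b(0 := i)) (a(0 := i)) = (if i = b n then Ksite K2 n b a else 0)"
proof -
  let ?a = "a(0 := i)" and ?b = "b(0 := i)"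
  have a0: "?a \<in> cfgs0 N" "?b \<in> cfgs0 N" and a3: "a n < 3"
    using ba i by (auto simp: cfgsH_def cfgs0_def)
  have sw: "?a \<circ> sw 0 n = a(0 := a n, n := i)"
    using n by (auto simp: fun_eq_iff Transposition.transpose_def)
  have sw0: "?a \<circ> sw 0 n \<in> cfgs0 N" using cfgs0_sw[OF a0(1), of 0 n] n by simp
  have Kx: "Kaux (Khat K2) ?b (a(0 := a n, n := i)) = (if b = a(n := i) then Khat K2 i (a n) else 0)"
  proof -
    have b0: "b 0 = 0" "a 0 = 0" using ba by (auto simp: cfgsH_def)
    have "(a(0 := a n, n := i)) 0 = j \<and> ?b = (a(0 := a n, n := i))(0 := k) \<longleftrightarrow> j = a n \<and> k = i \<and> b = a(n := i)" for j k
    proof -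
      have "n \<noteq> 0" using n by simp
      then have e: "(a(0 := a n, n := i)) 0 = a n" "(a(0 := a n, n := i))(0 := k) = a(n := i, 0 := k)"
        by (auto simp: fun_upd_twist)
      have "b(0 := i) = a(n := i, 0 := k) \<longleftrightarrow> k = i \<and> b = a(n := i)"
      proof
        assume h: "b(0 := i) = a(n := i, 0 := k)"
        have "b(0 := 0) = (b(0 := i))(0 := 0)" by simp
        also have "\<dots> = a(n := i, 0 := 0)" by (simp only: h fun_upd_upd)
        finally have "b = a(n := i)" using b0 \<open>n \<noteq> 0\<close> by (simp add: fun_upd_idem)
        then show "k = i \<and> b = a(n := i)" using fun_cong[OF h, of 0] by simp
      qed simp
      then show ?thesis unfolding e by auto
    qed
    then have "site_op 0 k j ?b (a(0 := a n, n := i)) = (if j = a n \<and> k = i \<and> b = a(n := i) then 1 else 0)" for j k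
      by (simp add: site_op_def)
    then have "Kaux (Khat K2) ?b (a(0 := a n, n := i)) =
        (\<Sum>k<3. \<Sum>j<3. if j = a n then (if k = i \<and> b = a(n := i) then Khat K2 i (a n) else 0) else 0)"
      unfolding Kaux_def by (intro sum.cong refl) auto
    also have "\<dots> = (\<Sum>k<3. if k = i then (if b = a(n := i) then Khat K2 i (a n) else 0) else 0)"
      using a3 by (intro sum.cong refl) auto
    finally show ?thesis using i by simp
  qed
  have "mmul (cfgs0 N) (Kaux (Khat K2)) (gperm N n) ?b ?a =
     (\<Sum>c\<in>cfgs0 N. if c = ?a \<circ> sw 0 n then Kaux (Khat K2) ?b (?a \<circ> sw 0 n) *
        (sg i * jw n ?a ^ (par i + par (a n))) else 0)"
    unfolding mmul_def using n by (intro sum.cong refl) (auto simp: gperm_eq[OF a0(1)])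
  also have "\<dots> = Kaux (Khat K2) ?b (?a \<circ> sw 0 n) * (sg i * jw n ?a ^ (par i + par (a n)))"
    using sw0 finite_cfgs0 by simp
  also have "\<dots> = (if b = a(n := i) then Khat K2 i (a n) else 0) * (sg i * jw n ?a ^ (par i + par (a n)))"
    by (simp only: sw Kx)
  finally have m: "mmul (cfgs0 N) (Kaux (Khat K2)) (gperm N n) ?b ?a =
      (if b = a(n := i) then Khat K2 i (a n) else 0) * (sg i * jw n ?a ^ (par i + par (a n)))" .
  show ?thesis
  proof (cases "b = a(n := i) \<and> Khat K2 i (a n) \<noteq> 0")
    case True
    then have od: "i \<noteq> 0" "a n \<noteq> 0" and b: "b = a(n := i)" using Khat_nz[of K2 i "a n"] by auto
    have "pH N b = pH N a"
      unfolding pH_def by (intro sum.cong refl) (use b od in \<open>auto simp: par_def\<close>)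
    then have p: "(- 1) ^ (par i * (pH N a + pH N b)) = (1 :: complex)"
      by (simp add: mult_2[symmetric])
    have e: "par i + par (a n) = 2" "(- 1) ^ par i = (- 1 :: complex)" "sg i = - 1"
      using od by (simp_all add: par_def sg_def)
    have K: "Ksite K2 n b a = Khat K2 i (a n)" "i = b n \<longleftrightarrow> True" "b = a(n := i) \<longleftrightarrow> True"
      unfolding Ksite_def b by simp_all
    have j: "jw n ?a ^ 2 = 1" by (simp add: power2_eq_square)
    show ?thesis unfolding m e p K j by simp
  next
    case False
    have "(if i = b n then Ksite K2 n b a else 0) = 0"
      using False by (auto simp: Ksite_def)
    then show ?thesis using False by (auto simp: m)
  qed
qed

lemma tendsto_transfer:
  assumes n: "n \<in> {1..N}" and ba: "b \<in> cfgsH N" "a \<in> cfgsH N"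
  shows "((\<lambda>s. transfer N \<eta> (ray s) (Khat K2) (ray s n) b a / of_real s ^ (N - 1)) \<longlongrightarrow>
     \<eta> * gap N n * Ksite K2 n b a) at_top"
proof -
  have H0: "a(0 := i) \<in> cfgs0 N" if "a \<in> cfgsH N" "i < 3" for a i
    using that by (auto simp: cfgsH_def cfgs0_def)
  have card: "card ({1..N} - {n}) = N - 1" using n by simp
  let ?s = "\<lambda>i. (- 1) ^ par i * (- 1) ^ (par i * (pH N a + pH N b)) :: complex"
  have "((\<lambda>s. \<Sum>i<3. \<Sum>c\<in>cfgs0 N. ?s i * (Kaux (Khat K2) (b(0 := i)) c *
        (monoR N \<eta> (ray s) N (ray s n) c (a(0 := i)) / of_real s ^ card ({1..N} - {n})))) \<longlongrightarrow>
     (\<Sum>i<3. \<Sum>c\<in>cfgs0 N. ?s i * (Kaux (Khat K2) (b(0 := i)) c *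
        ((\<Prod>m\<in>{1..N} - {n}. of_nat n - of_nat m) * (if n \<le> N then \<eta> * gperm N n c (a(0 := i)) else idm c (a(0 := i))))))) at_top"
    using H0[OF ba(2)] by (intro tendsto_sum tendsto_mult tendsto_const tendsto_monoR n) auto
  also have "(\<lambda>s. \<Sum>i<3. \<Sum>c\<in>cfgs0 N. ?s i * (Kaux (Khat K2) (b(0 := i)) c *
        (monoR N \<eta> (ray s) N (ray s n) c (a(0 := i)) / of_real s ^ card ({1..N} - {n})))) =
      (\<lambda>s. transfer N \<eta> (ray s) (Khat K2) (ray s n) b a / of_real s ^ (N - 1))"
    unfolding card transfer_def monodromy_def mmul_def
    by (simp add: sum_distrib_left sum_divide_distrib)
  also have "(\<Sum>i<3. \<Sum>c\<in>cfgs0 N. ?s i * (Kaux (Khat K2) (b(0 := i)) c *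
        ((\<Prod>m\<in>{1..N} - {n}. of_nat n - of_nat m) * (if n \<le> N then \<eta> * gperm N n c (a(0 := i)) else idm c (a(0 := i)))))) =
     (\<Sum>i<3. \<eta> * gap N n * (?s i * mmul (cfgs0 N) (Kaux (Khat K2)) (gperm N n) (b(0 := i)) (a(0 := i))))"
    using n by (intro sum.cong refl) (simp add: mmul_def gap_def sum_distrib_left mult_ac)
  also have "\<dots> = (\<Sum>i<3. \<eta> * gap N n * (if i = b n then Ksite K2 n b a else 0))"
    by (intro sum.cong refl) (simp only: Kaux_gperm[OF n ba] lessThan_iff)
  also have "\<dots> = (\<Sum>i<3. if i = b n then \<eta> * gap N n * Ksite K2 n b a else 0)"
    by (intro sum.cong) auto
  also have "\<dots> = \<eta> * gap N n * Ksite K2 n b a"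
    using ba by (simp add: cfgsH_def)
  finally show ?thesis .
qed

text \<open>The row vector \<open>v\<close> times the \<open>j\<close>-th power of
  \<open>Khat K2\<close>: the factor of a limiting covector at one site.\<close>

fun rp :: "(nat \<Rightarrow> nat \<Rightarrow> complex) \<Rightarrow> (nat \<Rightarrow> complex) \<Rightarrow> nat \<Rightarrow> nat \<Rightarrow> complex" where
  "rp K2 v 0 = v"
| "rp K2 v (Suc j) = (\<lambda>i. \<Sum>l<3. rp K2 v j l * Khat K2 l i)"

lemma rpow_tensor:
  assumes n: "n \<in> {1..N}" and v: "\<And>a. a \<in> cfgsH N \<Longrightarrow> v a = q * (\<Prod>m\<in>{1..N}. \<tau> m (a m))" and a: "a \<in> cfgsH N"
  shows "rpow N v (\<lambda>b a. \<kappa> * Ksite K2 n b a) j a =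
     q * \<kappa> ^ j * (\<Prod>m\<in>{1..N}. (\<tau>(n := rp K2 (\<tau> n) j)) m (a m))"
  using a
proof (induction j arbitrary: a)
  case (Suc j)
  let ?\<tau> = "\<tau>(n := rp K2 (\<tau> n) j)"
  have inj: "inj_on (\<lambda>i. a(n := i)) {..<3}" by (auto simp: inj_on_def dest: fun_upd_eqD)
  have sub: "(\<lambda>i. a(n := i)) ` {..<3} \<subseteq> cfgsH N" using Suc.prems n by (auto intro: cfgsH_upd)
  have "rpow N v (\<lambda>b a. \<kappa> * Ksite K2 n b a) (Suc j) a =
      (\<Sum>b\<in>(\<lambda>i. a(n := i)) ` {..<3}. rpow N v (\<lambda>b a. \<kappa> * Ksite K2 n b a) j b * (\<kappa> * Ksite K2 n b a))"
  proof (simp, rule sum.mono_neutral_right[OF finite_cfgsH sub], rule ballI)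
    fix b assume b: "b \<in> cfgsH N - (\<lambda>i. a(n := i)) ` {..<3}"
    then have "b n < 3" by (auto simp: cfgsH_def)
    then have "b \<noteq> a(n := b n)" using b by blast
    then show "rpow N v (\<lambda>b a. \<kappa> * Ksite K2 n b a) j b * (\<kappa> * Ksite K2 n b a) = 0"
      by (simp add: Ksite_def)
  qed
  also have "\<dots> = (\<Sum>i<3. rpow N v (\<lambda>b a. \<kappa> * Ksite K2 n b a) j (a(n := i)) * (\<kappa> * Khat K2 i (a n)))"
    by (subst sum.reindex[OF inj]) (simp add: Ksite_def)
  also have "\<dots> = (\<Sum>i<3. q * \<kappa> ^ Suc j * (\<Prod>m\<in>{1..N} - {n}. \<tau> m (a m)) * (rp K2 (\<tau> n) j i * Khat K2 i (a n)))"
  proof (intro sum.cong refl)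
    fix i :: nat assume "i \<in> {..<3}"
    then have ai: "a(n := i) \<in> cfgsH N" using Suc.prems n by (intro cfgsH_upd) auto
    have "(\<Prod>m\<in>{1..N}. ?\<tau> m ((a(n := i)) m)) = rp K2 (\<tau> n) j i * (\<Prod>m\<in>{1..N} - {n}. ?\<tau> m ((a(n := i)) m))"
      using n by (subst prod.remove[of _ n]) auto
    also have "(\<Prod>m\<in>{1..N} - {n}. ?\<tau> m ((a(n := i)) m)) = (\<Prod>m\<in>{1..N} - {n}. \<tau> m (a m))"
      by (intro prod.cong) auto
    finally show "rpow N v (\<lambda>b a. \<kappa> * Ksite K2 n b a) j (a(n := i)) * (\<kappa> * Khat K2 i (a n)) =
        q * \<kappa> ^ Suc j * (\<Prod>m\<in>{1..N} - {n}. \<tau> m (a m)) * (rp K2 (\<tau> n) j i * Khat K2 i (a n))"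
      unfolding Suc.IH[OF ai] by (simp add: mult_ac)
  qed
  also have "\<dots> = q * \<kappa> ^ Suc j * ((\<Prod>m\<in>{1..N} - {n}. \<tau> m (a m)) * rp K2 (\<tau> n) (Suc j) (a n))"
    by (simp add: sum_distrib_left mult.assoc)
  also have "(\<Prod>m\<in>{1..N} - {n}. \<tau> m (a m)) * rp K2 (\<tau> n) (Suc j) (a n) = (\<Prod>m\<in>{1..N}. (\<tau>(n := rp K2 (\<tau> n) (Suc j))) m (a m))"
    using n by (subst prod.remove[of "{1..N}" n]) (auto intro!: prod.cong simp del: rp.simps)
  finally show ?case .
qed (use v in simp)

lemma covq_tensor:
  assumes S: "\<And>a. a \<in> cfgsH N \<Longrightarrow> S a = (\<Prod>m\<in>{1..N}. \<sigma> m (a m))" and a: "a \<in> cfgsH N" and k: "k \<le> N"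
  shows "covq N (\<lambda>n b a. \<kappa> n * Ksite K2 n b a) S h k a =
     (\<Prod>m\<in>{1..k}. \<kappa> m ^ h m) * (\<Prod>m\<in>{1..N}. (if m \<le> k then rp K2 (\<sigma> m) (h m) else \<sigma> m) (a m))"
  using k a
proof (induction k arbitrary: a)
  case 0
  then show ?case by (auto simp: S intro!: prod.cong)
next
  case (Suc k)
  let ?\<tau> = "\<lambda>m. if m \<le> k then rp K2 (\<sigma> m) (h m) else \<sigma> m"
  have "covq N (\<lambda>n b a. \<kappa> n * Ksite K2 n b a) S h (Suc k) a =
      (\<Prod>m\<in>{1..k}. \<kappa> m ^ h m) * \<kappa> (Suc k) ^ h (Suc k) *
      (\<Prod>m\<in>{1..N}. (?\<tau>(Suc k := rp K2 (?\<tau> (Suc k)) (h (Suc k)))) m (a m))"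
    unfolding covq.simps by (rule rpow_tensor) (use Suc in auto)
  also have "(\<Prod>m\<in>{1..N}. (?\<tau>(Suc k := rp K2 (?\<tau> (Suc k)) (h (Suc k)))) m (a m)) =
      (\<Prod>m\<in>{1..N}. (if m \<le> Suc k then rp K2 (\<sigma> m) (h m) else \<sigma> m) (a m))"
    by (intro prod.cong refl) (auto simp: le_Suc_eq)
  finally show ?case by simp
qed

lemma sum_cfgsH_prod: "(\<Sum>a\<in>cfgsH N. \<Prod>m\<in>{1..N}. f m (a m)) = (\<Prod>m\<in>{1..N}. \<Sum>i<3. f m i :: complex)"
proof -
  have bij: "bij_betw (\<lambda>c n. if n \<in> {1..N} then c n else 0) (PiE {1..N} (\<lambda>_. {..<3})) (cfgsH N)"
  proof (rule bij_betw_byWitness[where f' = "\<lambda>a. restrict a {1..N}"])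
    show "\<forall>c\<in>PiE {1..N} (\<lambda>_. {..<3}). restrict (\<lambda>n. if n \<in> {1..N} then c n else 0) {1..N} = c"
      by (auto simp: fun_eq_iff PiE_def extensional_def)
    show "\<forall>a\<in>cfgsH N. (\<lambda>n. if n \<in> {1..N} then restrict a {1..N} n else 0) = a"
      by (auto simp: fun_eq_iff cfgsH_def Suc_le_eq)
    show "(\<lambda>c n. if n \<in> {1..N} then c n else 0) ` PiE {1..N} (\<lambda>_. {..<3}) \<subseteq> cfgsH N"
      by (auto simp: cfgsH_def PiE_def)
    show "(\<lambda>a. restrict a {1..N}) ` cfgsH N \<subseteq> PiE {1..N} (\<lambda>_. {..<3})"
      by (auto simp: cfgsH_def PiE_def)
  qed
  have "(\<Sum>a\<in>cfgsH N. \<Prod>m\<in>{1..N}. f m (a m)) =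
      (\<Sum>c\<in>PiE {1..N} (\<lambda>_. {..<3}). \<Prod>m\<in>{1..N}. f m (if m \<in> {1..N} then c m else 0))"
    by (rule sum.reindex_bij_betw[OF bij, symmetric])
  also have "\<dots> = (\<Sum>c\<in>PiE {1..N} (\<lambda>_. {..<3}). \<Prod>m\<in>{1..N}. f m (c m))"
    by (intro sum.cong prod.cong) auto
  also have "\<dots> = (\<Prod>m\<in>{1..N}. \<Sum>i<3. f m i)"
    by (rule prod_sum_PiE[symmetric]) auto
  finally show ?thesis .
qed

lemma cfgsH_eq_iff: "a \<in> cfgsH N \<Longrightarrow> b \<in> cfgsH N \<Longrightarrow> a = b \<longleftrightarrow> (\<forall>m\<in>{1..N}. a m = b m)"
proof -
  assume ab: "a \<in> cfgsH N" "b \<in> cfgsH N"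
  have "a m = b m" if "\<forall>m\<in>{1..N}. a m = b m" for m
    using that ab by (cases "m \<in> {1..N}") (auto simp: cfgsH_def Suc_le_eq)
  then show ?thesis by auto
qed

lemma prod_delta: "a \<in> cfgsH N \<Longrightarrow> b \<in> cfgsH N \<Longrightarrow>
   (\<Prod>m\<in>{1..N}. if a m = b m then 1 else 0 :: complex) = (if a = b then 1 else 0)"
  by (cases "a = b") (auto simp: cfgsH_eq_iff intro!: prod_zero bexI)

text \<open>A product over the sites of inverse 3 by 3 matrices inverts the product matrix, because
  sums over configurations of such products factor.\<close>

lemma detI_tensor:
  assumes inv: "\<And>i k. i < 3 \<Longrightarrow> k < 3 \<Longrightarrow> (\<Sum>j<3. m i j * r j k) = (if i = k then 1 else 0)"
  shows "detI (cfgsH N) (\<lambda>h a. \<Prod>n\<in>{1..N}. m (h n) (a n)) \<noteq> 0"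
proof (rule detI_right_inverse[OF finite_cfgsH, where B = "\<lambda>a h. \<Prod>n\<in>{1..N}. r (a n) (h n)"])
  fix h k assume hk: "h \<in> cfgsH N" "k \<in> cfgsH N"
  have "(\<Sum>a\<in>cfgsH N. (\<Prod>n\<in>{1..N}. m (h n) (a n)) * (\<Prod>n\<in>{1..N}. r (a n) (k n))) =
     (\<Sum>a\<in>cfgsH N. \<Prod>n\<in>{1..N}. m (h n) (a n) * r (a n) (k n))"
    by (simp add: prod.distrib)
  also have "\<dots> = (\<Prod>n\<in>{1..N}. \<Sum>j<3. m (h n) j * r j (k n))"
    by (rule sum_cfgsH_prod)
  also have "\<dots> = (\<Prod>n\<in>{1..N}. if h n = k n then 1 else 0)"
    using hk by (intro prod.cong refl inv) (auto simp: cfgsH_def)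
  finally show "(\<Sum>a\<in>cfgsH N. (\<Prod>n\<in>{1..N}. m (h n) (a n)) * (\<Prod>n\<in>{1..N}. r (a n) (k n))) = (if h = k then 1 else 0)"
    by (simp only: prod_delta[OF hk])
qed

section \<open>Determinants at one site\<close>

definition det3 :: "(nat \<Rightarrow> nat \<Rightarrow> complex) \<Rightarrow> complex" where
  "det3 m = m 0 0 * (m 1 1 * m 2 2 - m 1 2 * m 2 1) - m 0 1 * (m 1 0 * m 2 2 - m 1 2 * m 2 0)
     + m 0 2 * (m 1 0 * m 2 1 - m 1 1 * m 2 0)"

lemma det3_inverse:
  assumes "det3 m \<noteq> 0"
  shows "\<exists>r. \<forall>i<3. \<forall>k<3. (\<Sum>j<3. m i j * r j k) = (if i = k then 1 else 0)"
proof -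
  \<comment> \<open>The adjugate; taking indices cyclically modulo 3 absorbs the cofactor
    signs.\<close>
  define c where "c j k = m ((k + 1) mod 3) ((j + 1) mod 3) * m ((k + 2) mod 3) ((j + 2) mod 3)
     - m ((k + 1) mod 3) ((j + 2) mod 3) * m ((k + 2) mod 3) ((j + 1) mod 3)" for j k
  have "(\<Sum>j<3. m i j * (c j k / det3 m)) = (if i = k then 1 else 0)" if "i < 3" "k < 3" for i k
  proof -
    have "(\<Sum>j<3. m i j * c j k) = (if i = k then det3 m else 0)"
    proof -
      have "i = 0 \<or> i = 1 \<or> i = 2" "k = 0 \<or> k = 1 \<or> k = 2" using that by auto
      then show ?thesis
        by (auto simp: c_def det3_def lessThan_nat_numeral lessThan_Suc numeral_2_eq_2 algebra_simps)
    qed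
    moreover have "(\<Sum>j<3. m i j * (c j k / det3 m)) = (\<Sum>j<3. m i j * c j k) / det3 m"
      by (simp add: sum_divide_distrib)
    ultimately show ?thesis using assms by auto
  qed
  then show ?thesis by (intro exI[of _ "\<lambda>j k. c j k / det3 m"]) simp
qed

lemma sum_lt_3: "(\<Sum>i<3. f i) = f 0 + f 1 + f (2::nat)"
  by (simp add: eval_nat_numeral)

lemma rp_1: "rp K2 s 1 0 = 0" "rp K2 s 1 1 = s 1 * K2 1 1 + s 2 * K2 2 1" "rp K2 s 1 2 = s 1 * K2 1 2 + s 2 * K2 2 2"
  by (simp_all add: sum_lt_3 Khat_def)

lemma rp_Suc_entries:
  "rp K2 s (Suc j) 0 = 0"
  "rp K2 s (Suc j) 1 = rp K2 s j 1 * K2 1 1 + rp K2 s j 2 * K2 2 1"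
  "rp K2 s (Suc j) 2 = rp K2 s j 1 * K2 1 2 + rp K2 s j 2 * K2 2 2"
  by (simp_all add: sum_lt_3 Khat_def)

text \<open>Krylov matrix with rows s, sK, sK^2. In column 0 only \<open>s 0\<close> survives. In
  the remaining block both rows are images under \<open>K2\<close> of the rows s and sK, restricted
  to the odd states, which yields the factor det \<open>K2\<close>.\<close>

lemma det3_rp:
  "det3 (rp K2 s) = s 0 * (s 1 * (s 1 * K2 1 2 + s 2 * K2 2 2) - s 2 * (s 1 * K2 1 1 + s 2 * K2 2 1)) *
     (K2 1 1 * K2 2 2 - K2 1 2 * K2 2 1)"
proof -
  have 2: "rp K2 s 2 = rp K2 s (Suc 1)" by (simp only: numeral_2_eq_2 One_nat_def)
  have 0: "rp K2 s 0 = s" by simp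
  show ?thesis
    unfolding det3_def 2 rp_Suc_entries rp_1 0 by Groebner_Basis.algebra
qed

lemma cyclic_covector:
  assumes tr: "K2 1 1 + K2 2 2 = k2 + k3" and det: "K2 1 1 * K2 2 2 - K2 1 2 * K2 2 1 = k2 * k3"
    and "k2 \<noteq> k3" "k2 * k3 \<noteq> 0"
  shows "\<exists>s. det3 (rp K2 s) \<noteq> 0"
proof -
  define s :: "complex \<Rightarrow> complex \<Rightarrow> nat \<Rightarrow> complex" where "s x y i = (if i = 0 then 1 else if i = 1 then x else y)" for x y i
  have d: "det3 (rp K2 (s x y)) = (x * (x * K2 1 2 + y * K2 2 2) - y * (x * K2 1 1 + y * K2 2 1)) * (k2 * k3)" for x y
    unfolding det3_rp det by (simp add: s_def)
  \<comment> \<open>Apart from \<open>k2 * k3\<close> the determinant is a quadratic form in x and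
    y. If it vanishes at these three points, \<open>K2\<close> is a multiple of the identity and its
    discriminant is 0.\<close>
  have "det3 (rp K2 (s 1 0)) \<noteq> 0 \<or> det3 (rp K2 (s 0 1)) \<noteq> 0 \<or> det3 (rp K2 (s 1 1)) \<noteq> 0"
  proof (rule ccontr)
    assume "\<not> ?thesis"
    then have z: "K2 1 2 = 0" "K2 2 1 = 0" "K2 2 2 = K2 1 1"
      using assms(4) unfolding d by auto
    have "(k2 - k3)\<^sup>2 = (K2 1 1 + K2 2 2)\<^sup>2 - 4 * (K2 1 1 * K2 2 2 - K2 1 2 * K2 2 1)"
      unfolding tr det by (simp add: power2_eq_square algebra_simps)
    also have "\<dots> = 0" unfolding z by (simp add: power2_eq_square)
    finally show False using assms(3) by simp
  qed
  then show ?thesis by blast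
qed

definition ptr :: "(nat \<Rightarrow> nat \<Rightarrow> complex) \<Rightarrow> nat \<Rightarrow> complex" where
  "ptr K2 j = (\<Sum>i<3. rp K2 (\<lambda>l. if l = i then 1 else 0) j i)"

text \<open>\<open>ptr\<close> gives the power sums of the eigenvalues 0, \<open>k2\<close>,
  \<open>k3\<close> of the twist, so this Hankel determinant is the square of their Vandermonde
  determinant.\<close>

lemma det3_ptr:
  assumes tr: "K2 1 1 + K2 2 2 = k2 + k3" and det: "K2 1 1 * K2 2 2 - K2 1 2 * K2 2 1 = k2 * k3"
  shows "det3 (\<lambda>i j. ptr K2 (i + j)) = (k2 * k3 * (k2 - k3))\<^sup>2"
proof -
  have p0: "ptr K2 0 = 3" by (simp add: ptr_def)
  have p1: "ptr K2 (Suc 0) = k2 + k3"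
    unfolding ptr_def sum_lt_3 rp_Suc_entries using tr by simp
  have p2: "ptr K2 (Suc (Suc 0)) = k2\<^sup>2 + k3\<^sup>2"
  proof -
    have "ptr K2 (Suc (Suc 0)) = (K2 1 1 + K2 2 2)\<^sup>2 - 2 * (K2 1 1 * K2 2 2 - K2 1 2 * K2 2 1)"
      unfolding ptr_def sum_lt_3 rp_Suc_entries by (simp add: power2_eq_square algebra_simps)
    then show ?thesis unfolding tr det by (simp add: power2_eq_square algebra_simps)
  qed
  \<comment> \<open>Cayley-Hamilton for \<open>K2\<close>. The recursion starts at exponent 1, since
    at exponent 0 the trace also counts the eigenvalue 0.\<close>
  have rec: "ptr K2 (Suc (Suc (Suc j))) = (k2 + k3) * ptr K2 (Suc (Suc j)) - k2 * k3 * ptr K2 (Suc j)" for j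
    unfolding ptr_def sum_lt_3 rp_Suc_entries tr[symmetric] det[symmetric] by Groebner_Basis.algebra
  have p3: "ptr K2 (Suc (Suc (Suc 0))) = k2 ^ 3 + k3 ^ 3"
    unfolding rec p1 p2 by Groebner_Basis.algebra
  have p4: "ptr K2 (Suc (Suc (Suc (Suc 0)))) = k2 ^ 4 + k3 ^ 4"
    unfolding rec[of "Suc 0"] p3 p2 by Groebner_Basis.algebra
  have n: "(1::nat) + 1 = Suc (Suc 0)" "(0::nat) + 1 = Suc 0" "(1::nat) + 0 = Suc 0" "(0::nat) + 0 = 0"
     "(0::nat) + 2 = Suc (Suc 0)" "(2::nat) + 0 = Suc (Suc 0)" "(1::nat) + 2 = Suc (Suc (Suc 0))"
     "(2::nat) + 1 = Suc (Suc (Suc 0))" "(2::nat) + 2 = Suc (Suc (Suc (Suc 0)))" by simp_all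
  show ?thesis
    unfolding det3_def n p0 p1 p2 p3 p4 by Groebner_Basis.algebra
qed

definition dl :: "cfg \<Rightarrow> cfg \<Rightarrow> complex" where "dl a b = (if b = a then 1 else 0)"

text \<open>The matrix of the trace form on the products of powers, as a sum of diagonal entries.
  With the exponents already added it is a polynomial in \<xi> without any appeal to commutativity,
  by which \<open>gram_trc\<close> recognizes it as a trace of products.\<close>

definition gram :: "nat \<Rightarrow> complex \<Rightarrow> (nat \<Rightarrow> complex) \<Rightarrow> (nat \<Rightarrow> nat \<Rightarrow> complex) \<Rightarrow> cfg \<Rightarrow> cfg \<Rightarrow> complex" where
  "gram N \<eta> \<xi> K h h' = (\<Sum>a\<in>cfgsH N. covq N (\<lambda>n. transfer N \<eta> \<xi> K (\<xi> n)) (dl a) (\<lambda>m. h m + h' m) N a)"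

lemma tendsto_covq_scaled:
  assumes S: "\<And>a. a \<in> cfgsH N \<Longrightarrow> S a = (\<Prod>m\<in>{1..N}. \<sigma> m (a m))" and a: "a \<in> cfgsH N"
  shows "((\<lambda>s. (1 / of_real s ^ (N - 1)) ^ (\<Sum>m\<in>{1..N}. h m) *
        covq N (\<lambda>n. transfer N \<eta> (ray s) (Khat K2) (ray s n)) S h N a) \<longlongrightarrow>
     (\<Prod>m\<in>{1..N}. (\<eta> * gap N m) ^ h m) * (\<Prod>m\<in>{1..N}. rp K2 (\<sigma> m) (h m) (a m))) at_top"
proof -
  have "((\<lambda>s. covq N (\<lambda>n b a. 1 / of_real s ^ (N - 1) * transfer N \<eta> (ray s) (Khat K2) (ray s n) b a) S h N a) \<longlongrightarrow>
     covq N (\<lambda>n b a. \<eta> * gap N n * Ksite K2 n b a) S h N a) at_top"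
    using tendsto_transfer by (intro tendsto_covq a order_refl) simp
  also have "covq N (\<lambda>n b a. \<eta> * gap N n * Ksite K2 n b a) S h N a =
      (\<Prod>m\<in>{1..N}. (\<eta> * gap N m) ^ h m) * (\<Prod>m\<in>{1..N}. rp K2 (\<sigma> m) (h m) (a m))"
    by (subst covq_tensor[OF S a order_refl]) (auto intro!: prod.cong)
  finally show ?thesis by (simp only: covq_scale)
qed

text \<open>Scaling rows and columns does not affect whether a determinant vanishes, so each entry
  may be divided by its own power of s before passing to the limit.\<close>

lemma detI_scaled_eventually:
  assumes V: "finite V"
    and lim: "\<And>i j. i \<in> V \<Longrightarrow> j \<in> V \<Longrightarrow> ((\<lambda>s. r s i * M s i j * q s j) \<longlongrightarrow> r' i * L i j * q' j) F"
    and nz: "detI V L \<noteq> 0" "\<And>i. i \<in> V \<Longrightarrow> r' i \<noteq> 0" "\<And>i. i \<in> V \<Longrightarrow> q' i \<noteq> 0"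
  shows "eventually (\<lambda>s. detI V (M s) \<noteq> 0) F"
proof -
  have "((\<lambda>s. detI V (\<lambda>i j. r s i * M s i j * q s j)) \<longlongrightarrow> detI V (\<lambda>i j. r' i * L i j * q' j)) F"
    by (intro detI_tendsto V lim)
  moreover have "detI V (\<lambda>i j. r' i * L i j * q' j) \<noteq> 0"
    unfolding detI_scale[OF V] using nz V by simp
  ultimately have "eventually (\<lambda>s. detI V (\<lambda>i j. r s i * M s i j * q s j) \<noteq> 0) F"
    by (rule tendsto_imp_eventually_ne)
  then show ?thesis
    unfolding detI_scale[OF V] by (rule eventually_mono) auto
qed

lemma eventually_sov:
  assumes eta: "\<eta> \<noteq> 0" and s0: "det3 (rp K2 s0) \<noteq> 0"
  shows "eventually (\<lambda>s. detI (cfgsH N) (\<lambda>h a. covq N (\<lambda>n. transfer N \<eta> (ray s) (Khat K2) (ray s n))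
     (\<lambda>a. \<Prod>m\<in>{1..N}. s0 (a m)) h N a) \<noteq> 0) at_top"
proof (rule detI_scaled_eventually[OF finite_cfgsH])
  obtain r where "\<And>i k. i < 3 \<Longrightarrow> k < 3 \<Longrightarrow> (\<Sum>j<3. rp K2 s0 i j * r j k) = (if i = k then 1 else 0)"
    using det3_inverse[OF s0] by blast
  then show "detI (cfgsH N) (\<lambda>h a. \<Prod>n\<in>{1..N}. rp K2 s0 (h n) (a n)) \<noteq> 0" by (rule detI_tensor)
next
  fix h a assume "h \<in> cfgsH N" "a \<in> cfgsH N"
  then show "((\<lambda>s. (1 / of_real s ^ (N - 1)) ^ (\<Sum>m\<in>{1..N}. h m) * covq N (\<lambda>n. transfer N \<eta> (ray s) (Khat K2) (ray s n))
     (\<lambda>a. \<Prod>m\<in>{1..N}. s0 (a m)) h N a * 1) \<longlongrightarrow>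
     (\<Prod>m\<in>{1..N}. (\<eta> * gap N m) ^ h m) * (\<Prod>n\<in>{1..N}. rp K2 s0 (h n) (a n)) * 1) at_top"
    unfolding mult_1_right by (intro tendsto_covq_scaled) auto
qed (use eta gap_nz in auto)

lemma eventually_gram:
  assumes eta: "\<eta> \<noteq> 0" and tr: "K2 1 1 + K2 2 2 = k2 + k3" and det: "K2 1 1 * K2 2 2 - K2 1 2 * K2 2 1 = k2 * k3"
    and k: "k2 \<noteq> k3" "k2 * k3 \<noteq> 0"
  shows "eventually (\<lambda>s. detI (cfgsH N) (gram N \<eta> (ray s) (Khat K2)) \<noteq> 0) at_top"
proof (rule detI_scaled_eventually[OF finite_cfgsH])
  have "det3 (\<lambda>i j. ptr K2 (i + j)) \<noteq> 0"
    unfolding det3_ptr[OF tr det] using k by simp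
  then obtain r where "\<And>i k. i < 3 \<Longrightarrow> k < 3 \<Longrightarrow> (\<Sum>j<3. ptr K2 (i + j) * r j k) = (if i = k then 1 else 0)"
    using det3_inverse by blast
  then show "detI (cfgsH N) (\<lambda>h h'. \<Prod>n\<in>{1..N}. ptr K2 (h n + h' n)) \<noteq> 0" by (rule detI_tensor)
next
  fix h h' assume hh: "h \<in> cfgsH N" "h' \<in> cfgsH N"
  let ?q = "\<lambda>s::real. 1 / of_real s ^ (N - 1) :: complex"
  let ?A = "\<lambda>s n. transfer N \<eta> (ray s) (Khat K2) (ray s n)" and ?hh = "\<lambda>m. h m + h' m"
  have dl: "dl a b = (\<Prod>m\<in>{1..N}. if b m = a m then 1 else 0)" if "a \<in> cfgsH N" "b \<in> cfgsH N" for a b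
    unfolding prod_delta[OF that(2,1)] dl_def by simp
  have "((\<lambda>s. \<Sum>a\<in>cfgsH N. ?q s ^ (\<Sum>m\<in>{1..N}. ?hh m) * covq N (?A s) (dl a) ?hh N a) \<longlongrightarrow>
     (\<Sum>a\<in>cfgsH N. (\<Prod>m\<in>{1..N}. (\<eta> * gap N m) ^ ?hh m) * (\<Prod>m\<in>{1..N}. rp K2 (\<lambda>l. if l = a m then 1 else 0) (?hh m) (a m)))) at_top"
    by (intro tendsto_sum tendsto_covq_scaled) (auto simp: dl)
  \<comment> \<open>The scale depends on the sum of the exponents and therefore splits into a row
    factor for \<open>h\<close> and a column factor for \<open>h'\<close>.\<close>
  also have "(\<lambda>s. \<Sum>a\<in>cfgsH N. ?q s ^ (\<Sum>m\<in>{1..N}. ?hh m) * covq N (?A s) (dl a) ?hh N a) =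
     (\<lambda>s. ?q s ^ (\<Sum>m\<in>{1..N}. h m) * gram N \<eta> (ray s) (Khat K2) h h' * ?q s ^ (\<Sum>m\<in>{1..N}. h' m))"
    by (rule ext) (simp only: gram_def sum.distrib power_add sum_distrib_left[symmetric] mult.assoc, simp only: mult_ac)
  also have "(\<Sum>a\<in>cfgsH N. (\<Prod>m\<in>{1..N}. (\<eta> * gap N m) ^ ?hh m) * (\<Prod>m\<in>{1..N}. rp K2 (\<lambda>l. if l = a m then 1 else 0) (?hh m) (a m))) =
     (\<Prod>m\<in>{1..N}. (\<eta> * gap N m) ^ ?hh m) * (\<Prod>m\<in>{1..N}. ptr K2 (?hh m))"
    unfolding sum_distrib_left[symmetric] ptr_def
    by (rule arg_cong2[where f = times, OF refl]) (rule sum_cfgsH_prod[where N = N and f = "\<lambda>m i. rp K2 (\<lambda>l. if l = i then 1 else 0) (?hh m) i"])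
  also have "\<dots> = (\<Prod>m\<in>{1..N}. (\<eta> * gap N m) ^ h m) * (\<Prod>n\<in>{1..N}. ptr K2 (h n + h' n)) * (\<Prod>m\<in>{1..N}. (\<eta> * gap N m) ^ h' m)"
    by (simp add: power_add prod.distrib mult_ac)
  finally show "((\<lambda>s. ?q s ^ (\<Sum>m\<in>{1..N}. h m) * gram N \<eta> (ray s) (Khat K2) h h' * ?q s ^ (\<Sum>m\<in>{1..N}. h' m)) \<longlongrightarrow>
     (\<Prod>m\<in>{1..N}. (\<eta> * gap N m) ^ h m) * (\<Prod>n\<in>{1..N}. ptr K2 (h n + h' n)) * (\<Prod>m\<in>{1..N}. (\<eta> * gap N m) ^ h' m)) at_top" .
qed (use eta gap_nz in auto)

lemma polyfun_gram: "polyfun {1..N} (\<lambda>\<xi>. gram N \<eta> \<xi> K h h')"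
  unfolding gram_def
  by (intro polyfun_sum finite_cfgsH polyfun_covq polyfun.pconst polyfun_transfer) auto

subsection \<open>Eigenvectors and diagonalizability\<close>

lemma sc_inj: "sc a = sc b \<longleftrightarrow> a = b"
proof
  assume "sc a = sc b"
  then have "app (sc a) (\<lambda>_. 1) (\<lambda>_. 0) = app (sc b) (\<lambda>_. 1) (\<lambda>_. 0)" by simp
  then show "a = b" by (simp add: sc.rep_eq)
qed simp

lemma sc_power: "sc (a ^ n) = sc a ^ n"
  by (induction n) (simp_all add: sc_mult)

section \<open>Annihilating polynomials of one operator\<close>

definition pev :: "lop \<Rightarrow> complex poly \<Rightarrow> lop" where
  "pev Z p = (\<Sum>i\<le>degree p. sc (coeff p i) * Z ^ i)"

lemma pev_bound: assumes "degree p \<le> n" shows "pev Z p = (\<Sum>i\<le>n. sc (coeff p i) * Z ^ i)"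
  unfolding pev_def by (rule sum.mono_neutral_left) (use assms in \<open>auto simp: coeff_eq_0\<close>)

lemma pev_add: "pev Z (p + q) = pev Z p + pev Z q"
proof -
  let ?n = "max (degree p) (degree q)"
  show ?thesis
    by (simp add: pev_bound[of _ ?n] degree_add_le_max sc_add distrib_right sum.distrib)
qed

lemma pev_smult: "pev Z (Polynomial.smult c p) = sc c * pev Z p"
  by (subst pev_bound[of _ "degree p"]) (simp_all add: degree_smult_le pev_def sum_distrib_left sc_sc)

lemma pev_pCons_0: "pev Z (pCons 0 p) = Z * pev Z p"
proof -
  have "pev Z (pCons 0 p) = (\<Sum>i\<le>Suc (degree p). sc (coeff (pCons 0 p) i) * Z ^ i)"
    by (rule pev_bound) (rule degree_pCons_le)
  also have "\<dots> = (\<Sum>i\<le>degree p. sc (coeff p i) * (Z * Z ^ i))"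
    by (subst sum.atMost_Suc_shift) simp
  finally show ?thesis by (simp add: pev_def sum_distrib_left sc_left_comm[of Z])
qed

definition fac :: "lop \<Rightarrow> complex list \<Rightarrow> lop" where
  "fac Z es = prod_list (map (\<lambda>e. Z - sc e) es)"

lemma fac_simps: "fac Z [] = 1" "fac Z (e # es) = (Z - sc e) * fac Z es"
  by (simp_all add: fac_def)

lemma pev_fac: "pev Z (\<Prod>a\<leftarrow>es. [:- a, 1:]) = fac Z es"
proof (induction es)
  case Nil
  show ?case by (simp add: pev_def fac_simps)
next
  case (Cons e es)
  let ?q = "\<Prod>a\<leftarrow>es. [:- a, 1:]"
  have "[:- e, 1:] * ?q = Polynomial.smult (- e) ?q + pCons 0 ?q" by simp
  then have "pev Z ([:- e, 1:] * ?q) = sc (- e) * pev Z ?q + Z * pev Z ?q"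
    by (simp only: pev_add pev_smult pev_pCons_0)
  then show ?case using Cons by (simp add: fac_simps sc_minus algebra_simps)
qed

lemma fac_move: "fac Z (xs @ y # zs) = (Z - sc y) * fac Z (xs @ zs)"
proof (induction xs)
  case (Cons x xs)
  have "(Z - sc x) * (Z - sc y) = (Z - sc y) * (Z - sc x)"
    by (simp add: algebra_simps sc_comm[of Z]) (metis add.commute mult.commute sc_mult)
  then show ?case using Cons by (simp add: fac_simps) (metis mult.assoc)
qed (simp add: fac_simps)

text \<open>All powers of \<open>Z\<close> lie in the span of finitely many elements, so finitely
  many of them are dependent; the resulting polynomial splits into linear factors over the complex
  numbers.\<close>

lemma annihilator:
  assumes Z: "\<And>j. Z ^ j = (\<Sum>h\<in>V. sc (L j h) * U h)" and V: "finite V"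
  shows "\<exists>es. fac Z es = 0"
proof -
  obtain c k where c: "k \<le> card V" "c k \<noteq> 0" "\<And>h. h \<in> V \<Longrightarrow> (\<Sum>j\<le>card V. L j h * c j) = 0"
    using linear_dependence[OF V, of "\<lambda>h j. L j h"] by blast
  define p where "p = (\<Sum>j\<le>card V. monom (c j) j)"
  have cp: "coeff p i = (if i \<le> card V then c i else 0)" for i
    by (simp add: p_def coeff_sum sum.delta)
  have "degree p \<le> card V" by (rule degree_le) (simp add: cp)
  then have "pev Z p = (\<Sum>j\<le>card V. sc (c j) * Z ^ j)"
    by (subst pev_bound) (auto simp: cp)
  also have "\<dots> = (\<Sum>j\<le>card V. \<Sum>h\<in>V. sc (L j h * c j) * U h)"
    by (simp add: Z sum_distrib_left sc_sc mult.commute)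
  also have "\<dots> = (\<Sum>h\<in>V. sc (\<Sum>j\<le>card V. L j h * c j) * U h)"
    by (subst sum.swap) (simp add: sc_sum sum_distrib_right)
  also have "\<dots> = 0" by (simp add: c(3))
  finally have p0: "pev Z p = 0" .
  have "p \<noteq> 0" using c(1,2) cp[of k] by auto
  obtain as where as: "Polynomial.smult (coeff p (degree p)) (\<Prod>a\<leftarrow>as. [:- a, 1:]) = p"
    using fundamental_theorem_algebra_factorized[of p] by blast
  have "sc (coeff p (degree p)) * fac Z as = 0"
    using p0 by (subst (asm) as[symmetric]) (simp only: pev_smult pev_fac)
  then show ?thesis using \<open>p \<noteq> 0\<close> by (subst (asm) sc_eq_0) auto
qed

text \<open>If a root is repeated, drop one copy of it. The square of the shorter product contains
  the original product as a factor and is 0, so by \<open>red\<close> the shorter product is 0 as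
  well.\<close>

lemma squarefree_annihilator:
  assumes "fac Z es = 0" and red: "\<And>es. fac Z es * fac Z es = 0 \<Longrightarrow> fac Z es = 0"
  shows "\<exists>ds. distinct ds \<and> fac Z ds = 0"
  using assms(1)
proof (induction es rule: length_induct)
  case (1 es)
  show ?case
  proof (cases "distinct es")
    case False
    then obtain xs ys zs y where es: "es = xs @ [y] @ ys @ [y] @ zs"
      using not_distinct_decomp by blast
    let ?r = "xs @ ys @ zs"
    have f: "fac Z es = (Z - sc y) * fac Z (y # ?r)"
      using fac_move[of Z xs y "ys @ y # zs"] fac_move[of Z "xs @ ys" y zs] by (simp add: es fac_simps)
    have "fac Z (y # ?r) * fac Z (y # ?r) = fac Z ((y # ?r) @ (y # ?r))"
      by (simp add: fac_def mult.assoc)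
    also have "\<dots> = fac Z es * fac Z ?r"
    proof -
      have "fac Z ((y # ?r) @ (y # ?r)) = (Z - sc y) * fac Z ((y # ?r) @ ?r)" by (rule fac_move)
      also have "fac Z ((y # ?r) @ ?r) = fac Z (y # ?r) * fac Z ?r" by (simp add: fac_def mult.assoc)
      finally show ?thesis by (simp add: f mult.assoc)
    qed
    finally have "fac Z (y # ?r) = 0" using 1(2) by (intro red) simp
    then show ?thesis using 1(1) es by (auto dest!: spec[of _ "y # ?r"])
  qed (use 1 in auto)
qed

context twisted_chain
begin

abbreviation "TT \<equiv> transfer N \<eta> \<xi> (Khat K2)"
abbreviation "A \<equiv> alg N X"

lemma app_t_transfer: "b \<in> C \<Longrightarrow> app (t X l) v b = (\<Sum>a\<in>C. TT l b a * v a)"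
  by (simp add: app_t app_T_transfer)

lemma app_X_transfer: "n \<in> {1..N} \<Longrightarrow> b \<in> C \<Longrightarrow> app (X n) v b = (\<Sum>a\<in>C. TT (\<xi> n) b a * v a)"
  using app_t_transfer[of b "\<xi> n" v] by (simp add: t_node)

text \<open>This lets the algebra act on functions on \<open>C\<close>, a space of finite dimension,
  although its elements are operators on functions of all configurations.\<close>

lemma alg_local:
  assumes "Z \<in> A" "\<forall>b\<in>C. v b = v' b" shows "\<forall>b\<in>C. app Z v b = app Z v' b"
  using assms
proof (induction arbitrary: v v')
  case (alg_X a)
  then show ?case by (simp add: app_X_transfer cong: sum.cong)
next
  case (alg_mult Y Z)
  then show ?case by (simp add: app_ring)
next
  case (alg_add Y Z)
  then have "\<forall>b\<in>C. app Y v b = app Y v' b" "\<forall>b\<in>C. app Z v b = app Z v' b" by blast+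
  then show ?case by (simp add: app_ring)
qed (simp add: app_ring)

lemma alg_expand: assumes "Z \<in> A" "b \<in> C" shows "app Z v b = (\<Sum>a\<in>C. app Z (dl a) b * v a)"
proof -
  let ?v = "\<lambda>b. \<Sum>a\<in>C. v a * dl a b"
  have "v b = ?v b" if "b \<in> C" for b
  proof -
    have "?v b = (\<Sum>a\<in>C. if a = b then v b else 0)" by (intro sum.cong) (auto simp: dl_def)
    then show ?thesis using that finite_cfgsH by simp
  qed
  then have "\<forall>b\<in>C. app Z v b = app Z ?v b" by (intro alg_local[OF assms(1)]) blast
  then have "app Z v b = app Z ?v b" using assms(2) by blast
  also have "\<dots> = (\<Sum>a\<in>C. v a * app Z (dl a) b)" by (simp only: app_sum app_scale)
  finally show ?thesis by (simp only: mult.commute)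
qed

definition ph :: "(cfg \<Rightarrow> complex) \<Rightarrow> lop \<Rightarrow> (cfg \<Rightarrow> complex) \<Rightarrow> complex" where
  "ph S Z v = (\<Sum>b\<in>C. S b * app Z v b)"

lemma ph_expand: assumes "Z \<in> A" shows "ph S Z v = (\<Sum>a\<in>C. ph S Z (dl a) * v a)"
proof -
  have "ph S Z v = (\<Sum>b\<in>C. \<Sum>a\<in>C. S b * app Z (dl a) b * v a)"
    unfolding ph_def by (intro sum.cong refl) (subst alg_expand[OF assms], simp_all add: sum_distrib_left mult.assoc)
  also have "\<dots> = (\<Sum>a\<in>C. ph S Z (dl a) * v a)"
    by (subst sum.swap) (simp add: ph_def sum_distrib_right)
  finally show ?thesis .
qed

lemma ph_sum: "ph S (\<Sum>k\<in>V. sc (L k) * F k) v = (\<Sum>k\<in>V. L k * ph S (F k) v)"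
proof -
  have "ph S (\<Sum>k\<in>V. sc (L k) * F k) v = (\<Sum>b\<in>C. \<Sum>k\<in>V. L k * (S b * app (F k) v b))"
    by (simp add: ph_def app_sum_lop app_ring sum_distrib_left mult_ac)
  also have "\<dots> = (\<Sum>k\<in>V. L k * ph S (F k) v)"
    by (subst sum.swap) (simp add: ph_def sum_distrib_left)
  finally show ?thesis .
qed

lemma rpow_pairing:
  assumes n: "n \<in> {1..N}"
  shows "(\<Sum>a\<in>C. rpow N s (TT (\<xi> n)) m a * v a) = (\<Sum>b\<in>C. s b * app (X n ^ m) v b)"
proof (induction m arbitrary: v)
  case (Suc m)
  have "(\<Sum>a\<in>C. rpow N s (TT (\<xi> n)) (Suc m) a * v a) =
      (\<Sum>a\<in>C. \<Sum>b\<in>C. rpow N s (TT (\<xi> n)) m b * (TT (\<xi> n) b a * v a))"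
    by (simp add: sum_distrib_right mult.assoc)
  also have "\<dots> = (\<Sum>b\<in>C. rpow N s (TT (\<xi> n)) m b * app (X n) v b)"
    by (subst sum.swap) (simp add: app_X_transfer[OF n] sum_distrib_left)
  also have "\<dots> = (\<Sum>b\<in>C. s b * app (X n ^ m) (app (X n) v) b)" by (rule Suc)
  finally show ?case by (simp only: power_Suc2 times_lop.rep_eq)
qed (simp add: app_ring)

lemma covq_pairing:
  assumes "k \<le> N"
  shows "(\<Sum>a\<in>C. covq N (\<lambda>n. TT (\<xi> n)) S h k a * v a) = ph S (w X h k) v"
  using assms
proof (induction k arbitrary: v)
  case (Suc k)
  then show ?case by (simp add: rpow_pairing ph_def app_ring)
qed (simp add: ph_def app_ring)

lemma sov_pairing: "pairing N (sov_covec N TT \<xi> S h) v = ph S (w X h N) v"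
  unfolding pairing_def sov_covec_def covp_covq by (rule covq_pairing) simp

lemma sov_entry: assumes "a \<in> C" shows "sov_covec N TT \<xi> S h a = ph S (w X h N) (dl a)"
proof -
  have "(\<Sum>b\<in>C. sov_covec N TT \<xi> S h b * dl a b) = (\<Sum>b\<in>C. if b = a then sov_covec N TT \<xi> S h a else 0)"
    by (intro sum.cong) (auto simp: dl_def)
  then show ?thesis
    using assms finite_cfgsH by (simp add: pairing_def flip: sov_pairing)
qed

lemma w_U: "\<exists>Lw. \<forall>h. \<forall>Z. sl Z \<longrightarrow> w Z h N = (\<Sum>k\<in>C. sc (Lw h k) * U Z k)"
  using spn_w[OF order_refl] unfolding spn_def by metis

lemma t_U: "\<exists>L. \<forall>Z. sl Z \<longrightarrow> t Z l * U Z k = (\<Sum>k'\<in>C. sc (L k') * U Z k')" if "k \<in> C"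
  using spn_t_U[OF that, of l] unfolding spn_def .

text \<open>The powers are combinations of the products \<open>U\<close>, so their determinant is
  that of the transition matrix times the one in question.\<close>

lemma detI_sov_U:
  assumes "detI C (sov_covec N TT \<xi> S) \<noteq> 0"
  shows "detI C (\<lambda>k a. ph S (U X k) (dl a)) \<noteq> 0"
proof -
  obtain Lw where Lw: "\<And>h. w X h N = (\<Sum>k\<in>C. sc (Lw h k) * U X k)" using w_U sol_X by metis
  have "detI C (sov_covec N TT \<xi> S) = detI C (\<lambda>h a. \<Sum>k\<in>C. Lw h k * ph S (U X k) (dl a))"
    by (rule detI_cong[OF finite_cfgsH]) (simp add: sov_entry Lw ph_sum)
  then show ?thesis using assms by (auto simp: detI_mult[OF finite_cfgsH])
qed

lemma sol_scalar:
  assumes x: "x \<in> solset N \<eta> \<xi> k2 k3"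
  shows "sl (\<lambda>a. sc (x a))" "t (\<lambda>a. sc (x a)) l = sc (tfun N \<eta> \<xi> k2 k3 x l)"
proof -
  show t: "t (\<lambda>a. sc (x a)) l = sc (tfun N \<eta> \<xi> k2 k3 x l)" for l
    by (simp add: tX_def tfun_def fcoef_1 sc_add sc_sum sc_mult)
  have "sc (x a) * (sc (k2 * k3 * d (\<xi> a + \<eta>)) + (\<Sum>r\<in>{1..N}. sc (fcoef N \<eta> \<xi> 2 r (\<xi> a + \<eta>)) *
      (t (\<lambda>a. sc (x a)) (\<xi> r + \<eta>) * sc (x r)))) = 0" if "a \<in> {1..N}" for a
  proof -
    have eq: "x a * (k2 * k3 * d (\<xi> a + \<eta>) + (\<Sum>r\<in>{1..N}. fcoef N \<eta> \<xi> 2 r (\<xi> a + \<eta>) *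
        tfun N \<eta> \<xi> k2 k3 x (\<xi> r + \<eta>) * x r)) = 0"
      using x that by (auto simp: solset_def)
    have "sc (x a * (k2 * k3 * d (\<xi> a + \<eta>) + (\<Sum>r\<in>{1..N}. fcoef N \<eta> \<xi> 2 r (\<xi> a + \<eta>) *
        tfun N \<eta> \<xi> k2 k3 x (\<xi> r + \<eta>) * x r))) = 0"
      by (simp only: eq sc_0)
    then show ?thesis by (simp only: t sc_mult sc_add sc_sum mult.assoc)
  qed
  moreover have "sc (x a) * sc (x b) = sc (x b) * sc (x a)" for a b by (rule sc_comm)
  ultimately show "sl (\<lambda>a. sc (x a))" unfolding sol_def by blast
qed

lemma U_scalar: "\<exists>y. U (\<lambda>a. sc (x a)) h = sc y"
proof -
  have t: "\<exists>y. t (\<lambda>a. sc (x a)) l = sc y" for l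
    by (rule exI[of _ "tfun N \<eta> \<xi> k2 k3 x l"]) (simp add: tX_def tfun_def fcoef_1 sc_add sc_sum sc_mult)
  have g: "\<exists>y. g (\<lambda>a. sc (x a)) n i = sc y" for n i
  proof -
    obtain y where y: "t (\<lambda>a. sc (x a)) (\<xi> n + \<eta>) = sc y" using t by blast
    have "Y (\<lambda>a. sc (x a)) n = sc (1 / d (\<xi> n + \<eta>) * (y * x n))" by (simp only: Y_def sc_mult y)
    then show ?thesis unfolding g_def by (metis sc_1)
  qed
  have "\<exists>y. u (\<lambda>a. sc (x a)) h k = sc y" for k
  proof (induction k)
    case (Suc k)
    then obtain y y' where "u (\<lambda>a. sc (x a)) h k = sc y" "g (\<lambda>a. sc (x a)) (Suc k) (h (Suc k)) = sc y'"
      using g by blast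
    then show ?case by (intro exI[of _ "y * y'"]) (simp add: sc_mult)
  qed (metis u.simps(1) sc_1)
  then show ?thesis .
qed

lemma w_scalar: "w (\<lambda>a. sc (x a)) h k = sc (\<Prod>m\<in>{1..k}. x m ^ h m)"
  by (induction k) (simp_all add: sc_mult sc_power)

lemma tfun_node: assumes "n \<in> {1..N}" "x \<in> solset N \<eta> \<xi> k2 k3" shows "tfun N \<eta> \<xi> k2 k3 x (\<xi> n) = x n"
proof -
  have "sc (tfun N \<eta> \<xi> k2 k3 x (\<xi> n)) = sc (x n)"
    using sol_scalar(2)[OF assms(2), of "\<xi> n"] t_node[OF assms(1), of "\<lambda>a. sc (x a)"] by simp
  then show ?thesis by (simp add: sc_inj)
qed

lemma joint_eigvec_iff: "joint_eigvec N TT \<tau> v \<longleftrightarrow> (\<exists>a\<in>C. v a \<noteq> 0) \<and> (\<forall>l. \<forall>b\<in>C. app (t X l) v b = \<tau> l * v b)"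
  by (simp add: joint_eigvec_def app_t_transfer)

text \<open>The vector is defined by its pairings with the covectors \<open>S U(k)\<close>; since multiplication by
  \<open>t(\<lambda>)\<close> acts on the \<open>U(k)\<close> by the same matrix for operators and for scalar solutions, it is an
  eigenvector.\<close>
lemma solution_eigenvector:
  assumes nz: "detI C (sov_covec N TT \<xi> S) \<noteq> 0" and x: "x \<in> solset N \<eta> \<xi> k2 k3"
  shows "\<exists>v. joint_eigvec N TT (tfun N \<eta> \<xi> k2 k3 x) v \<and>
     (\<forall>h. pairing N (sov_covec N TT \<xi> S h) v = (\<Prod>n\<in>{1..N}. x n ^ h n))"
proof -
  let ?x = "\<lambda>a. sc (x a)" and ?\<tau> = "tfun N \<eta> \<xi> k2 k3 x"
  note nzU = detI_sov_U[OF nz]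
  obtain y where y: "\<And>k. U ?x k = sc (y k)" using U_scalar by metis
  obtain v where v: "\<And>k. k \<in> C \<Longrightarrow> (\<Sum>a\<in>C. ph S (U X k) (dl a) * v a) = y k"
    using detI_solve[OF finite_cfgsH nzU] by blast
  have phv: "ph S (U X k) v = y k" if "k \<in> C" for k
    using v[OF that] ph_expand[OF u_alg[OF order_refl], of S k v] by simp
  have eig: "app (t X l) v b = ?\<tau> l * v b" if b: "b \<in> C" for l b
  proof -
    define e where "e b = app (t X l) v b - ?\<tau> l * v b" for b
    have "(\<Sum>a\<in>C. ph S (U X k) (dl a) * e a) = 0" if k: "k \<in> C" for k
    proof -
      obtain L where L: "\<And>Z. sl Z \<Longrightarrow> t Z l * U Z k = (\<Sum>k'\<in>C. sc (L k') * U Z k')"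
        using t_U[OF k, of l] by blast
      have "ph S (U X k) (app (t X l) v) = ph S (t X l * U X k) v"
        using sol_comm[OF sol_X t_alg u_alg[OF order_refl], of l k] by (simp add: ph_def app_ring)
      also have "\<dots> = (\<Sum>k'\<in>C. L k' * y k')"
        by (simp add: L[OF sol_X] ph_sum phv)
      also have "\<dots> = ?\<tau> l * y k"
      proof -
        have "sc (?\<tau> l * y k) = sc (\<Sum>k'\<in>C. L k' * y k')"
          using L[OF sol_scalar(1)[OF x]] by (simp add: sol_scalar(2)[OF x] y sc_mult sc_sum)
        then show ?thesis by (simp add: sc_inj)
      qed
      finally have 1: "ph S (U X k) (app (t X l) v) = ?\<tau> l * ph S (U X k) v" by (simp add: phv[OF k])
      have "(\<Sum>a\<in>C. ph S (U X k) (dl a) * e a) =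
         (\<Sum>a\<in>C. ph S (U X k) (dl a) * app (t X l) v a) - ?\<tau> l * (\<Sum>a\<in>C. ph S (U X k) (dl a) * v a)"
        by (simp add: e_def algebra_simps sum_subtractf sum_distrib_left)
      also have "\<dots> = 0"
      proof -
        have e: "(\<Sum>a\<in>C. ph S (U X k) (dl a) * z a) = ph S (U X k) z" for z
          by (rule ph_expand[symmetric]) (rule u_alg, simp)
        show ?thesis unfolding e 1 by simp
      qed
      finally show ?thesis .
    qed
    then have "e b = 0" by (rule detI_kernel[OF finite_cfgsH nzU _ b])
    then show ?thesis by (simp add: e_def)
  qed
  have "\<exists>a\<in>C. v a \<noteq> 0"
  proof (rule ccontr)
    assume "\<not> ?thesis"
    then have "ph S (U X (\<lambda>_. 0)) v = 0" by (simp add: U_0 ph_def app_ring)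
    moreover have "(\<lambda>_. 0) \<in> C" by (simp add: cfgsH_def)
    ultimately have "y (\<lambda>_. 0) = 0" using phv by simp
    then show False using y[of "\<lambda>_. 0"] by (simp add: U_0)
  qed
  then have "joint_eigvec N TT ?\<tau> v" using eig by (simp add: joint_eigvec_iff)
  moreover have "pairing N (sov_covec N TT \<xi> S h) v = (\<Prod>n\<in>{1..N}. x n ^ h n)" for h
  proof -
    obtain Lw where Lw: "\<And>Z. sl Z \<Longrightarrow> w Z h N = (\<Sum>k\<in>C. sc (Lw k) * U Z k)"
      using w_U by meson
    have "sc (\<Prod>n\<in>{1..N}. x n ^ h n) = sc (\<Sum>k\<in>C. Lw k * y k)"
      using Lw[OF sol_scalar(1)[OF x]] by (simp add: w_scalar y sc_sum sc_mult)
    then show ?thesis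
      by (simp add: sov_pairing Lw[OF sol_X] ph_sum phv sc_inj)
  qed
  ultimately show ?thesis by blast
qed

section \<open>Joint eigenvectors of the generated algebra\<close>

definition eig :: "lop \<Rightarrow> complex \<Rightarrow> (cfg \<Rightarrow> complex) \<Rightarrow> bool" where
  "eig Z z v \<longleftrightarrow> (\<forall>b\<in>C. app Z v b = z * v b)"

lemma eig_sc: "eig (sc z) z v" by (simp add: eig_def app_ring)
lemma eig_add: "eig W y v \<Longrightarrow> eig Z z v \<Longrightarrow> eig (W + Z) (y + z) v"
  by (simp add: eig_def app_ring distrib_right)
lemma eig_mult: assumes "W \<in> A" "eig W y v" "eig Z z v" shows "eig (W * Z) (y * z) v"
  unfolding eig_def
proof
  fix b assume b: "b \<in> C"
  have "app (W * Z) v b = app W (\<lambda>c. z * v c) b"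
    using alg_local[OF assms(1), of "app Z v" "\<lambda>c. z * v c"] assms(3) b by (simp add: app_ring eig_def)
  then show "app (W * Z) v b = y * z * v b"
    using assms(2) b by (simp add: app_scale eig_def)
qed
lemma eig_sum: "finite V \<Longrightarrow> (\<And>i. i \<in> V \<Longrightarrow> eig (F i) (f i) v) \<Longrightarrow> eig (\<Sum>i\<in>V. F i) (\<Sum>i\<in>V. f i) v"
  by (induction V rule: finite_induct) (use eig_sc[of 0] in \<open>auto intro: eig_add\<close>)

lemma eig_unique: "eig Z z v \<Longrightarrow> eig Z z' v \<Longrightarrow> a \<in> C \<Longrightarrow> v a \<noteq> 0 \<Longrightarrow> z = z'"
  by (auto simp: eig_def)

lemma joint_eigvec_eig: "joint_eigvec N TT \<tau> v \<longleftrightarrow> (\<exists>a\<in>C. v a \<noteq> 0) \<and> (\<forall>l. eig (t X l) (\<tau> l) v)"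
  by (simp add: joint_eigvec_iff eig_def)

lemma eig_tfun:
  assumes "\<And>a. a \<in> {1..N} \<Longrightarrow> eig (X a) (x a) v" shows "eig (t X l) (tfun N \<eta> \<xi> k2 k3 x l) v"
  unfolding tX_def tfun_def fcoef_1[folded One_nat_def]
  by (intro eig_add eig_sc eig_sum eig_mult alg_sc assms) auto

lemma eigenvalue_in_Sigma:
  assumes "joint_eigvec N TT \<tau> v" shows "\<tau> \<in> Sigma_set N \<eta> \<xi> k2 k3"
proof -
  obtain a where a: "a \<in> C" "v a \<noteq> 0" and e: "\<And>l. eig (t X l) (\<tau> l) v"
    using assms by (auto simp: joint_eigvec_eig)
  \<comment> \<open>The value 0 outside \<open>{1..N}\<close> is the normalization built into
    \<open>solset\<close>.\<close>
  define x where "x n = (if n \<in> {1..N} then \<tau> (\<xi> n) else 0)" for n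
  have ex: "eig (X n) (x n) v" if "n \<in> {1..N}" for n
    using e[of "\<xi> n"] that by (simp add: t_node x_def)
  have \<tau>: "\<tau> = tfun N \<eta> \<xi> k2 k3 x"
    using eig_unique[where v = v and a = a, OF e eig_tfun[OF ex] a] by auto
  have "x n * (k2 * k3 * d (\<xi> n + \<eta>) + (\<Sum>r\<in>{1..N}. fcoef N \<eta> \<xi> 2 r (\<xi> n + \<eta>) *
      (tfun N \<eta> \<xi> k2 k3 x (\<xi> r + \<eta>) * x r))) = 0" if n: "n \<in> {1..N}" for n
  proof (rule eig_unique[where v = v and a = a, OF _ _ a])
    show "eig (X n * (sc (k2 * k3 * d (\<xi> n + \<eta>)) + (\<Sum>r\<in>{1..N}. sc (fcoef N \<eta> \<xi> 2 r (\<xi> n + \<eta>)) *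
        (t X (\<xi> r + \<eta>) * X r)))) (x n * (k2 * k3 * d (\<xi> n + \<eta>) + (\<Sum>r\<in>{1..N}. fcoef N \<eta> \<xi> 2 r (\<xi> n + \<eta>) *
        (tfun N \<eta> \<xi> k2 k3 x (\<xi> r + \<eta>) * x r)))) v"
      by (intro eig_mult eig_add eig_sum eig_sc alg_sc alg_X n t_alg ex eig_tfun) auto
    have "X n * (sc (k2 * k3 * d (\<xi> n + \<eta>)) + (\<Sum>r\<in>{1..N}. sc (fcoef N \<eta> \<xi> 2 r (\<xi> n + \<eta>)) *
        (t X (\<xi> r + \<eta>) * X r))) = sc 0"
      using sol_X n by (auto simp: sol_def)
    then show "eig (X n * (sc (k2 * k3 * d (\<xi> n + \<eta>)) + (\<Sum>r\<in>{1..N}. sc (fcoef N \<eta> \<xi> 2 r (\<xi> n + \<eta>)) *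
        (t X (\<xi> r + \<eta>) * X r)))) 0 v"
      using eig_sc[of 0 v] by simp
  qed
  then have "x \<in> solset N \<eta> \<xi> k2 k3"
    unfolding solset_def by (auto simp: x_def mult.assoc)
  then show ?thesis unfolding Sigma_set_def \<tau> by blast
qed

lemma eig_w:
  assumes "\<And>l. eig (t X l) (\<tau> l) v" "k \<le> N"
  shows "eig (w X h k) (\<Prod>n\<in>{1..k}. \<tau> (\<xi> n) ^ h n) v"
  using assms(2)
proof (induction k)
  case 0
  show ?case using eig_sc[of 1 v] by simp
next
  case (Suc k)
  have "eig (X (Suc k)) (\<tau> (\<xi> (Suc k))) v" using assms(1)[of "\<xi> (Suc k)"] Suc.prems by (simp add: t_node)
  then have "eig (X (Suc k) ^ m) (\<tau> (\<xi> (Suc k)) ^ m) v" for m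
    using eig_sc[of 1 v] Suc.prems by (induction m) (auto intro!: eig_mult alg_X)
  then show ?case using Suc by (auto intro!: eig_mult w_alg)
qed

text \<open>On a joint eigenvector the covector with exponents \<open>h\<close> equals
  \<open>S\<close> times a number depending only on \<tau>. As the covectors form a basis, the
  vector is determined by the single number \<open>s v\<close>, which therefore cannot
  vanish.\<close>

lemma simple_spectrum:
  assumes nz: "detI C (sov_covec N TT \<xi> S) \<noteq> 0"
    and v: "joint_eigvec N TT \<tau> v" and v': "joint_eigvec N TT \<tau> v'"
  shows "\<exists>c. \<forall>b\<in>C. v' b = c * v b"
proof -
  define s where "s v = (\<Sum>b\<in>C. S b * v b)" for v
  have pr: "(\<Sum>a\<in>C. sov_covec N TT \<xi> S h a * v a) = (\<Prod>n\<in>{1..N}. \<tau> (\<xi> n) ^ h n) * s v"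
    if "joint_eigvec N TT \<tau> v" for v h
  proof -
    have "eig (w X h N) (\<Prod>n\<in>{1..N}. \<tau> (\<xi> n) ^ h n) v"
      using that by (intro eig_w) (auto simp: joint_eigvec_eig)
    then have "ph S (w X h N) v = (\<Prod>n\<in>{1..N}. \<tau> (\<xi> n) ^ h n) * s v"
      by (simp add: ph_def eig_def s_def sum_distrib_right mult_ac)
    then show ?thesis by (simp add: sov_pairing[symmetric] pairing_def)
  qed
  have "s v \<noteq> 0"
  proof
    assume "s v = 0"
    then have "v b = 0" if "b \<in> C" for b
      using detI_kernel[OF finite_cfgsH nz _ that, of v] pr[OF v] by simp
    then show False using v by (auto simp: joint_eigvec_eig)
  qed
  have "v' b - s v' / s v * v b = 0" if b: "b \<in> C" for b
  proof (rule detI_kernel[OF finite_cfgsH nz _ b, where v = "\<lambda>b. v' b - s v' / s v * v b"])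
    fix h
    have "(\<Sum>a\<in>C. sov_covec N TT \<xi> S h a * (v' a - s v' / s v * v a)) =
       (\<Sum>a\<in>C. sov_covec N TT \<xi> S h a * v' a) - s v' / s v * (\<Sum>a\<in>C. sov_covec N TT \<xi> S h a * v a)"
      by (simp add: algebra_simps sum_subtractf sum_distrib_left)
    also have "\<dots> = 0" using \<open>s v \<noteq> 0\<close> by (simp add: pr[OF v] pr[OF v'])
    finally show "(\<Sum>a\<in>C. sov_covec N TT \<xi> S h a * (v' a - s v' / s v * v a)) = 0" .
  qed
  then show ?thesis by (intro exI[of _ "s v' / s v"]) auto
qed

section \<open>The trace form and the absence of nilpotents\<close>

definition trc :: "lop \<Rightarrow> complex" where "trc Z = (\<Sum>a\<in>C. app Z (dl a) a)"

lemma w_add: assumes "k \<le> N" shows "w X (\<lambda>m. h m + h' m) k = w X h k * w X h' k"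
  using assms
proof (induction k)
  case (Suc k)
  let ?x = "X (Suc k)"
  have "?x ^ h (Suc k) * w X h' k = w X h' k * ?x ^ h (Suc k)"
    using Suc.prems by (intro sol_comm[OF sol_X] alg_power alg_X w_alg) auto
  then have "w X h' k * (?x ^ h (Suc k) * Z) = ?x ^ h (Suc k) * (w X h' k * Z)" for Z
    by (simp flip: mult.assoc)
  then show ?case using Suc by (simp add: power_add mult.assoc)
qed simp

lemma gram_trc: "gram N \<eta> \<xi> (Khat K2) h h' = trc (w X h N * w X h' N)"
proof -
  have "covq N (\<lambda>n. TT (\<xi> n)) (dl a) (\<lambda>m. h m + h' m) N a = app (w X h N * w X h' N) (dl a) a" if a: "a \<in> C" for a
  proof -
    have d: "(\<Sum>b\<in>C. f b * dl a b) = f a" "(\<Sum>b\<in>C. dl a b * f b) = f a" for f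
      using a finite_cfgsH by (simp_all add: dl_def if_distrib if_distribR cong: if_cong)
    have "covq N (\<lambda>n. TT (\<xi> n)) (dl a) (\<lambda>m. h m + h' m) N a = ph (dl a) (w X (\<lambda>m. h m + h' m) N) (dl a)"
      using covq_pairing[OF order_refl, of "dl a" "\<lambda>m. h m + h' m" "dl a"] by (simp add: d)
    then show ?thesis by (simp add: ph_def d w_add)
  qed
  then show ?thesis by (simp add: gram_def trc_def)
qed

lemma trc_square_zero:
  assumes Z: "Z \<in> A" "Z * Z = 0" shows "trc Z = 0"
  unfolding trc_def
proof (rule trace_square_zero[OF finite_cfgsH, where A = "\<lambda>b a. app Z (dl a) b"])
  fix i k assume ik: "i \<in> C" "k \<in> C"
  have "(\<Sum>j\<in>C. app Z (dl j) i * app Z (dl k) j) = app Z (app Z (dl k)) i"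
    by (rule alg_expand[OF Z(1) ik(1), symmetric])
  also have "\<dots> = app (Z * Z) (dl k) i" by (simp only: times_lop.rep_eq)
  finally show "(\<Sum>j\<in>C. app Z (dl j) i * app Z (dl k) j) = 0" by (simp add: Z(2) app_ring)
qed

lemma trc_sum: "trc ((\<Sum>k\<in>V. sc (L k) * F k) * Z) = (\<Sum>k\<in>V. L k * trc (F k * Z))"
proof -
  have "trc ((\<Sum>k\<in>V. sc (L k) * F k) * Z) = (\<Sum>a\<in>C. \<Sum>k\<in>V. L k * app (F k * Z) (dl a) a)"
    by (simp add: trc_def sum_distrib_right app_sum_lop app_ring)
  also have "\<dots> = (\<Sum>k\<in>V. L k * trc (F k * Z))"
    by (subst sum.swap) (simp add: trc_def sum_distrib_left)
  finally show ?thesis .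
qed

text \<open>By commutativity every multiple of \<open>Z\<close> also squares to 0 and has trace 0.
  Thus \<open>Z\<close> is orthogonal to all products of powers, and nondegeneracy makes all
  coefficients of \<open>Z\<close> with respect to the products \<open>U\<close> vanish.\<close>

lemma alg_reduced:
  assumes nz: "detI C (gram N \<eta> \<xi> (Khat K2)) \<noteq> 0" and Z: "Z \<in> A" "Z * Z = 0"
  shows "Z = 0"
proof -
  obtain Lw where Lw: "\<And>h. w X h N = (\<Sum>k\<in>C. sc (Lw h k) * U X k)" using w_U sol_X by metis
  have "detI C (gram N \<eta> \<xi> (Khat K2)) = detI C (\<lambda>h h'. \<Sum>k\<in>C. Lw h k * trc (U X k * w X h' N))"
    unfolding gram_trc by (rule detI_cong[OF finite_cfgsH]) (subst Lw, simp only: trc_sum)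
  then have nzU: "detI C (\<lambda>k h. trc (U X k * w X h N)) \<noteq> 0"
    using nz by (auto simp: detI_mult[OF finite_cfgsH])
  obtain L where L: "Z = (\<Sum>k\<in>C. sc (L k) * U X k)" using alg_span[OF sol_X Z(1)] by blast
  have "(\<Sum>k\<in>C. L k * trc (U X k * w X h N)) = 0" for h
  proof -
    have wA: "w X h N \<in> A" by (rule w_alg) simp
    have "(Z * w X h N) * (Z * w X h N) = (Z * Z) * (w X h N * w X h N)"
      using sol_comm[OF sol_X Z(1) wA] by (metis mult.assoc)
    then have "trc (Z * w X h N) = 0" using Z wA by (intro trc_square_zero alg_mult) auto
    then show ?thesis unfolding L trc_sum .
  qed
  then have "L k = 0" if "k \<in> C" for k
    using detI_left_kernel[OF finite_cfgsH nzU _ that] by blast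
  then show ?thesis unfolding L by simp
qed

lemma fac_alg: "Z \<in> A \<Longrightarrow> fac Z es \<in> A"
  by (induction es) (auto simp: fac_simps alg_1 diff_conv_add_uminus simp flip: sc_minus intro!: alg_mult alg_add alg_sc)

lemma squarefree_fac:
  assumes nz: "detI C (gram N \<eta> \<xi> (Khat K2)) \<noteq> 0" and Z: "Z \<in> A"
  shows "\<exists>ds. distinct ds \<and> fac Z ds = 0"
proof -
  have "\<forall>j. \<exists>L. Z ^ j = (\<Sum>h\<in>C. sc (L h) * U X h)"
    using alg_span[OF sol_X alg_power[OF Z]] by blast
  then obtain L where "\<And>j. Z ^ j = (\<Sum>h\<in>C. sc (L j h) * U X h)" by metis
  from annihilator[OF this finite_cfgsH] obtain es where "fac Z es = 0" by blast
  from squarefree_annihilator[OF this alg_reduced[OF nz fac_alg[OF Z]]] show ?thesis .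
qed

text \<open>Partial fractions by induction on the list of roots. All components arise from
  \<open>v\<close> by elements of the commutative algebra, so they remain eigenvectors of the
  operators in \<open>V\<close> with the same eigenvalues.\<close>

lemma eigen_split:
  assumes Z: "Z \<in> A" and V: "V \<subseteq> A"
    and "distinct ds" "\<forall>b\<in>C. app (fac Z ds) v b = 0" "\<And>W. W \<in> V \<Longrightarrow> eig W (\<epsilon> W) v"
  shows "\<exists>f. (\<forall>e\<in>set ds. eig Z e (f e) \<and> (\<forall>W\<in>V. eig W (\<epsilon> W) (f e))) \<and>
     (\<forall>b\<in>C. v b = (\<Sum>e\<in>set ds. f e b))"
  using assms(3-)
proof (induction ds arbitrary: v)
  case Nil
  then show ?case by (simp add: fac_simps app_ring)
next
  case (Cons e ds)
  have ZA: "Z - sc e \<in> A" using fac_alg[OF Z, of "[e]"] by (simp add: fac_simps)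
  define y where "y = app (Z - sc e) v"
  have yb: "y b = app Z v b - e * v b" for b by (simp add: y_def app_ring)
  have "fac Z (e # ds) = fac Z ds * (Z - sc e)"
    using sol_comm[OF sol_X ZA fac_alg[OF Z, of ds]] by (simp add: fac_simps)
  then have y0: "\<forall>b\<in>C. app (fac Z ds) y b = 0"
    using Cons.prems(2) by (simp add: y_def app_ring)
  have yW: "eig W (\<epsilon> W) y" if W: "W \<in> V" for W
    unfolding eig_def
  proof
    fix b assume b: "b \<in> C"
    have "app W y b = app (W * (Z - sc e)) v b" by (simp add: y_def app_ring)
    also have "W * (Z - sc e) = (Z - sc e) * W"
      using W V by (intro sol_comm[OF sol_X _ ZA]) auto
    also have "app ((Z - sc e) * W) v b = app (Z - sc e) (\<lambda>c. \<epsilon> W * v c) b"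
      using alg_local[OF ZA, of "app W v" "\<lambda>c. \<epsilon> W * v c"] Cons.prems(3)[OF W] b by (simp add: eig_def times_lop.rep_eq)
    finally show "app W y b = \<epsilon> W * y b" by (simp add: app_scale y_def)
  qed
  obtain g where g: "\<And>e'. e' \<in> set ds \<Longrightarrow> eig Z e' (g e')" "\<And>e' W. e' \<in> set ds \<Longrightarrow> W \<in> V \<Longrightarrow> eig W (\<epsilon> W) (g e')"
      "\<And>b. b \<in> C \<Longrightarrow> y b = (\<Sum>e\<in>set ds. g e b)"
    using Cons.IH[OF _ y0 yW] Cons.prems(1) by auto
  \<comment> \<open>The part of \<open>v\<close> with eigenvalue \<open>e'\<close> is multiplied by
    \<open>e' - e\<close> when \<open>Z - sc e\<close> is applied, so it is recovered from
    \<open>g e'\<close> by division; the remainder of \<open>v\<close> belongs to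
    \<open>e\<close>.\<close>
  define f where "f e' b = (if e' = e then v b - (\<Sum>e''\<in>set ds. inverse (e'' - e) * g e'' b) else inverse (e' - e) * g e' b)" for e' b
  have ne: "e \<notin> set ds" using Cons.prems(1) by simp
  have fds: "f e' = (\<lambda>b. inverse (e' - e) * g e' b)" if "e' \<in> set ds" for e'
    using that ne by (auto simp: f_def fun_eq_iff)
  have fe: "f e = (\<lambda>b. v b - (\<Sum>e''\<in>set ds. inverse (e'' - e) * g e'' b))" by (simp add: f_def fun_eq_iff)
  have 1: "eig Z e' (f e')" "W \<in> V \<Longrightarrow> eig W (\<epsilon> W) (f e')" if "e' \<in> set ds" for e' W
    using g(1,2)[OF that] by (auto simp: fds[OF that] eig_def app_scale)
  have 2: "eig Z e (f e)"
    unfolding eig_def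
  proof
    fix b assume b: "b \<in> C"
    have "app Z (f e) b - e * f e b = y b - (\<Sum>e''\<in>set ds. inverse (e'' - e) * (app Z (g e'') b - e * g e'' b))"
      by (simp only: fe yb app_diff app_sum app_scale) (simp add: algebra_simps sum_distrib_left sum_subtractf)
    also have "(\<Sum>e''\<in>set ds. inverse (e'' - e) * (app Z (g e'') b - e * g e'' b)) = (\<Sum>e''\<in>set ds. g e'' b)"
    proof (intro sum.cong refl)
      fix e'' assume e'': "e'' \<in> set ds"
      then have "e'' - e \<noteq> 0" using ne by auto
      moreover have "app Z (g e'') b - e * g e'' b = (e'' - e) * g e'' b"
        using g(1)[OF e''] b by (simp add: eig_def algebra_simps)
      ultimately show "inverse (e'' - e) * (app Z (g e'') b - e * g e'' b) = g e'' b" by simp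
    qed
    finally show "app Z (f e) b = e * f e b" using g(3)[OF b] by simp
  qed
  have 3: "eig W (\<epsilon> W) (f e)" if W: "W \<in> V" for W
    unfolding eig_def
  proof
    fix b assume b: "b \<in> C"
    have "app W (f e) b = \<epsilon> W * v b - (\<Sum>e''\<in>set ds. inverse (e'' - e) * (\<epsilon> W * g e'' b))"
      using Cons.prems(3)[OF W] g(2)[OF _ W] b
      by (simp add: fe app_diff app_sum app_scale eig_def)
    then show "app W (f e) b = \<epsilon> W * f e b"
      by (simp add: fe algebra_simps sum_distrib_left)
  qed
  have "v b = (\<Sum>e'\<in>set (e # ds). f e' b)" for b
  proof -
    have "(\<Sum>e'\<in>set (e # ds). f e' b) = f e b + (\<Sum>e'\<in>set ds. f e' b)"
      using ne by simp
    also have "(\<Sum>e'\<in>set ds. f e' b) = (\<Sum>e'\<in>set ds. inverse (e' - e) * g e' b)"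
      by (intro sum.cong refl) (simp add: fds)
    finally show ?thesis by (simp add: fe)
  qed
  then show ?case using 1 2 3 by (intro exI[of _ f]) auto
qed

section \<open>Decomposition into joint eigenvectors\<close>

definition dec :: "(cfg \<Rightarrow> complex) \<Rightarrow> bool" where
  "dec v \<longleftrightarrow> (\<exists>F c. finite F \<and> (\<forall>v\<in>F. \<exists>t. joint_eigvec N TT t v) \<and> (\<forall>b\<in>C. v b = (\<Sum>v\<in>F. c v * v b)))"

lemma dec_cong: "dec v \<Longrightarrow> (\<And>b. b \<in> C \<Longrightarrow> v' b = v b) \<Longrightarrow> dec v'"
  unfolding dec_def by metis

lemma dec_0: "dec (\<lambda>_. 0)"
  unfolding dec_def by (rule exI[of _ "{}"]) simp

lemma dec_add: assumes "dec v" "dec v'" shows "dec (\<lambda>b. v b + v' b)"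
proof -
  obtain F c where F: "finite F" "\<forall>v\<in>F. \<exists>t. joint_eigvec N TT t v" "\<And>b. b \<in> C \<Longrightarrow> v b = (\<Sum>v\<in>F. c v * v b)"
    using assms(1) by (auto simp: dec_def)
  obtain F' c' where F': "finite F'" "\<forall>v\<in>F'. \<exists>t. joint_eigvec N TT t v" "\<And>b. b \<in> C \<Longrightarrow> v' b = (\<Sum>v\<in>F'. c' v * v b)"
    using assms(2) by (auto simp: dec_def)
  define e where "e u = (if u \<in> F then c u else 0) + (if u \<in> F' then c' u else 0)" for u
  have "v b + v' b = (\<Sum>u\<in>F \<union> F'. e u * u b)" if b: "b \<in> C" for b
  proof -
    have "(\<Sum>u\<in>F. c u * u b) = (\<Sum>u\<in>F \<union> F'. (if u \<in> F then c u else 0) * u b)"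
      using F(1) F'(1) by (intro sum.mono_neutral_cong_left) auto
    moreover have "(\<Sum>u\<in>F'. c' u * u b) = (\<Sum>u\<in>F \<union> F'. (if u \<in> F' then c' u else 0) * u b)"
      using F(1) F'(1) by (intro sum.mono_neutral_cong_left) auto
    ultimately show ?thesis by (simp add: F(3)[OF b] F'(3)[OF b] e_def distrib_right sum.distrib)
  qed
  then show ?thesis unfolding dec_def using F(1,2) F'(1,2)
    by (intro exI[of _ "F \<union> F'"] exI[of _ e]) auto
qed

lemma dec_sum: "finite V \<Longrightarrow> (\<And>i. i \<in> V \<Longrightarrow> dec (f i)) \<Longrightarrow> dec (\<lambda>b. \<Sum>i\<in>V. f i b)"
  by (induction V rule: finite_induct) (auto intro: dec_0 dec_add)

text \<open>Downward induction on \<open>k\<close>: a joint eigenvector of the first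
  \<open>k\<close> operators is split along the next one. At \<open>k = N\<close> it is an
  eigenvector of the whole algebra; \<open>k = 0\<close> imposes no condition on
  \<open>v\<close>.\<close>

lemma dec_joint:
  assumes nz: "detI C (gram N \<eta> \<xi> (Khat K2)) \<noteq> 0"
    and "k \<le> N" "\<And>a. a \<in> {1..k} \<Longrightarrow> eig (X a) (\<epsilon> a) v"
  shows "dec v"
  using assms(2,3)
proof (induction k arbitrary: \<epsilon> v rule: inc_induct)
  case base
  show ?case
  proof (cases "\<exists>a\<in>C. v a \<noteq> 0")
    case True
    then have "joint_eigvec N TT (tfun N \<eta> \<xi> k2 k3 \<epsilon>) v"
      using base by (auto simp: joint_eigvec_eig intro!: eig_tfun)
    then show ?thesis unfolding dec_def by (intro exI[of _ "{v}"] exI[of _ "\<lambda>_. 1"]) auto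
  next
    case False
    then show ?thesis by (intro dec_cong[OF dec_0]) auto
  qed
next
  case (step k)
  have XA: "X (Suc k) \<in> A" using step.hyps by (intro alg_X) auto
  obtain ds where ds: "distinct ds" "fac (X (Suc k)) ds = 0"
    using squarefree_fac[OF nz XA] by blast
  \<comment> \<open>\<open>eigen_split\<close> labels eigenvalues by operators rather than by
    indices, and different indices may give the same operator, so an eigenvalue is chosen for each
    operator.\<close>
  define ew where "ew W = (SOME z. eig W z v)" for W
  have ew: "eig W (ew W) v" if W: "W \<in> X ` {1..k}" for W
  proof -
    have "\<exists>z. eig W z v" using W step.prems by blast
    then show ?thesis unfolding ew_def by (rule someI_ex)
  qed
  have sub: "X ` {1..k} \<subseteq> A" using step.hyps by (auto intro!: alg_X)
  have f0: "\<forall>b\<in>C. app (fac (X (Suc k)) ds) v b = 0" by (simp add: ds(2) app_ring)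
  obtain f where f: "\<And>e. e \<in> set ds \<Longrightarrow> eig (X (Suc k)) e (f e)"
      "\<And>e W. e \<in> set ds \<Longrightarrow> W \<in> X ` {1..k} \<Longrightarrow> eig W (ew W) (f e)"
      "\<And>b. b \<in> C \<Longrightarrow> v b = (\<Sum>e\<in>set ds. f e b)"
    using eigen_split[OF XA sub ds(1) f0 ew] by blast
  have "dec (f e)" if e: "e \<in> set ds" for e
  proof (rule step.IH)
    fix a assume "a \<in> {1..Suc k}"
    then show "eig (X a) (if a = Suc k then e else ew (X a)) (f e)"
      using f(1)[OF e] f(2)[OF e, of "X a"] by (cases "a = Suc k") auto
  qed
  then have "dec (\<lambda>b. \<Sum>e\<in>set ds. f e b)" by (intro dec_sum) auto
  then show ?case by (rule dec_cong) (simp add: f(3))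
qed

lemma diagonalizable_simple:
  assumes "detI C (gram N \<eta> \<xi> (Khat K2)) \<noteq> 0" "detI C (sov_covec N TT \<xi> S) \<noteq> 0"
  shows "diag_simple N TT"
proof -
  have "dec v" for v
    by (rule dec_joint[OF assms(1), of 0]) auto
  then show ?thesis
    unfolding diag_simple_def using simple_spectrum[OF assms(2)] unfolding dec_def by blast
qed

lemma eigenvalues:
  assumes "detI C (sov_covec N TT \<xi> S) \<noteq> 0" shows "eigvals N TT = Sigma_set N \<eta> \<xi> k2 k3"
proof
  show "eigvals N TT \<subseteq> Sigma_set N \<eta> \<xi> k2 k3"
    using eigenvalue_in_Sigma by (auto simp: eigvals_def)
  show "Sigma_set N \<eta> \<xi> k2 k3 \<subseteq> eigvals N TT"
    using solution_eigenvector[OF assms] by (auto simp: eigvals_def Sigma_set_def)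
qed

lemma separate_basis:
  assumes nz: "detI C (sov_covec N TT \<xi> S) \<noteq> 0"
  shows "(\<forall>a\<in>C. (\<Sum>h\<in>C. c h * sov_covec N TT \<xi> S h a) = 0) \<Longrightarrow> h \<in> C \<Longrightarrow> c h = 0"
    and "\<tau> \<in> Sigma_set N \<eta> \<xi> k2 k3 \<Longrightarrow> \<exists>v. joint_eigvec N TT \<tau> v \<and>
       (\<forall>h\<in>C. pairing N (sov_covec N TT \<xi> S h) v = (\<Prod>n\<in>{1..N}. \<tau> (\<xi> n) ^ h n))"
proof -
  show "(\<forall>a\<in>C. (\<Sum>h\<in>C. c h * sov_covec N TT \<xi> S h a) = 0) \<Longrightarrow> h \<in> C \<Longrightarrow> c h = 0"
    using detI_left_kernel[OF finite_cfgsH nz] by blast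
  assume "\<tau> \<in> Sigma_set N \<eta> \<xi> k2 k3"
  then obtain x where x: "x \<in> solset N \<eta> \<xi> k2 k3" "\<tau> = tfun N \<eta> \<xi> k2 k3 x" by (auto simp: Sigma_set_def)
  have "(\<Prod>n\<in>{1..N}. \<tau> (\<xi> n) ^ h n) = (\<Prod>n\<in>{1..N}. x n ^ h n)" for h
    by (intro prod.cong refl) (simp only: x(2) tfun_node[OF _ x(1)])
  then show "\<exists>v. joint_eigvec N TT \<tau> v \<and>
       (\<forall>h\<in>C. pairing N (sov_covec N TT \<xi> S h) v = (\<Prod>n\<in>{1..N}. \<tau> (\<xi> n) ^ h n))"
    using solution_eigenvector[OF nz x(1)] x(2) by auto
qed

end

theorem mainTheorem7:
  fixes N :: nat and \<eta> k2 k3 :: complex and K2 :: "nat \<Rightarrow> nat \<Rightarrow> complex"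
  assumes "N \<ge> 1" and "\<eta> \<noteq> 0"
    and "\<forall>z. (z - K2 1 1) * (z - K2 2 2) - K2 1 2 * K2 2 1 = (z - k2) * (z - k3)"
    and "k2 \<noteq> k3" and "k2 * k3 \<noteq> 0"
  shows "\<exists>P. polyfun {1..N} P \<and> (\<exists>\<xi>0. P \<xi>0 \<noteq> 0) \<and>
    (\<forall>\<xi>. P \<xi> \<noteq> 0 \<and> nonres N \<eta> \<xi> \<longrightarrow>
      eigvals N (transfer N \<eta> \<xi> (Khat K2)) = Sigma_set N \<eta> \<xi> k2 k3 \<and>
      diag_simple N (transfer N \<eta> \<xi> (Khat K2)) \<and>
      (\<exists>Q. polyfun (cfgsH N) Q \<and> (\<exists>S0. Q S0 \<noteq> 0) \<and>
        (\<forall>S. Q S \<noteq> 0 \<longrightarrow>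
          (\<forall>c. (\<forall>a\<in>cfgsH N. (\<Sum>h\<in>cfgsH N. c h * sov_covec N (transfer N \<eta> \<xi> (Khat K2)) \<xi> S h a) = 0)
               \<longrightarrow> (\<forall>h\<in>cfgsH N. c h = 0)) \<and>
          (\<forall>t\<in>Sigma_set N \<eta> \<xi> k2 k3. \<exists>v. joint_eigvec N (transfer N \<eta> \<xi> (Khat K2)) t v \<and>
             (\<forall>h\<in>cfgsH N. pairing N (sov_covec N (transfer N \<eta> \<xi> (Khat K2)) \<xi> S h) v
                = (\<Prod>n\<in>{1..N}. t (\<xi> n) ^ h n))))))"
proof -
  \<comment> \<open>The hypothesis on the characteristic polynomial is evaluated at 0 and 1.\<close>
  have det: "K2 1 1 * K2 2 2 - K2 1 2 * K2 2 1 = k2 * k3"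
    using spec[OF assms(3), of 0] by simp
  have tr: "K2 1 1 + K2 2 2 = k2 + k3"
  proof -
    have "1 - (K2 1 1 + K2 2 2) + (K2 1 1 * K2 2 2 - K2 1 2 * K2 2 1) = 1 - (k2 + k3) + k2 * k3"
      using spec[OF assms(3), of 1] by (simp add: algebra_simps)
    then have "1 - (K2 1 1 + K2 2 2) = 1 - (k2 + k3)" unfolding det by (simp only: add_right_cancel)
    then show ?thesis by (rule diff_left_imp_eq)
  qed
  let ?T = "\<lambda>\<xi>. transfer N \<eta> \<xi> (Khat K2)"
  have sov: "sov_covec N (?T \<xi>) \<xi> S = (\<lambda>h a. covq N (\<lambda>n. ?T \<xi> (\<xi> n)) S h N a)" for \<xi> S
    by (simp add: sov_covec_def[abs_def] covp_covq fun_eq_iff)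
  obtain s0 where s0: "det3 (rp K2 s0) \<noteq> 0"
    using cyclic_covector[OF tr det assms(4,5)] by blast
  \<comment> \<open>The same cyclic covector at every site. It does not depend on \<xi>, so
    \<open>D \<xi> S0\<close> is a polynomial in \<xi> alone.\<close>
  define S0 :: "cfg \<Rightarrow> complex" where "S0 a = (\<Prod>m\<in>{1..N}. s0 (a m))" for a
  define D where "D \<xi> S = detI (cfgsH N) (sov_covec N (?T \<xi>) \<xi> S)" for \<xi> S
  define G where "G \<xi> = detI (cfgsH N) (gram N \<eta> \<xi> (Khat K2))" for \<xi>
  have poly_\<xi>: "polyfun {1..N} (\<lambda>\<xi>. D \<xi> S0 * G \<xi>)"
    unfolding D_def G_def sov
    by (intro polyfun.pmul detI_polyfun finite_cfgsH polyfun_gram polyfun_covq polyfun.pconst polyfun_transfer) auto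
  have poly_S: "polyfun (cfgsH N) (D \<xi>)" for \<xi>
  proof -
    have "D \<xi> = (\<lambda>S. detI (cfgsH N) (\<lambda>h a. covq N (\<lambda>n. ?T \<xi> (\<xi> n)) S h N a))"
      by (rule ext) (simp only: D_def sov)
    then show ?thesis
      by (simp only:) (intro detI_polyfun finite_cfgsH polyfun_covq polyfun.pvar polyfun.pconst; simp)
  qed
  have "eventually (\<lambda>s. D (ray s) S0 \<noteq> 0 \<and> G (ray s) \<noteq> 0) at_top"
    unfolding D_def G_def sov S0_def
    by (intro eventually_conj eventually_sov eventually_gram[OF assms(2) tr det assms(4,5)] assms(2) s0)
  then obtain s where s: "D (ray s) S0 * G (ray s) \<noteq> 0"
    using eventually_happens by fastforce
  show ?thesis
  \<comment> \<open>The first factor makes the separate covectors for \<open>S0\<close> a basis, the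
    second makes the trace form nondegenerate.\<close>
  proof (intro exI[of _ "\<lambda>\<xi>. D \<xi> S0 * G \<xi>"] conjI allI impI)
    show "polyfun {1..N} (\<lambda>\<xi>. D \<xi> S0 * G \<xi>)" by (rule poly_\<xi>)
    show "\<exists>\<xi>0. D \<xi>0 S0 * G \<xi>0 \<noteq> 0" using s by blast
  next
    fix \<xi> assume "D \<xi> S0 * G \<xi> \<noteq> 0 \<and> nonres N \<eta> \<xi>"
    then have nz: "D \<xi> S0 \<noteq> 0" "G \<xi> \<noteq> 0" and nr: "nonres N \<eta> \<xi>" by auto
    have shift: "\<xi> a - \<xi> b \<noteq> of_int k * \<eta>" if "a \<in> {1..N}" "b \<in> {1..N}" "a \<noteq> b" for a b k
      using nr that unfolding nonres_def by blast
    interpret twisted_chain N \<eta> \<xi> K2 k2 k3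
    proof
      show "0 < N" using assms(1) by simp
      show "inj_on \<xi> {1..N}"
        using shift[where k = 0] by (intro inj_onI) auto
      fix a b assume ab: "a \<in> {1..N}" "b \<in> {1..N}"
      show "\<xi> a + \<eta> \<noteq> \<xi> b"
        \<comment> \<open>For equal indices the claim is that \<eta> is nonzero; otherwise the
          integer -1 in the non-resonance condition applies.\<close>
        using shift[OF ab, where k = "-1"] assms(2) by (cases "a = b") (auto simp: algebra_simps)
    qed (use assms(2) nr tr det in auto)
    show "eigvals N (?T \<xi>) = Sigma_set N \<eta> \<xi> k2 k3"
      using eigenvalues nz(1) unfolding D_def .
    show "diag_simple N (?T \<xi>)"
      using diagonalizable_simple nz unfolding D_def G_def by blast
    show "\<exists>Q. polyfun (cfgsH N) Q \<and> (\<exists>S0. Q S0 \<noteq> 0) \<and>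
        (\<forall>S. Q S \<noteq> 0 \<longrightarrow>
          (\<forall>c. (\<forall>a\<in>cfgsH N. (\<Sum>h\<in>cfgsH N. c h * sov_covec N (?T \<xi>) \<xi> S h a) = 0)
               \<longrightarrow> (\<forall>h\<in>cfgsH N. c h = 0)) \<and>
          (\<forall>t\<in>Sigma_set N \<eta> \<xi> k2 k3. \<exists>v. joint_eigvec N (?T \<xi>) t v \<and>
             (\<forall>h\<in>cfgsH N. pairing N (sov_covec N (?T \<xi>) \<xi> S h) v
                = (\<Prod>n\<in>{1..N}. t (\<xi> n) ^ h n))))"
    \<comment> \<open>For fixed \<xi> the same determinant, now as a polynomial in the entries of
      \<open>S\<close>; \<open>S0\<close> shows that it is not identically zero.\<close>
    proof (intro exI[of _ "D \<xi>"] conjI allI impI ballI)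
      show "polyfun (cfgsH N) (D \<xi>)" by (rule poly_S)
      show "\<exists>S0. D \<xi> S0 \<noteq> 0" using nz by blast
    next
      fix S c h
      assume "D \<xi> S \<noteq> 0" "\<forall>a\<in>cfgsH N. (\<Sum>h\<in>cfgsH N. c h * sov_covec N (?T \<xi>) \<xi> S h a) = 0" "h \<in> cfgsH N"
      then show "c h = 0" using separate_basis(1) unfolding D_def by blast
    next
      fix S \<tau> assume "D \<xi> S \<noteq> 0" "\<tau> \<in> Sigma_set N \<eta> \<xi> k2 k3"
      then show "\<exists>v. joint_eigvec N (?T \<xi>) \<tau> v \<and>
          (\<forall>h\<in>cfgsH N. pairing N (sov_covec N (?T \<xi>) \<xi> S h) v = (\<Prod>n\<in>{1..N}. \<tau> (\<xi> n) ^ h n))"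
        using separate_basis(2) unfolding D_def by blast
    qed
  qed
qed

end
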